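(* Let integers $d\ge1$, $p\ge2$ and $k>d$ vary along a sequence such that $1\ll k\lesssim d\log p$. Let $\zeta:=\tfrac1k(k-d)\log p$, and let $t_0$ and $s_0:=t_0/k$ be the entropic times for $\mathbb{Z}_p^d$, for either the simple or the directed walk. The following hold: \begin{itemize} \item if $\zeta\ll1$, then $t_0/k=s_0\sim\tfrac12\log(1/\zeta)\big/\bigl(1-\cos(2\pi/p)\bigr)$; \item if $\zeta\gtrsim1$, then $t_0/k=s_0\asymp p^2e^{-2\zeta}=(p^d)^{2/k}$; \item further, if in fact $1\ll k\ll d\log p$ and $\zeta\gg1$, then $t_0/k=s_0\sim p^2e^{-2\zeta}/(2\pi e)=(p^d)^{2/k}/(2\pi e)$. \end{itemize} Note that, as $p\to\infty$, $1-\cos(2\pi/p)\sim 2\pi^2/p^2=2\pi^2p^{-2d/k}e^{-2\zeta}$.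
   Context: Asymptotic notation (along the sequence): $a\ll b$ (equivalently $b\gg a$) means $a/b\to0$; $a\lesssim b$ (equivalently $b\gtrsim a$) means $a\le Cb$ for a constant $C$; $a\asymp b$ means both $a\lesssim b$ and $b\lesssim a$; $a\sim b$ means $a/b\to1$. The integer $p$ need not be prime. The rate-1 random walk on $\mathbb{Z}_p^k$ started at $0$ jumps at rate 1; at each jump it chooses a uniformly random coordinate and adds to it (mod $p$) either $\pm1$ with probability $1/2$ each (simple walk) or always $+1$ (directed walk). Let $h(t)$ be the Shannon entropy (natural logarithm) of its position at time $t$. The entropic time $t_0$ is defined by $h(t_0)=d\log p$. Equivalently $s_0=t_0/k$ satisfies $R(s_0)=\zeta$, where $R(s)=\log p-H(s)$ and $H(s)$ is the Shannon entropy at time $s$ of the corresponding rate-1 walk on $\mathbb{Z}_p$. *)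

theory Defs
  imports "HOL-Probability.Probability" "HOL-Library.Landau_Symbols"
begin

definition shannon_entropy :: "'a pmf \<Rightarrow> real" where
  "shannon_entropy P = prob_space.entropy (measure_pmf P) (exp 1) (count_space UNIV) (\<lambda>x. x)"

lemma shannon_entropy_eq:
  fixes P :: "'a::countable pmf"
  assumes "finite (set_pmf P)"
  shows "shannon_entropy P = - (\<Sum>x\<in>set_pmf P. pmf P x * ln (pmf P x))"
proof -
  interpret information_space "measure_pmf P" "exp 1"
    by unfold_locales simp
  interpret C: sigma_finite_measure "count_space (UNIV :: 'a set)"
    by (rule sigma_finite_measure_count_space)
  have D: "distributed (measure_pmf P) (count_space UNIV) (\<lambda>x. x) (\<lambda>x. ennreal (pmf P x))"
    unfolding distributed_def
    by (auto simp: distr_id2 measure_pmf_eq_density[symmetric])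
  have "shannon_entropy P = - (\<integral>x. pmf P x * log (exp 1) (pmf P x) \<partial>count_space UNIV)"
    unfolding shannon_entropy_def by (rule entropy_distr[OF D]) simp
  also have "(\<integral>x. pmf P x * log (exp 1) (pmf P x) \<partial>count_space UNIV) =
      (\<Sum>x\<in>set_pmf P. pmf P x * ln (pmf P x))"
  proof -
    let ?f = "\<lambda>x. pmf P x * log (exp 1) (pmf P x)"
    have sub: "{x \<in> UNIV. ?f x \<noteq> 0} \<subseteq> set_pmf P"
      by (auto simp: set_pmf_iff)
    then have "(\<integral>x. ?f x \<partial>count_space UNIV) = (\<Sum>x\<in>{x \<in> UNIV. ?f x \<noteq> 0}. ?f x)"
      using assms finite_subset by (intro lebesgue_integral_count_space_finite_support) blast
    also have "\<dots> = (\<Sum>x\<in>set_pmf P. ?f x)"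
      using sub assms by (intro sum.mono_neutral_left) auto
    finally show ?thesis by (simp add: log_def)
  qed
  finally show ?thesis .
qed

datatype walk = Simple | Directed

fun increment :: "walk \<Rightarrow> int pmf" where
  "increment Simple = pmf_of_set {-1, 1}"
| "increment Directed = return_pmf 1"

text \<open>
  Points of \<open>\<int>\<^sub>p\<^sup>k\<close> are lists of length \<open>k\<close> with entries in \<open>{0..<p}\<close>.
\<close>

definition jump :: "walk \<Rightarrow> nat \<Rightarrow> nat \<Rightarrow> int list \<Rightarrow> int list pmf" where
  "jump w p k x =
    bind_pmf (pmf_of_set {..<k}) (\<lambda>i.
      map_pmf (\<lambda>e. x[i := (x ! i + e) mod int p]) (increment w))"

primrec position_after_jumps :: "walk \<Rightarrow> nat \<Rightarrow> nat \<Rightarrow> nat \<Rightarrow> int list pmf" where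
  "position_after_jumps w p k 0 = return_pmf (replicate k 0)"
| "position_after_jumps w p k (Suc n) = bind_pmf (position_after_jumps w p k n) (jump w p k)"

text \<open>
  The number of jumps made by time \<open>t\<close> is Poisson with mean \<open>t\<close>, independently of the jumps
  themselves. Since \<^const>\<open>poisson_pmf\<close> is specified only for positive means, time \<open>0\<close> is
  treated separately.
\<close>

definition jump_count :: "real \<Rightarrow> nat pmf" where
  "jump_count t = (if t > 0 then poisson_pmf t else return_pmf 0)"

definition position :: "walk \<Rightarrow> nat \<Rightarrow> nat \<Rightarrow> real \<Rightarrow> int list pmf" where
  "position w p k t = bind_pmf (jump_count t) (position_after_jumps w p k)"

definition walk_entropy :: "walk \<Rightarrow> nat \<Rightarrow> nat \<Rightarrow> real \<Rightarrow> real" where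
  "walk_entropy w p k t = shannon_entropy (position w p k t)"

definition entropic_time :: "walk \<Rightarrow> nat \<Rightarrow> nat \<Rightarrow> nat \<Rightarrow> real" where
  "entropic_time w d p k = (THE t. t \<ge> 0 \<and> walk_entropy w p k t = real d * ln (real p))"

end

theory Submission
  imports Defs "HOL-Real_Asymp.Real_Asymp"
begin

text \<open>
  The number of jumps is Poisson, so the \<open>k\<close> coordinates of the position at time \<open>t\<close> are
  independent, each a rate-1 walk on the cycle run for time \<open>t / k\<close>
  (\<open>position_eq_replicate_pmf\<close>, proved by comparing Fourier coefficients). Hence
  \<open>h(t) = k H(t / k)\<close>. The entropy \<open>H\<close> on the cycle is continuous and strictly increasing from
  \<open>0\<close> to \<open>ln p\<close>, so the entropic time is well defined and \<open>s = t\<^sub>0 / k\<close> solves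
  \<open>ln p - H(s) = \<zeta>\<close> (\<open>entropic_time_characterization\<close>). What remains is to understand \<open>H(s)\<close>
  uniformly in \<open>p\<close>.

  The Fourier coefficient of the law on the cycle at frequency \<open>2 \<pi> j / p\<close> has modulus
  \<open>exp (- s (1 - cos (2 \<pi> j / p)))\<close>, for the simple and for the directed walk alike. Let
  \<open>R = ln p - H(s)\<close>. Comparing relative entropy with Hellinger distance bounds \<open>R\<close> from below by a
  multiple of the squared first coefficient; Jensen and Parseval bound it from above by the
  logarithm of the sum of all squared coefficients. For small \<open>R\<close> that sum is dominated by its
  first terms, so \<open>R\<close> is \<open>exp (- 2 s (1 - cos (2 \<pi> / p)))\<close> up to a constant factor
  (\<open>entropy_deficit_bounds\<close>), and taking logarithms gives the case \<open>\<zeta> \<rightarrow> 0\<close>. In general the same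
  sum is at most \<open>1 + 2 p / sqrt s\<close>, which bounds \<open>s\<close> above by a multiple of
  \<open>p\<^sup>2 exp (- 2 \<zeta>) = exp (2 H)\<close> as soon as \<open>\<zeta>\<close> stays away from \<open>0\<close> (\<open>sqrt_time_le\<close>).

  Conversely, the walk has variance \<open>s\<close>, and a Gaussian has the largest entropy for a given
  variance: \<open>H(s) \<le> ln (2 \<pi> e s) / 2 + 1 / (8 s)\<close> (\<open>cyclic_entropy_le_gaussian\<close>). Together with the
  fact that \<open>H(s) = d ln p / k\<close>, which is bounded below, keeps \<open>s\<close> away from \<open>0\<close>, this gives the order of
  magnitude of \<open>s\<close> when \<open>\<zeta>\<close> is bounded below. If moreover \<open>\<zeta>\<close> and \<open>H\<close> tend to infinity, then \<open>s \<rightarrow> \<infinity>\<close> while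
  \<open>sqrt s / p \<rightarrow> 0\<close>; in this regime a local limit theorem shows that the Gaussian bound is attained
  asymptotically (\<open>cyclic_entropy_ge_gaussian\<close>), so \<open>2 \<pi> e s / exp (2 H) \<rightarrow> 1\<close>.
\<close>

section \<open>The walk on the integers and its characters\<close>

text \<open>
  Adding the bound \<open>B\<close> makes the integrand nonnegative, and nonnegative integrands can be
  integrated over a mixture without any integrability condition.
\<close>

lemma expectation_bind_pmf_real:
  fixes f :: "'b \<Rightarrow> real"
  assumes B: "\<And>y. \<bar>f y\<bar> \<le> B"
  shows "measure_pmf.expectation (bind_pmf P g) f
    = measure_pmf.expectation P (\<lambda>x. measure_pmf.expectation (g x) f)"
proof -
  have int: "integrable (measure_pmf Q) f" for Q :: "'b pmf"
    by (rule measure_pmf.integrable_const_bound[where B = B]) (use B in auto)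
  have nn: "0 \<le> f y + B" for y
    using B[of y] by linarith
  have shift: "measure_pmf.expectation Q (\<lambda>y. f y + B) = measure_pmf.expectation Q f + B"
    for Q :: "'b pmf"
    using int by simp
  have E: "(\<integral>\<^sup>+ y. ennreal (f y + B) \<partial>measure_pmf Q)
      = ennreal (measure_pmf.expectation Q f + B)" for Q :: "'b pmf"
    using int nn by (subst nn_integral_eq_integral) auto
  have pos: "0 \<le> measure_pmf.expectation Q f + B" for Q :: "'b pmf"
    unfolding shift[symmetric] by (intro integral_nonneg_AE) (use nn in auto)
  have bound: "\<bar>measure_pmf.expectation Q f\<bar> \<le> B" for Q :: "'b pmf"
  proof -
    have "\<bar>measure_pmf.expectation Q f\<bar> \<le> measure_pmf.expectation Q (\<lambda>y. \<bar>f y\<bar>)"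
      by (rule integral_abs_bound)
    also have "\<dots> \<le> measure_pmf.expectation Q (\<lambda>y. B)"
      using int B by (intro integral_mono) auto
    finally show ?thesis by simp
  qed
  have int2: "integrable (measure_pmf P) (\<lambda>x. measure_pmf.expectation (g x) f)"
    by (rule measure_pmf.integrable_const_bound[where B = B]) (use bound in auto)
  have "0 \<le> measure_pmf.expectation P (\<lambda>x. measure_pmf.expectation (g x) f + B)"
    by (intro integral_nonneg_AE) (use pos in auto)
  then have pos2: "0 \<le> measure_pmf.expectation P (\<lambda>x. measure_pmf.expectation (g x) f) + B"
    using int2 by simp
  have "ennreal (measure_pmf.expectation (bind_pmf P g) f + B)
      = (\<integral>\<^sup>+ x. ennreal (measure_pmf.expectation (g x) f + B) \<partial>measure_pmf P)"
    unfolding E[symmetric] by simp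
  also have "\<dots> = ennreal (measure_pmf.expectation P (\<lambda>x. measure_pmf.expectation (g x) f) + B)"
    using int2 pos by (subst nn_integral_eq_integral) auto
  finally have "measure_pmf.expectation (bind_pmf P g) f + B
      = measure_pmf.expectation P (\<lambda>x. measure_pmf.expectation (g x) f) + B"
    using pos[of "bind_pmf P g"] pos2 by (simp add: ennreal_inj)
  then show ?thesis by simp
qed

lemma expectation_bind_pmf:
  fixes f :: "'b \<Rightarrow> complex"
  assumes B: "\<And>y. norm (f y) \<le> B"
  shows "measure_pmf.expectation (bind_pmf P g) f
    = measure_pmf.expectation P (\<lambda>x. measure_pmf.expectation (g x) f)"
proof -
  have int: "integrable (measure_pmf Q) f" for Q :: "'b pmf"
    by (rule measure_pmf.integrable_const_bound[where B = B]) (use B in auto)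
  have bound: "norm (measure_pmf.expectation Q f) \<le> B" for Q :: "'b pmf"
  proof -
    have "norm (measure_pmf.expectation Q f) \<le> measure_pmf.expectation Q (\<lambda>y. norm (f y))"
      by (rule integral_norm_bound)
    also have "\<dots> \<le> measure_pmf.expectation Q (\<lambda>y. B)"
      using int B by (intro integral_mono) auto
    finally show ?thesis by simp
  qed
  have int2: "integrable (measure_pmf P) (\<lambda>x. measure_pmf.expectation (g x) f)"
    by (rule measure_pmf.integrable_const_bound[where B = B]) (use bound in auto)
  have Re: "measure_pmf.expectation (bind_pmf P g) (\<lambda>y. Re (f y))
      = measure_pmf.expectation P (\<lambda>x. measure_pmf.expectation (g x) (\<lambda>y. Re (f y)))"
    by (rule expectation_bind_pmf_real[where B = B]) (meson B abs_Re_le_cmod order.trans)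
  have Im: "measure_pmf.expectation (bind_pmf P g) (\<lambda>y. Im (f y))
      = measure_pmf.expectation P (\<lambda>x. measure_pmf.expectation (g x) (\<lambda>y. Im (f y)))"
    by (rule expectation_bind_pmf_real[where B = B]) (meson B abs_Im_le_cmod order.trans)
  show ?thesis
    using Re Im int int2 by (simp add: complex_eq_iff)
qed

text \<open>
  The generating function of the Poisson law. It converts the character of \<open>n\<close> jumps, which is an
  \<open>n\<close>-th power, into the character at a given time, which is an exponential.
\<close>

lemma expectation_jump_count_power:
  fixes a :: complex
  assumes "0 \<le> s" "norm a \<le> 1"
  shows "measure_pmf.expectation (jump_count s) (\<lambda>n. a ^ n) = exp (of_real s * (a - 1))"
proof (cases "s = 0")
  case True
  then show ?thesis by (simp add: jump_count_def)
next
  case False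
  with assms have s: "s > 0" by simp
  have summ: "(\<lambda>n. pmf (poisson_pmf s) n *\<^sub>R a ^ n) sums (exp (of_real s * a) * exp (- of_real s))"
  proof -
    have "(\<lambda>n. (of_real s * a) ^ n /\<^sub>R fact n * exp (- of_real s)) sums
        (exp (of_real s * a) * exp (- of_real s))"
      by (intro sums_mult2 exp_converges)
    moreover have "(of_real s * a) ^ n /\<^sub>R fact n * exp (- of_real s)
        = pmf (poisson_pmf s) n *\<^sub>R a ^ n" for n
      using s by (simp add: scaleR_conv_of_real power_mult_distrib field_simps exp_of_real[symmetric])
    ultimately show ?thesis by simp
  qed
  have int: "integrable (count_space UNIV) (\<lambda>n. pmf (poisson_pmf s) n *\<^sub>R a ^ n)"
  proof (rule Bochner_Integration.integrable_bound[OF integrable_pmf[of UNIV "poisson_pmf s"]])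
    show "AE n in count_space UNIV. norm (pmf (poisson_pmf s) n *\<^sub>R a ^ n) \<le> norm (pmf (poisson_pmf s) n)"
      using assms by (auto simp: norm_power power_le_one intro!: mult_left_le)
  qed auto
  have "measure_pmf.expectation (jump_count s) (\<lambda>n. a ^ n)
      = (\<integral>n. pmf (poisson_pmf s) n *\<^sub>R a ^ n \<partial>count_space UNIV)"
    using s by (simp add: jump_count_def measure_pmf_eq_density integral_density)
  also have "\<dots> = (\<Sum>n. pmf (poisson_pmf s) n *\<^sub>R a ^ n)"
    by (rule integral_count_space_nat[OF int])
  also have "\<dots> = exp (of_real s * a) * exp (- of_real s)"
    using summ by (rule sums_unique[symmetric])
  also have "\<dots> = exp (of_real s * (a - 1))"
    by (simp add: exp_add[symmetric] algebra_simps)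
  finally show ?thesis .
qed

definition step_char :: "walk \<Rightarrow> real \<Rightarrow> complex" where
  "step_char w \<theta> = measure_pmf.expectation (increment w) (\<lambda>e. cis (\<theta> * of_int e))"

lemma step_char_simps:
  "step_char Simple \<theta> = of_real (cos \<theta>)" "step_char Directed \<theta> = cis \<theta>"
proof -
  have "step_char Simple \<theta> = (cis (- \<theta>) + cis \<theta>) / 2"
    unfolding step_char_def increment.simps
    by (subst integral_measure_pmf[of "{-1, 1}"]) (auto simp: scaleR_conv_of_real)
  then show "step_char Simple \<theta> = of_real (cos \<theta>)"
    by (simp add: complex_eq_iff)
qed (simp add: step_char_def)

text \<open>
  The modulus of a Fourier coefficient depends on the real part only; this is why the simple and
  the directed walk obey the same asymptotics.
\<close>

lemma Re_step_char: "Re (step_char w \<theta>) = cos \<theta>"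
  by (cases w) (auto simp: step_char_simps)

lemma norm_step_char_le: "norm (step_char w \<theta>) \<le> 1"
  by (cases w) (auto simp: step_char_simps)

text \<open>
  The walk before reduction modulo \<open>p\<close>. Moments and the comparison with Gaussian laws make sense on
  the integers only, and every function on the cycle pulls back to the integers.
\<close>

primrec int_walk :: "walk \<Rightarrow> nat \<Rightarrow> int pmf" where
  "int_walk w 0 = return_pmf 0"
| "int_walk w (Suc n) = bind_pmf (int_walk w n) (\<lambda>z. map_pmf (\<lambda>e. z + e) (increment w))"

definition int_position :: "walk \<Rightarrow> real \<Rightarrow> int pmf" where
  "int_position w s = bind_pmf (jump_count s) (int_walk w)"

lemma char_int_walk:
  "measure_pmf.expectation (int_walk w n) (\<lambda>z. cis (\<theta> * of_int z)) = step_char w \<theta> ^ n"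
proof (induction n)
  case (Suc n)
  have "measure_pmf.expectation (int_walk w (Suc n)) (\<lambda>z. cis (\<theta> * of_int z))
      = measure_pmf.expectation (int_walk w n) (\<lambda>z. measure_pmf.expectation (increment w)
          (\<lambda>e. cis (\<theta> * of_int z) * cis (\<theta> * of_int e)))"
    by (simp add: expectation_bind_pmf[where B = 1] cis_mult algebra_simps)
  also have "\<dots> = measure_pmf.expectation (int_walk w n) (\<lambda>z. cis (\<theta> * of_int z)) * step_char w \<theta>"
    by (simp add: step_char_def)
  finally show ?case using Suc by simp
qed simp

lemma char_int_position:
  assumes "0 \<le> s"
  shows "measure_pmf.expectation (int_position w s) (\<lambda>z. cis (\<theta> * of_int z))
    = exp (of_real s * (step_char w \<theta> - 1))"
  unfolding int_position_def
  by (simp add: expectation_bind_pmf[where B = 1] char_int_walk expectation_jump_count_power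
      assms norm_step_char_le)

lemma norm_char_position:
  "norm (exp (of_real s * (step_char w \<theta> - 1))) = exp (- s * (1 - cos \<theta>))"
  by (simp add: Re_step_char algebra_simps)

definition angle :: "nat \<Rightarrow> int \<Rightarrow> real" where
  "angle p j = 2 * pi * of_int j / real p"

lemma cis_2pi_int: "cis (2 * (pi * of_int m)) = 1"
proof -
  have "cis (2 * pi * of_int m) = 1" by (simp only: cis_multiple_2pi Ints_of_int)
  then show ?thesis by (simp only: mult.assoc)
qed

lemma sum_cis_roots:
  assumes "p > 0"
  shows "(\<Sum>j\<in>{0..<int p}. cis (angle p j * of_int z)) = (if int p dvd z then of_nat p else 0)"
proof -
  define x where "x = cis (2 * pi * of_int z / real p)"
  have "(\<Sum>j\<in>{0..<int p}. cis (angle p j * of_int z)) = (\<Sum>j\<in>{..<p}. cis (angle p (int j) * of_int z))"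
    by (rule sum.reindex_bij_witness[of _ int nat]) auto
  also have "\<dots> = (\<Sum>j\<in>{..<p}. x ^ j)"
  proof (intro sum.cong refl)
    fix j
    have "angle p (int j) * of_int z = real j * (2 * pi * of_int z / real p)"
      by (simp add: angle_def)
    then show "cis (angle p (int j) * of_int z) = x ^ j"
      by (simp only: x_def Complex.DeMoivre)
  qed
  also have "\<dots> = (if int p dvd z then of_nat p else 0)"
  proof (cases "int p dvd z")
    case True
    then obtain m where "z = int p * m" by (rule dvdE)
    then have "x = 1" using assms by (simp add: x_def cis_2pi_int)
    then show ?thesis using True by simp
  next
    case False
    have "x \<noteq> 1"
    proof
      assume "x = 1"
      then have "cos (2 * pi * of_int z / real p) = 1" by (simp add: x_def complex_eq_iff)
      then obtain m :: int where "2 * pi * of_int z / real p = of_int m * 2 * pi"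
        by (auto simp: cos_one_2pi_int)
      then have "real_of_int z = of_int (m * int p)" using assms by (simp add: field_simps)
      then have "z = m * int p" by (simp only: of_int_eq_iff)
      then show False using False by simp
    qed
    moreover have "x ^ p = 1"
      using assms by (simp add: x_def Complex.DeMoivre cis_2pi_int)
    ultimately show ?thesis using False by (simp add: geometric_sum)
  qed
  finally show ?thesis .
qed

section \<open>Fourier inversion and independence of the coordinates\<close>

definition cyclic_position :: "walk \<Rightarrow> nat \<Rightarrow> real \<Rightarrow> int pmf" where
  "cyclic_position w p s = map_pmf (\<lambda>z. z mod int p) (int_position w s)"

text \<open>
  The Fourier coefficient of the law on the cycle at frequency \<open>angle p j\<close>.
\<close>

definition mode :: "walk \<Rightarrow> nat \<Rightarrow> real \<Rightarrow> int \<Rightarrow> complex" where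
  "mode w p s j = exp (of_real s * (step_char w (angle p j) - 1))"

lemma cis_angle_mod:
  assumes "p > 0"
  shows "cis (angle p j * of_int (z mod int p)) = cis (angle p j * of_int z)"
proof -
  have "z = z mod int p + int p * (z div int p)" by simp
  then have "real_of_int z = of_int (z mod int p) + of_nat p * of_int (z div int p)"
    by (metis of_int_add of_int_mult of_int_of_nat_eq)
  then have "angle p j * of_int z
      = angle p j * of_int (z mod int p) + 2 * pi * of_int (j * (z div int p))"
    using assms by (simp add: angle_def field_simps)
  then show ?thesis
    using cis_2pi_int[of "j * (z div int p)"] by (simp only: cis_mult[symmetric] mult.assoc mult_1_right)
qed

lemma set_cyclic_position: "p > 0 \<Longrightarrow> set_pmf (cyclic_position w p s) \<subseteq> {0..<int p}"
  by (auto simp: cyclic_position_def)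

lemma char_cyclic_position:
  assumes "p > 0" "0 \<le> s"
  shows "measure_pmf.expectation (cyclic_position w p s) (\<lambda>z. cis (angle p j * of_int z)) = mode w p s j"
  using assms by (simp add: cyclic_position_def cis_angle_mod char_int_position mode_def)

lemma expectation_indicator_complex:
  "measure_pmf.expectation P (\<lambda>z. c * indicator {x} z) = c * complex_of_real (pmf P x)"
  by (subst integral_measure_pmf[of "{x}"]) (auto simp: indicator_def scaleR_conv_of_real split: if_splits)

lemma dvd_diff_residues_iff:
  fixes x y m :: int
  assumes "x \<in> {0..<m}" "y \<in> {0..<m}"
  shows "m dvd y - x \<longleftrightarrow> y = x"
  using assms by (auto simp: mod_eq_dvd_iff[symmetric])

text \<open>
  By orthogonality of the characters (\<open>sum_cis_roots\<close>), the sum over \<open>j\<close> is, inside the expectation,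
  \<open>p\<close> times the indicator of \<open>x\<close>.
\<close>

lemma pmf_fourier:
  assumes p: "p > 0" and P: "set_pmf P \<subseteq> {0..<int p}" and x: "x \<in> {0..<int p}"
  shows "complex_of_real (pmf P x) = (\<Sum>j\<in>{0..<int p}. cis (- angle p j * of_int x)
      * measure_pmf.expectation P (\<lambda>z. cis (angle p j * of_int z))) / of_nat p"
proof -
  have int: "integrable (measure_pmf P) (\<lambda>z. cis (angle p j * of_int z))" for j
    by (rule measure_pmf.integrable_const_bound[where B = 1]) auto
  have "(\<Sum>j\<in>{0..<int p}. cis (- angle p j * of_int x)
      * measure_pmf.expectation P (\<lambda>z. cis (angle p j * of_int z)))
    = measure_pmf.expectation P (\<lambda>z. \<Sum>j\<in>{0..<int p}. cis (- angle p j * of_int x)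
      * cis (angle p j * of_int z))"
    using int by (subst Bochner_Integration.integral_sum) auto
  also have "\<dots> = measure_pmf.expectation P (\<lambda>z. of_nat p * indicator {x} z)"
  proof (rule integral_cong_AE)
    show "AE z in P. (\<Sum>j\<in>{0..<int p}. cis (- angle p j * of_int x) * cis (angle p j * of_int z))
        = of_nat p * indicator {x} z"
    proof (unfold AE_measure_pmf_iff, rule ballI)
      fix z assume "z \<in> set_pmf P"
      then have "z \<in> {0..<int p}" using P by auto
      then show "(\<Sum>j\<in>{0..<int p}. cis (- angle p j * of_int x) * cis (angle p j * of_int z))
          = of_nat p * indicator {x} z"
        using sum_cis_roots[OF p, of "z - x"] dvd_diff_residues_iff[OF x, of z]
        by (auto simp: cis_mult algebra_simps)
    qed
  qed auto
  also have "\<dots> = of_nat p * of_real (pmf P x)"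
    by (rule expectation_indicator_complex)
  finally show ?thesis
    using p by simp
qed

lemma pmf_cyclic_position:
  assumes p: "p > 0" and "0 \<le> s"
  shows "complex_of_real (pmf (cyclic_position w p s) (z mod int p))
    = (\<Sum>j\<in>{0..<int p}. cis (- angle p j * of_int z) * mode w p s j) / of_nat p"
proof -
  have "cis (- angle p j * of_int (z mod int p)) = cis (- angle p j * of_int z)" for j
    using cis_angle_mod[OF p, of j z] by (metis cis_cnj minus_mult_left)
  then show ?thesis
    using assms by (subst pmf_fourier[OF p set_cyclic_position[OF p]]) (auto simp: char_cyclic_position)
qed

text \<open>
  The character of \<open>\<int>\<^sub>p\<^sup>k\<close> with frequency vector \<open>g\<close>.
\<close>

definition list_char :: "nat \<Rightarrow> nat \<Rightarrow> (nat \<Rightarrow> int) \<Rightarrow> int list \<Rightarrow> complex" where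
  "list_char p k g x = (\<Prod>i<k. cis (angle p (g i) * of_int (x ! i)))"

lemma norm_list_char: "norm (list_char p k g x) = 1"
  by (simp add: list_char_def prod_norm[symmetric])

lemma list_char_update:
  assumes "p > 0" "i < k" "length x = k"
  shows "list_char p k g (x[i := (x ! i + e) mod int p])
    = list_char p k g x * cis (angle p (g i) * of_int e)"
proof -
  have "list_char p k g (x[i := (x ! i + e) mod int p])
      = (\<Prod>l<k. cis (angle p (g l) * of_int (x ! l)) * (if l = i then cis (angle p (g i) * of_int e) else 1))"
    unfolding list_char_def
  proof (rule prod.cong)
    fix l assume "l \<in> {..<k}"
    then show "cis (angle p (g l) * of_int (x[i := (x ! i + e) mod int p] ! l))
        = cis (angle p (g l) * of_int (x ! l)) * (if l = i then cis (angle p (g i) * of_int e) else 1)"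
      using assms by (auto simp: nth_list_update cis_angle_mod cis_mult algebra_simps)
  qed auto
  also have "\<dots> = list_char p k g x * cis (angle p (g i) * of_int e)"
    using assms by (simp add: prod.distrib list_char_def prod.delta)
  finally show ?thesis .
qed

text \<open>
  A jump changes one factor of a character, by multiplying it with the character of the increment.
  So characters are eigenfunctions of the jump kernel, and the eigenvalue is an average over the
  coordinates.
\<close>

lemma char_jump:
  assumes "p > 0" "k > 0" "length x = k"
  shows "measure_pmf.expectation (jump w p k x) (list_char p k g)
    = list_char p k g x * ((\<Sum>i<k. step_char w (angle p (g i))) / of_nat k)"
proof -
  have "measure_pmf.expectation (jump w p k x) (list_char p k g)
      = measure_pmf.expectation (pmf_of_set {..<k}) (\<lambda>i. measure_pmf.expectation (increment w)
          (\<lambda>e. list_char p k g (x[i := (x ! i + e) mod int p])))"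
    unfolding jump_def by (subst expectation_bind_pmf[where B = 1]) (auto simp: norm_list_char)
  also have "\<dots> = (\<Sum>i<k. (measure_pmf.expectation (increment w)
          (\<lambda>e. list_char p k g (x[i := (x ! i + e) mod int p]))) / of_nat k)"
    using assms
    by (subst integral_measure_pmf[of "{..<k}"]) (auto simp: scaleR_conv_of_real lessThan_empty_iff)
  also have "\<dots> = (\<Sum>i<k. list_char p k g x * step_char w (angle p (g i)) / of_nat k)"
    using assms by (simp add: list_char_update step_char_def)
  also have "\<dots> = list_char p k g x * ((\<Sum>i<k. step_char w (angle p (g i))) / of_nat k)"
    by (simp add: sum_distrib_left sum_divide_distrib)
  finally show ?thesis .
qed

lemma set_position_after_jumps:
  assumes "p > 0"
  shows "x \<in> set_pmf (position_after_jumps w p k n) \<Longrightarrow> length x = k \<and> set x \<subseteq> {0..<int p}"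
proof (induction n arbitrary: x)
  case (Suc n)
  then show ?case
    using assms set_update_subset_insert by (fastforce simp: jump_def)
qed (use assms in auto)

lemma char_position_after_jumps:
  assumes "p > 0" "k > 0"
  shows "measure_pmf.expectation (position_after_jumps w p k n) (list_char p k g)
    = ((\<Sum>i<k. step_char w (angle p (g i))) / of_nat k) ^ n"
proof (induction n)
  case 0
  then show ?case by (simp add: list_char_def)
next
  case (Suc n)
  have "measure_pmf.expectation (position_after_jumps w p k (Suc n)) (list_char p k g)
      = measure_pmf.expectation (position_after_jumps w p k n)
          (\<lambda>x. measure_pmf.expectation (jump w p k x) (list_char p k g))"
    by (simp add: expectation_bind_pmf[where B = 1] norm_list_char)
  also have "\<dots> = measure_pmf.expectation (position_after_jumps w p k n)
          (\<lambda>x. list_char p k g x * ((\<Sum>i<k. step_char w (angle p (g i))) / of_nat k))"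
    by (rule integral_cong_AE)
      (use assms set_position_after_jumps in \<open>auto simp: AE_measure_pmf_iff char_jump\<close>)
  finally show ?case
    using Suc by simp
qed

text \<open>
  The exponential in the Poisson generating function turns the average over the coordinates into a
  product. This is where the independence of the coordinates comes from.
\<close>

lemma char_position:
  assumes "p > 0" "k > 0" "t \<ge> 0"
  shows "measure_pmf.expectation (position w p k t) (list_char p k g)
    = (\<Prod>i<k. mode w p (t / real k) (g i))"
proof -
  define c where "c = (\<Sum>i<k. step_char w (angle p (g i))) / of_nat k"
  have "norm c \<le> (\<Sum>i<k. norm (step_char w (angle p (g i)))) / of_nat k"
    unfolding c_def by (simp add: norm_divide divide_right_mono norm_sum)
  also have "\<dots> \<le> (\<Sum>i<k. 1) / of_nat k"
    by (intro divide_right_mono sum_mono norm_step_char_le) auto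
  finally have c: "norm c \<le> 1" using assms by simp
  have "measure_pmf.expectation (position w p k t) (list_char p k g)
      = measure_pmf.expectation (jump_count t) (\<lambda>n. c ^ n)"
    unfolding position_def using assms
    by (subst expectation_bind_pmf[where B = 1]) (auto simp: norm_list_char char_position_after_jumps c_def)
  also have "\<dots> = exp (of_real t * (c - 1))"
    by (rule expectation_jump_count_power) (use assms c in auto)
  also have "of_real t * (c - 1) = (\<Sum>i<k. of_real (t / real k) * (step_char w (angle p (g i)) - 1))"
  proof -
    have "(\<Sum>i<k. of_real (t / real k) * (step_char w (angle p (g i)) - 1))
        = of_real (t / real k) * ((\<Sum>i<k. step_char w (angle p (g i))) - of_nat k)"
      by (simp only: sum_distrib_left[symmetric] sum_subtractf) simp
    then show ?thesis using assms by (simp add: c_def field_simps)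
  qed
  finally show ?thesis
    by (simp add: exp_sum mode_def)
qed

lemma pmf_list_fourier:
  assumes p: "p > 0"
    and P: "\<And>y. y \<in> set_pmf P \<Longrightarrow> length y = k \<and> set y \<subseteq> {0..<int p}"
    and x: "length x = k" "set x \<subseteq> {0..<int p}"
  shows "complex_of_real (pmf P x) = (\<Sum>g\<in>PiE {..<k} (\<lambda>_. {0..<int p}).
      (\<Prod>i<k. cis (- angle p (g i) * of_int (x ! i))) * measure_pmf.expectation P (list_char p k g))
      / of_nat p ^ k"
proof -
  have int: "integrable (measure_pmf P) (list_char p k g)" for g
    by (rule measure_pmf.integrable_const_bound[where B = 1]) (auto simp: norm_list_char)
  have "(\<Sum>g\<in>PiE {..<k} (\<lambda>_. {0..<int p}).
      (\<Prod>i<k. cis (- angle p (g i) * of_int (x ! i))) * measure_pmf.expectation P (list_char p k g))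
    = measure_pmf.expectation P (\<lambda>y. \<Sum>g\<in>PiE {..<k} (\<lambda>_. {0..<int p}).
      (\<Prod>i<k. cis (- angle p (g i) * of_int (x ! i))) * list_char p k g y)"
    using int by (subst Bochner_Integration.integral_sum) auto
  also have "\<dots> = measure_pmf.expectation P (\<lambda>y. of_nat p ^ k * indicator {x} y)"
  proof (rule integral_cong_AE)
    show "AE y in P. (\<Sum>g\<in>PiE {..<k} (\<lambda>_. {0..<int p}).
        (\<Prod>i<k. cis (- angle p (g i) * of_int (x ! i))) * list_char p k g y)
        = of_nat p ^ k * indicator {x} y"
    proof (unfold AE_measure_pmf_iff, rule ballI)
      fix y assume "y \<in> set_pmf P"
      then have y: "length y = k" "set y \<subseteq> {0..<int p}" using P by auto
      have "(\<Sum>g\<in>PiE {..<k} (\<lambda>_. {0..<int p}).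
          (\<Prod>i<k. cis (- angle p (g i) * of_int (x ! i))) * list_char p k g y)
        = (\<Sum>g\<in>PiE {..<k} (\<lambda>_. {0..<int p}).
          (\<Prod>i<k. cis (angle p (g i) * of_int (y ! i - x ! i))))"
        by (simp add: list_char_def prod.distrib[symmetric] cis_mult algebra_simps)
      also have "\<dots> = (\<Prod>i<k. \<Sum>j\<in>{0..<int p}. cis (angle p j * of_int (y ! i - x ! i)))"
        by (rule prod_sum_PiE[symmetric]) auto
      also have "\<dots> = (\<Prod>i<k. if y ! i = x ! i then of_nat p else 0)"
      proof (intro prod.cong refl)
        fix i assume "i \<in> {..<k}"
        then have "x ! i \<in> set x" "y ! i \<in> set y" using x y by auto
        then have "x ! i \<in> {0..<int p}" "y ! i \<in> {0..<int p}" using x y by blast+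
        then show "(\<Sum>j\<in>{0..<int p}. cis (angle p j * of_int (y ! i - x ! i)))
            = (if y ! i = x ! i then of_nat p else 0)"
          using sum_cis_roots[OF p, of "y ! i - x ! i"] dvd_diff_residues_iff[of "x ! i" "int p" "y ! i"]
          by simp
      qed
      also have "\<dots> = of_nat p ^ k * indicator {x} y"
      proof (cases "y = x")
        case False
        then obtain i where "i < k" "y ! i \<noteq> x ! i" using x y by (auto simp: list_eq_iff_nth_eq)
        then show ?thesis using False by (auto simp: prod_zero_iff)
      qed simp
      finally show "(\<Sum>g\<in>PiE {..<k} (\<lambda>_. {0..<int p}).
          (\<Prod>i<k. cis (- angle p (g i) * of_int (x ! i))) * list_char p k g y)
        = of_nat p ^ k * indicator {x} y" .
    qed
  qed auto
  also have "\<dots> = of_nat p ^ k * of_real (pmf P x)"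
    by (rule expectation_indicator_complex)
  finally show ?thesis
    using p by simp
qed

lemma replicate_pmf_Suc_pair:
  "replicate_pmf (Suc n) P = map_pmf (\<lambda>(x, xs). x # xs) (pair_pmf P (replicate_pmf n P))"
  by (simp add: pair_pmf_def map_bind_pmf map_pmf_def bind_assoc_pmf bind_return_pmf)

lemma pmf_replicate:
  "pmf (replicate_pmf n P) xs = (if length xs = n then (\<Prod>i<n. pmf P (xs ! i)) else 0)"
proof (induction n arbitrary: xs)
  case 0
  then show ?case by (auto simp: pmf_return)
next
  case (Suc n)
  have inj: "inj (\<lambda>(x, xs). x # xs)" by (auto intro!: injI)
  show ?case
  proof (cases xs)
    case Nil
    then show ?thesis
      by (auto simp: pmf_eq_0_set_pmf set_replicate_pmf simp del: replicate_pmf.simps)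
  next
    case (Cons y ys)
    have "pmf (replicate_pmf (Suc n) P) xs
        = pmf (map_pmf (\<lambda>(x, xs). x # xs) (pair_pmf P (replicate_pmf n P))) ((\<lambda>(x, xs). x # xs) (y, ys))"
      unfolding replicate_pmf_Suc_pair Cons by simp
    also have "\<dots> = pmf P y * pmf (replicate_pmf n P) ys"
      by (subst pmf_map_inj'[OF inj]) (simp add: pmf_pair)
    finally show ?thesis
      using Suc by (simp add: Cons prod.lessThan_Suc_shift del: prod.lessThan_Suc)
  qed
qed

text \<open>
  The Fourier coefficients of the position factorise, and Fourier inversion on lists is a product of
  one-dimensional inversions, so the probabilities factorise as well.
\<close>

lemma position_eq_replicate_pmf:
  assumes p: "p > 0" and k: "k > 0" and t: "t \<ge> 0"
  shows "position w p k t = replicate_pmf k (cyclic_position w p (t / real k))"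
proof (rule pmf_eqI)
  fix x
  let ?C = "cyclic_position w p (t / real k)"
  have supp: "length y = k \<and> set y \<subseteq> {0..<int p}" if "y \<in> set_pmf (position w p k t)" for y
  proof -
    have "\<exists>n. y \<in> set_pmf (position_after_jumps w p k n)"
      using that by (auto simp: position_def)
    then obtain n where "y \<in> set_pmf (position_after_jumps w p k n)" ..
    then show ?thesis by (rule set_position_after_jumps[OF p])
  qed
  show "pmf (position w p k t) x = pmf (replicate_pmf k ?C) x"
  proof (cases "length x = k \<and> set x \<subseteq> {0..<int p}")
    case False
    then have "x \<notin> set_pmf (position w p k t)" using supp by blast
    moreover have "x \<notin> set_pmf (replicate_pmf k ?C)"
      using False set_cyclic_position[OF p, of w "t / real k"] by (auto simp: set_replicate_pmf)
    ultimately show ?thesis by (simp add: set_pmf_iff)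
  next
    case True
    have xi: "x ! i mod int p = x ! i" if "i < k" for i
    proof -
      have "x ! i \<in> set x" using True that by auto
      then have "x ! i \<in> {0..<int p}" using True by blast
      then show ?thesis by simp
    qed
    have "complex_of_real (pmf (position w p k t) x)
        = (\<Sum>g\<in>PiE {..<k} (\<lambda>_. {0..<int p}). (\<Prod>i<k. cis (- angle p (g i) * of_int (x ! i)))
            * (\<Prod>i<k. mode w p (t / real k) (g i))) / of_nat p ^ k"
      using True by (subst pmf_list_fourier[OF p supp]) (auto simp: char_position[OF p k t])
    also have "\<dots> = (\<Prod>i<k. \<Sum>j\<in>{0..<int p}. cis (- angle p j * of_int (x ! i))
            * mode w p (t / real k) j) / of_nat p ^ k"
      by (subst prod_sum_PiE) (auto simp: prod.distrib)
    also have "\<dots> = (\<Prod>i<k. complex_of_real (pmf ?C (x ! i mod int p)))"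
      using t by (simp add: pmf_cyclic_position[OF p] prod_dividef)
    also have "\<dots> = complex_of_real (pmf (replicate_pmf k ?C) x)"
      using True xi by (simp add: pmf_replicate)
    finally show ?thesis by (simp only: of_real_eq_iff)
  qed
qed

lemma shannon_entropy_map_inj:
  fixes P :: "'a :: countable pmf" and f :: "'a \<Rightarrow> 'b :: countable"
  assumes "finite (set_pmf P)" "inj f"
  shows "shannon_entropy (map_pmf f P) = shannon_entropy P"
  using assms
  by (simp add: shannon_entropy_eq sum.reindex inj_on_subset[OF assms(2)] pmf_map_inj')

lemma shannon_entropy_pair:
  fixes P :: "'a :: countable pmf" and Q :: "'b :: countable pmf"
  assumes P: "finite (set_pmf P)" and Q: "finite (set_pmf Q)"
  shows "shannon_entropy (pair_pmf P Q) = shannon_entropy P + shannon_entropy Q"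
proof -
  have "(\<Sum>z\<in>set_pmf P \<times> set_pmf Q. pmf (pair_pmf P Q) z * ln (pmf (pair_pmf P Q) z))
      = (\<Sum>x\<in>set_pmf P. \<Sum>y\<in>set_pmf Q. pmf Q y * (pmf P x * ln (pmf P x))
          + pmf P x * (pmf Q y * ln (pmf Q y)))"
    unfolding sum.cartesian_product
    by (intro sum.cong refl) (auto simp: pmf_pair ln_mult pmf_positive algebra_simps)
  also have "\<dots> = (\<Sum>x\<in>set_pmf P. pmf P x * ln (pmf P x)) + (\<Sum>y\<in>set_pmf Q. pmf Q y * ln (pmf Q y))"
    using P Q by (simp add: sum.distrib sum_distrib_right[symmetric] sum_distrib_left[symmetric] sum_pmf_eq_1)
  finally show ?thesis
    using P Q by (simp add: shannon_entropy_eq)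
qed

lemma shannon_entropy_replicate:
  fixes P :: "'a :: countable pmf"
  assumes "finite (set_pmf P)"
  shows "finite (set_pmf (replicate_pmf n P)) \<and> shannon_entropy (replicate_pmf n P) = real n * shannon_entropy P"
proof (induction n)
  case 0
  then show ?case by (simp add: shannon_entropy_eq)
next
  case (Suc n)
  have inj: "inj (\<lambda>(x :: 'a, xs). x # xs)" by (auto intro!: injI)
  show ?case
    unfolding replicate_pmf_Suc_pair using Suc assms
    by (simp add: shannon_entropy_map_inj[OF _ inj] shannon_entropy_pair algebra_simps)
qed

definition cyclic_entropy :: "walk \<Rightarrow> nat \<Rightarrow> real \<Rightarrow> real" where
  "cyclic_entropy w p s = - (\<Sum>x\<in>{0..<int p}. pmf (cyclic_position w p s) x * ln (pmf (cyclic_position w p s) x))"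

lemma walk_entropy_eq:
  assumes "p > 0" "k > 0" "t \<ge> 0"
  shows "walk_entropy w p k t = real k * cyclic_entropy w p (t / real k)"
proof -
  let ?C = "cyclic_position w p (t / real k)"
  have fin: "finite (set_pmf ?C)"
    using set_cyclic_position[OF assms(1)] finite_subset by blast
  have "shannon_entropy ?C = cyclic_entropy w p (t / real k)"
    unfolding shannon_entropy_eq[OF fin] cyclic_entropy_def
    using set_cyclic_position[OF assms(1)]
    by (intro arg_cong[where f = uminus] sum.mono_neutral_left) (auto simp: set_pmf_iff)
  then show ?thesis
    unfolding walk_entropy_def position_eq_replicate_pmf[OF assms]
    using shannon_entropy_replicate[OF fin] by simp
qed

section \<open>Entropy on the cycle and the entropic time\<close>

abbreviation cyclic_prob :: "walk \<Rightarrow> nat \<Rightarrow> real \<Rightarrow> int \<Rightarrow> real" where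
  "cyclic_prob w p s \<equiv> pmf (cyclic_position w p s)"

text \<open>
  Relative entropy dominates the squared Hellinger distance, because \<open>ln r \<le> r - 1\<close> at
  \<open>r = sqrt (b / a)\<close>. It is used for the lower bound on the entropy deficit and for the strict growth
  of the entropy.
\<close>

lemma gibbs_hellinger:
  fixes a b :: "'a \<Rightarrow> real"
  assumes "\<And>x. x \<in> A \<Longrightarrow> 0 \<le> a x" "\<And>x. x \<in> A \<Longrightarrow> 0 \<le> b x"
    and ac: "\<And>x. x \<in> A \<Longrightarrow> b x = 0 \<Longrightarrow> a x = 0"
    and "sum a A = 1" "sum b A = 1"
  shows "(\<Sum>x\<in>A. (sqrt (a x) - sqrt (b x))\<^sup>2) \<le> (\<Sum>x\<in>A. a x * ln (a x / b x))"
proof -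
  have *: "2 * (a x - sqrt (a x) * sqrt (b x)) \<le> a x * ln (a x / b x)" if x: "x \<in> A" for x
  proof (cases "a x = 0")
    case False
    then have "a x > 0" "b x \<noteq> 0" using assms(1)[OF x] ac[OF x] by auto
    then have pos: "a x > 0" "b x > 0" using assms(2)[OF x] by auto
    define r where "r = sqrt (b x) / sqrt (a x)"
    have r: "r > 0" using pos by (simp add: r_def)
    have "ln (a x / b x) = - 2 * ln r"
      using pos by (simp add: r_def ln_div ln_sqrt)
    moreover have "ln r \<le> r - 1" using r by (rule ln_le_minus_one)
    ultimately have "a x * (2 * (1 - r)) \<le> a x * ln (a x / b x)"
      using pos by (intro mult_left_mono) auto
    moreover have "a x * r = sqrt (a x) * sqrt (b x)"
      using pos by (simp add: r_def field_simps)
    ultimately show ?thesis by (simp add: algebra_simps)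
  qed simp
  have "(\<Sum>x\<in>A. (sqrt (a x) - sqrt (b x))\<^sup>2) = (\<Sum>x\<in>A. a x + b x - 2 * (sqrt (a x) * sqrt (b x)))"
    by (intro sum.cong refl) (use assms(1,2) in \<open>simp add: power2_diff\<close>)
  also have "\<dots> = (\<Sum>x\<in>A. 2 * (a x - sqrt (a x) * sqrt (b x)))"
    using assms(4,5) by (simp add: sum.distrib sum_subtractf sum_distrib_left[symmetric])
  also have "\<dots> \<le> (\<Sum>x\<in>A. a x * ln (a x / b x))"
    by (intro sum_mono *)
  finally show ?thesis .
qed

lemma gibbs_le:
  fixes a b :: "'a \<Rightarrow> real"
  assumes "\<And>x. x \<in> A \<Longrightarrow> 0 \<le> a x" "\<And>x. x \<in> A \<Longrightarrow> 0 < b x"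
    and "sum a A = 1" "sum b A \<le> 1"
  shows "- (\<Sum>x\<in>A. a x * ln (a x)) \<le> - (\<Sum>x\<in>A. a x * ln (b x))"
proof -
  have "a x * ln (b x) - a x * ln (a x) \<le> b x - a x" if x: "x \<in> A" for x
  proof (cases "a x = 0")
    case False
    then have pos: "a x > 0" "b x > 0" using assms(1,2)[OF x] by auto
    have "ln (b x / a x) \<le> b x / a x - 1" using pos by (intro ln_le_minus_one) auto
    then have "a x * ln (b x / a x) \<le> a x * (b x / a x - 1)" using pos by (intro mult_left_mono) auto
    also have "a x * (b x / a x - 1) = b x - a x" using pos by (simp add: field_simps)
    finally show ?thesis using pos by (simp add: ln_div algebra_simps)
  qed (use assms(2)[OF x] in simp)
  then have "(\<Sum>x\<in>A. a x * ln (b x) - a x * ln (a x)) \<le> (\<Sum>x\<in>A. b x - a x)"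
    by (rule sum_mono)
  then show ?thesis using assms(3,4) by (simp add: sum_subtractf)
qed

lemma sum_cyclic_prob: "p > 0 \<Longrightarrow> sum (cyclic_prob w p s) {0..<int p} = 1"
  by (intro sum_pmf_eq_1 set_cyclic_position) auto

lemma expectation_cyclic:
  fixes f :: "int \<Rightarrow> complex"
  assumes "p > 0"
  shows "measure_pmf.expectation (cyclic_position w p s) f = (\<Sum>x\<in>{0..<int p}. of_real (cyclic_prob w p s x) * f x)"
  using set_cyclic_position[OF assms, of w s]
  by (subst integral_measure_pmf[of "{0..<int p}"]) (auto simp: scaleR_conv_of_real)

lemma norm_mode: "norm (mode w p s j) = exp (- s * (1 - cos (angle p j)))"
  unfolding mode_def by (rule norm_char_position)

lemma mode_add: "mode w p (s + r) j = mode w p s j * mode w p r j"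
  by (simp add: mode_def exp_add[symmetric] algebra_simps)

lemma parseval_cyclic:
  assumes "p > 0" "s \<ge> 0"
  shows "(\<Sum>x\<in>{0..<int p}. (cyclic_prob w p s x)\<^sup>2)
    = (\<Sum>j\<in>{0..<int p}. exp (- 2 * s * (1 - cos (angle p j)))) / real p"
proof -
  let ?q = "cyclic_prob w p s"
  have "complex_of_real (\<Sum>x\<in>{0..<int p}. (?q x)\<^sup>2)
      = (\<Sum>x\<in>{0..<int p}. of_real (?q x) * of_real (?q (x mod int p)))"
    by (simp add: power2_eq_square)
  also have "\<dots> = (\<Sum>x\<in>{0..<int p}. \<Sum>j\<in>{0..<int p}.
      (of_real (?q x) * cis (- angle p j * of_int x)) * mode w p s j) / of_nat p"
    unfolding pmf_cyclic_position[OF assms]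
    by (simp add: sum_divide_distrib sum_distrib_left mult_ac)
  also have "\<dots> = (\<Sum>j\<in>{0..<int p}. \<Sum>x\<in>{0..<int p}.
      (of_real (?q x) * cis (- angle p j * of_int x)) * mode w p s j) / of_nat p"
    by (subst sum.swap) simp
  also have "\<dots> = (\<Sum>j\<in>{0..<int p}. cnj (mode w p s j) * mode w p s j) / of_nat p"
  proof -
    have "(\<Sum>x\<in>{0..<int p}. of_real (?q x) * cis (- angle p j * of_int x)) = cnj (mode w p s j)" for j
      unfolding char_cyclic_position[OF assms, symmetric] expectation_cyclic[OF assms(1)]
      by (simp add: cis_cnj)
    then show ?thesis by (simp add: sum_distrib_right[symmetric])
  qed
  also have "\<dots> = complex_of_real ((\<Sum>j\<in>{0..<int p}. (norm (mode w p s j))\<^sup>2) / real p)"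
    by (simp add: complex_norm_square mult.commute del: of_real_power)
  also have "(\<Sum>j\<in>{0..<int p}. (norm (mode w p s j))\<^sup>2) = (\<Sum>j\<in>{0..<int p}. exp (- 2 * s * (1 - cos (angle p j))))"
    by (intro sum.cong refl) (simp add: norm_mode exp_double[symmetric] algebra_simps)
  finally show ?thesis by (simp only: of_real_eq_iff)
qed

lemma entropy_deficit_eq:
  assumes "p > 0"
  shows "ln (real p) - cyclic_entropy w p s
    = (\<Sum>x\<in>{0..<int p}. cyclic_prob w p s x * ln (cyclic_prob w p s x / (1 / real p)))"
proof -
  let ?q = "cyclic_prob w p s"
  have "?q x * ln (?q x / (1 / real p)) = ?q x * ln (real p) + ?q x * ln (?q x)" for x
  proof (cases "?q x = 0")
    case False
    then have "?q x > 0" by (simp add: pmf_pos)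
    then have "ln (?q x / (1 / real p)) = ln (real p) + ln (?q x)"
      using assms by (simp add: ln_mult)
    then show ?thesis by (simp only: distrib_left)
  qed simp
  then have "(\<Sum>x\<in>{0..<int p}. ?q x * ln (?q x / (1 / real p)))
      = (\<Sum>x\<in>{0..<int p}. ?q x) * ln (real p) + (\<Sum>x\<in>{0..<int p}. ?q x * ln (?q x))"
    by (simp only: sum.distrib sum_distrib_right)
  then show ?thesis
    by (simp only: sum_cyclic_prob[OF assms] cyclic_entropy_def mult_1_left)
qed

text \<open>
  By Jensen's inequality the deficit is at most the logarithm of \<open>p\<close> times the collision
  probability, which Parseval's identity expresses by the Fourier coefficients.
\<close>

lemma entropy_deficit_upper:
  assumes "p > 0" "s \<ge> 0"
  shows "ln (real p) - cyclic_entropy w p s \<le> ln (\<Sum>j\<in>{0..<int p}. exp (- 2 * s * (1 - cos (angle p j))))"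
proof -
  let ?q = "cyclic_prob w p s"
  define T where "T = (\<Sum>j\<in>{0..<int p}. exp (- 2 * s * (1 - cos (angle p j))))"
  have T: "T > 0" unfolding T_def using assms by (intro sum_pos) auto
  have "?q x * ln (?q x / (1 / real p)) \<le> ?q x * ln T + (?q x * (?q x * real p) / T - ?q x)" for x
  proof (cases "?q x = 0")
    case False
    then have q: "?q x > 0" by (simp add: pmf_pos)
    have "ln (?q x * real p / T) \<le> ?q x * real p / T - 1"
      using q T assms by (intro ln_le_minus_one) auto
    then have "ln (?q x / (1 / real p)) \<le> ln T + (?q x * real p / T - 1)"
      using q T assms by (simp add: ln_div ln_mult)
    then have "?q x * ln (?q x / (1 / real p)) \<le> ?q x * (ln T + (?q x * real p / T - 1))"
      using q by (intro mult_left_mono) auto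
    then show ?thesis by (simp add: algebra_simps)
  qed simp
  then have "(\<Sum>x\<in>{0..<int p}. ?q x * ln (?q x / (1 / real p)))
      \<le> (\<Sum>x\<in>{0..<int p}. ?q x * ln T + (?q x * (?q x * real p) / T - ?q x))"
    by (intro sum_mono)
  also have "\<dots> = ln T + (\<Sum>x\<in>{0..<int p}. (?q x)\<^sup>2) * real p / T - 1"
    using assms by (simp add: sum.distrib sum_subtractf sum_distrib_right[symmetric] sum_divide_distrib[symmetric]
        sum_cyclic_prob power2_eq_square mult.assoc[symmetric])
  also have "\<dots> = ln T"
    unfolding parseval_cyclic[OF assms] T_def[symmetric] using assms T by simp
  finally show ?thesis
    unfolding entropy_deficit_eq[OF assms(1)] T_def .
qed

text \<open>
  The first Fourier coefficient is the integral of a unimodular function against the difference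
  \<open>q - u\<close> to the uniform law. Writing \<open>q - u\<close> as \<open>(sqrt q - sqrt u) (sqrt q + sqrt u)\<close>,
  Cauchy-Schwarz bounds the coefficient by twice the Hellinger distance, hence its square by four
  times the deficit.
\<close>

lemma entropy_deficit_lower:
  assumes "p \<ge> 2" "s \<ge> 0"
  shows "exp (- 2 * s * (1 - cos (2 * pi / real p))) / 4 \<le> ln (real p) - cyclic_entropy w p s"
proof -
  let ?q = "cyclic_prob w p s" and ?u = "1 / real p" and ?A = "{0..<int p}"
  have p: "p > 0" using assms by simp
  have not_dvd: "\<not> int p dvd 1" using assms by auto
  have ang: "angle p 1 = 2 * pi / real p" by (simp add: angle_def)
  have sum0: "(\<Sum>x\<in>?A. cis (angle p 1 * of_int x)) = 0"
  proof -
    have "(\<Sum>x\<in>?A. cis (angle p 1 * of_int x)) = (\<Sum>x\<in>?A. cis (angle p x * of_int 1))"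
      by (intro sum.cong refl) (simp add: angle_def field_simps)
    then show ?thesis using sum_cis_roots[OF p, of 1] not_dvd by simp
  qed
  have "mode w p s 1 = (\<Sum>x\<in>?A. of_real (?q x - ?u) * cis (angle p 1 * of_int x))"
    using sum0 unfolding char_cyclic_position[OF p assms(2), symmetric] expectation_cyclic[OF p]
    by (simp add: left_diff_distrib sum_subtractf sum_distrib_left[symmetric] sum_divide_distrib[symmetric])
  then have "norm (mode w p s 1) \<le> (\<Sum>x\<in>?A. norm (of_real (?q x - ?u) * cis (angle p 1 * of_int x)))"
    by (simp only: norm_sum)
  also have "\<dots> = (\<Sum>x\<in>?A. \<bar>?q x - ?u\<bar>)"
    by (intro sum.cong refl) (simp only: norm_mult norm_of_real norm_cis mult_1_right)
  also have "\<dots> = (\<Sum>x\<in>?A. \<bar>sqrt (?q x) - sqrt ?u\<bar> * \<bar>sqrt (?q x) + sqrt ?u\<bar>)"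
  proof (intro sum.cong refl)
    fix x
    have "a - b = (sqrt a - sqrt b) * (sqrt a + sqrt b)" if "0 \<le> a" "0 \<le> b" for a b :: real
      using that by (simp add: algebra_simps)
    from this[of "?q x" ?u] have "?q x - ?u = (sqrt (?q x) - sqrt ?u) * (sqrt (?q x) + sqrt ?u)"
      by simp
    then show "\<bar>?q x - ?u\<bar> = \<bar>sqrt (?q x) - sqrt ?u\<bar> * \<bar>sqrt (?q x) + sqrt ?u\<bar>"
      by (simp only: abs_mult)
  qed
  finally have "(norm (mode w p s 1))\<^sup>2 \<le> (\<Sum>x\<in>?A. \<bar>sqrt (?q x) - sqrt ?u\<bar> * \<bar>sqrt (?q x) + sqrt ?u\<bar>)\<^sup>2"
    by (intro power_mono) auto
  also have "\<dots> \<le> (\<Sum>x\<in>?A. \<bar>sqrt (?q x) - sqrt ?u\<bar>\<^sup>2) * (\<Sum>x\<in>?A. \<bar>sqrt (?q x) + sqrt ?u\<bar>\<^sup>2)"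
    by (rule Cauchy_Schwarz_ineq_sum)
  also have "\<dots> \<le> (\<Sum>x\<in>?A. ?q x * ln (?q x / ?u)) * 4"
  proof (intro mult_mono)
    show "(\<Sum>x\<in>?A. \<bar>sqrt (?q x) - sqrt ?u\<bar>\<^sup>2) \<le> (\<Sum>x\<in>?A. ?q x * ln (?q x / ?u))"
      using gibbs_hellinger[of ?A ?q "\<lambda>_. ?u"] p by (simp add: sum_cyclic_prob)
    have "(\<Sum>x\<in>?A. \<bar>sqrt (?q x) + sqrt ?u\<bar>\<^sup>2) \<le> (\<Sum>x\<in>?A. 2 * ?q x + 2 * ?u)"
    proof (intro sum_mono)
      fix x
      have "0 \<le> (sqrt (?q x) - sqrt ?u)\<^sup>2" by simp
      moreover have "(sqrt (?q x))\<^sup>2 = ?q x" "(sqrt ?u)\<^sup>2 = ?u" by simp_all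
      ultimately show "\<bar>sqrt (?q x) + sqrt ?u\<bar>\<^sup>2 \<le> 2 * ?q x + 2 * ?u"
        by (simp only: power2_abs power2_sum power2_diff)
    qed
    also have "\<dots> = 4"
      using p by (simp add: sum.distrib sum_distrib_left[symmetric] sum_cyclic_prob)
    finally show "(\<Sum>x\<in>?A. \<bar>sqrt (?q x) + sqrt ?u\<bar>\<^sup>2) \<le> 4" .
    show "0 \<le> (\<Sum>x\<in>?A. ?q x * ln (?q x / ?u))"
      using gibbs_hellinger[of ?A ?q "\<lambda>_. ?u"] p sum_nonneg[of ?A "\<lambda>x. (sqrt (?q x) - sqrt ?u)\<^sup>2"]
      by (simp add: sum_cyclic_prob)
  qed (auto intro: sum_nonneg)
  also have "(norm (mode w p s 1))\<^sup>2 = exp (- 2 * s * (1 - cos (2 * pi / real p)))"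
    by (simp add: norm_mode ang exp_double[symmetric] algebra_simps)
  finally show ?thesis
    unfolding entropy_deficit_eq[OF p] by simp
qed

text \<open>
  The semigroup property, read off from the multiplicativity of the Fourier coefficients.
\<close>

lemma cyclic_prob_convolution:
  assumes "p > 0" "s \<ge> 0" "r \<ge> 0"
  shows "cyclic_prob w p (s + r) (z mod int p)
    = (\<Sum>y\<in>{0..<int p}. cyclic_prob w p r y * cyclic_prob w p s ((z - y) mod int p))"
proof -
  let ?A = "{0..<int p}"
  have "complex_of_real (\<Sum>y\<in>?A. cyclic_prob w p r y * cyclic_prob w p s ((z - y) mod int p))
      = (\<Sum>y\<in>?A. \<Sum>j\<in>?A. cis (- angle p j * of_int z) * mode w p s j
          * (of_real (cyclic_prob w p r y) * cis (angle p j * of_int y)) / of_nat p)"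
  proof -
    have "cis (- angle p j * of_int (z - y)) = cis (- angle p j * of_int z) * cis (angle p j * of_int y)"
      for j y by (simp add: cis_mult algebra_simps)
    then show ?thesis
      using assms by (simp add: pmf_cyclic_position sum_distrib_left sum_divide_distrib mult_ac)
  qed
  also have "\<dots> = (\<Sum>j\<in>?A. \<Sum>y\<in>?A. cis (- angle p j * of_int z) * mode w p s j
          * (of_real (cyclic_prob w p r y) * cis (angle p j * of_int y)) / of_nat p)"
    by (rule sum.swap)
  also have "\<dots> = (\<Sum>j\<in>?A. cis (- angle p j * of_int z) * mode w p s j * mode w p r j / of_nat p)"
    using assms char_cyclic_position[of p r w] 
    by (simp add: expectation_cyclic sum_distrib_left[symmetric] sum_divide_distrib[symmetric])
  also have "\<dots> = complex_of_real (cyclic_prob w p (s + r) (z mod int p))"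
    using assms by (simp add: pmf_cyclic_position mode_add sum_divide_distrib mult.assoc)
  finally show ?thesis by (simp only: of_real_eq_iff)
qed

lemma cyclic_prob_zero_pos:
  assumes "p > 0"
  shows "cyclic_prob w p r 0 > 0"
proof -
  have "0 \<in> set_pmf (jump_count r)" by (simp add: jump_count_def)
  then have "0 \<in> set_pmf (int_position w r)"
    unfolding int_position_def set_bind_pmf by (rule UN_I) simp
  then have "0 mod int p \<in> set_pmf (cyclic_position w p r)"
    unfolding cyclic_position_def set_map_pmf by (rule imageI)
  then show ?thesis by (simp add: pmf_positive)
qed

lemma cos_angle_less_1:
  assumes "p \<ge> 2" "j \<in> {1..<int p}"
  shows "cos (angle p j) < 1"
proof -
  have "cos (angle p j) \<noteq> 1"
  proof
    assume "cos (angle p j) = 1"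
    then obtain m :: int where "angle p j = of_int m * 2 * pi"
      by (auto simp: cos_one_2pi_int)
    then have "real_of_int j = of_int (m * int p)" using assms by (simp add: angle_def field_simps)
    then have "j = m * int p" by (simp only: of_int_eq_iff)
    then have "int p dvd j" by simp
    then show False using assms zdvd_imp_le by fastforce
  qed
  then show ?thesis using cos_le_one[of "angle p j"] by linarith
qed

lemma sum_shift_mod:
  fixes f :: "int \<Rightarrow> real"
  assumes "p > 0"
  shows "(\<Sum>x\<in>{0..<int p}. f ((x - y) mod int p)) = sum f {0..<int p}"
proof (rule sum.reindex_bij_witness[of _ "\<lambda>x. (x + y) mod int p" "\<lambda>x. (x - y) mod int p"])
  fix x assume "x \<in> {0..<int p}"
  then show "((x - y) mod int p + y) mod int p = x" "((x + y) mod int p - y) mod int p = x"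
    by (simp_all add: mod_simps)
qed (use assms in auto)

text \<open>
  The law \<open>b\<close> at time \<open>s + r\<close> is the mixture, with weights \<open>\<kappa> y\<close>, of the translates \<open>a y\<close> of the law
  at time \<open>s\<close>. All translates have the same entropy, so the entropy gained is the average of the
  relative entropies of \<open>a y\<close> with respect to \<open>b\<close>. The term \<open>y = 0\<close> is positive: its weight is
  positive, and \<open>a 0 = b\<close> is impossible since the first Fourier coefficient strictly decays.
\<close>

lemma cyclic_entropy_strict_mono:
  assumes "p \<ge> 2" "s \<ge> 0" "r > 0"
  shows "cyclic_entropy w p s < cyclic_entropy w p (s + r)"
proof -
  let ?A = "{0..<int p}"
  have p: "p > 0" using assms by simp
  define a where "a = (\<lambda>y x. cyclic_prob w p s ((x - y) mod int p))"
  define b where "b = cyclic_prob w p (s + r)"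
  define \<kappa> where "\<kappa> = cyclic_prob w p r"
  have conv: "b x = (\<Sum>y\<in>?A. \<kappa> y * a y x)" if "x \<in> ?A" for x
    using cyclic_prob_convolution[OF p assms(2), of r w x] that assms by (simp add: a_def b_def \<kappa>_def)
  have suma: "sum (a y) ?A = 1" for y
    using sum_shift_mod[OF p, of "cyclic_prob w p s" y] p by (simp add: a_def sum_cyclic_prob)
  have sumb: "sum b ?A = 1" using p by (simp add: b_def sum_cyclic_prob)
  have sumk: "sum \<kappa> ?A = 1" using p by (simp add: \<kappa>_def sum_cyclic_prob)
  have nn: "0 \<le> a y x" "0 \<le> b x" "0 \<le> \<kappa> y" for x y by (auto simp: a_def b_def \<kappa>_def)
  have ac: "a y x = 0" if "x \<in> ?A" "y \<in> ?A" "\<kappa> y \<noteq> 0" "b x = 0" for x y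
  proof -
    have "\<kappa> y * a y x \<le> b x"
      unfolding conv[OF that(1)] using that nn by (intro member_le_sum) auto
    then show ?thesis using that nn(1)[of y x] nn(3)[of y] by (smt (verit) mult_pos_pos)
  qed
  have Hs: "cyclic_entropy w p s = - (\<Sum>x\<in>?A. a y x * ln (a y x))" for y
    using sum_shift_mod[OF p, of "\<lambda>x. cyclic_prob w p s x * ln (cyclic_prob w p s x)" y]
    by (simp add: a_def cyclic_entropy_def)
  have "cyclic_entropy w p (s + r) = - (\<Sum>x\<in>?A. \<Sum>y\<in>?A. \<kappa> y * (a y x * ln (b x)))"
    unfolding cyclic_entropy_def b_def[symmetric]
    by (simp add: conv sum_distrib_right sum_distrib_left mult_ac)
  also have "\<dots> = - (\<Sum>y\<in>?A. \<kappa> y * (\<Sum>x\<in>?A. a y x * ln (b x)))"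
    by (subst sum.swap) (simp add: sum_distrib_left)
  finally have H1: "cyclic_entropy w p (s + r) = - (\<Sum>y\<in>?A. \<kappa> y * (\<Sum>x\<in>?A. a y x * ln (b x)))" .
  have "cyclic_entropy w p s = (\<Sum>y\<in>?A. \<kappa> y * cyclic_entropy w p s)"
    using sumk by (simp add: sum_distrib_right[symmetric])
  also have "\<dots> = - (\<Sum>y\<in>?A. \<kappa> y * (\<Sum>x\<in>?A. a y x * ln (a y x)))"
  proof -
    have "\<kappa> y * cyclic_entropy w p s = - (\<kappa> y * (\<Sum>x\<in>?A. a y x * ln (a y x)))" for y
      using arg_cong[OF Hs[of y], of "\<lambda>h. \<kappa> y * h"] by (simp only: mult_minus_right)
    then show ?thesis by (simp only: sum_negf)
  qed
  finally have H2: "cyclic_entropy w p (s + r) - cyclic_entropy w p s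
      = (\<Sum>y\<in>?A. \<kappa> y * (\<Sum>x\<in>?A. a y x * ln (a y x) - a y x * ln (b x)))"
    unfolding H1 by (simp add: sum_subtractf right_diff_distrib)
  have D: "\<kappa> y * (\<Sum>x\<in>?A. (sqrt (a y x) - sqrt (b x))\<^sup>2)
      \<le> \<kappa> y * (\<Sum>x\<in>?A. a y x * ln (a y x) - a y x * ln (b x))" if y: "y \<in> ?A" for y
  proof (cases "\<kappa> y = 0")
    case False
    have "(\<Sum>x\<in>?A. a y x * ln (a y x) - a y x * ln (b x)) = (\<Sum>x\<in>?A. a y x * ln (a y x / b x))"
    proof (intro sum.cong refl)
      fix x assume x: "x \<in> ?A"
      show "a y x * ln (a y x) - a y x * ln (b x) = a y x * ln (a y x / b x)"
      proof (cases "a y x = 0")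
        case nz: False
        then have "b x \<noteq> 0" using ac[OF x y False] by auto
        then show ?thesis using nz nn(1)[of y x] nn(2)[of x] by (simp add: ln_div algebra_simps)
      qed simp
    qed
    moreover have "(\<Sum>x\<in>?A. (sqrt (a y x) - sqrt (b x))\<^sup>2) \<le> (\<Sum>x\<in>?A. a y x * ln (a y x / b x))"
      using nn ac[OF _ y False] suma sumb by (intro gibbs_hellinger) auto
    ultimately show ?thesis using nn by (intro mult_left_mono) auto
  qed simp
  let ?h = "\<lambda>y. \<Sum>x\<in>?A. (sqrt (a y x) - sqrt (b x))\<^sup>2"
  have "0 < ?h 0"
  proof (rule ccontr)
    assume "\<not> 0 < ?h 0"
    moreover have "0 \<le> ?h 0" by (intro sum_nonneg) auto
    ultimately have "?h 0 = 0" by linarith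
    then have ab: "a 0 x = b x" if "x \<in> ?A" for x
      using that nn by (subst (asm) sum_nonneg_eq_0_iff) auto
    have "mode w p s 1 = (\<Sum>x\<in>?A. of_real (a 0 x) * cis (angle p 1 * of_int x))"
      unfolding char_cyclic_position[OF p assms(2), symmetric] expectation_cyclic[OF p]
      by (simp add: a_def)
    also have "\<dots> = mode w p (s + r) 1"
      using assms unfolding char_cyclic_position[OF p, of "s + r", symmetric] expectation_cyclic[OF p]
      by (simp add: ab char_cyclic_position[OF p, of "s + r", symmetric] expectation_cyclic[OF p] b_def)
    finally have "norm (mode w p s 1) = norm (mode w p (s + r) 1)" by simp
    then have "r * (1 - cos (angle p 1)) = 0" by (simp add: norm_mode algebra_simps)
    then show False using cos_angle_less_1[of p 1] assms by simp
  qed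
  then have "0 < \<kappa> 0 * ?h 0" using cyclic_prob_zero_pos[OF p, of w r] by (simp add: \<kappa>_def)
  also have "\<dots> \<le> (\<Sum>y\<in>?A. \<kappa> y * ?h y)"
    using p nn by (intro member_le_sum) (auto intro!: mult_nonneg_nonneg sum_nonneg)
  also have "\<dots> \<le> cyclic_entropy w p (s + r) - cyclic_entropy w p s"
    unfolding H2 by (intro sum_mono D)
  finally show ?thesis by simp
qed

lemma continuous_on_mult_ln: "continuous_on {0..} (\<lambda>u::real. u * ln u)"
proof -
  have "((\<lambda>u::real. u * ln u) \<longlongrightarrow> 0) (at_right 0)"
    by real_asymp
  then have "continuous (at 0 within {0..}) (\<lambda>u::real. u * ln u)"
    by (simp add: continuous_within at_within_Ici_at_right)
  moreover have "continuous (at u within {0..}) (\<lambda>u::real. u * ln u)" if "u > 0" for u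
    using that by (intro continuous_intros) auto
  ultimately show ?thesis
    unfolding continuous_on_eq_continuous_within by (metis atLeast_iff order_less_le)
qed

lemma continuous_on_cyclic_entropy:
  assumes "p > 0"
  shows "continuous_on {0..} (cyclic_entropy w p)"
proof -
  have "continuous_on {0..} (\<lambda>s. cyclic_prob w p s x)" if x: "x \<in> {0..<int p}" for x
  proof -
    have "continuous_on {0..} (\<lambda>s. Re ((\<Sum>j\<in>{0..<int p}. cis (- angle p j * of_int x) * mode w p s j) / of_nat p))"
      unfolding mode_def using assms by (intro continuous_intros) auto
    moreover have "Re ((\<Sum>j\<in>{0..<int p}. cis (- angle p j * of_int x) * mode w p s j) / of_nat p)
        = cyclic_prob w p s x" if "s \<ge> 0" for s
    proof -
      have "complex_of_real (cyclic_prob w p s x) 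
          = (\<Sum>j\<in>{0..<int p}. cis (- angle p j * of_int x) * mode w p s j) / of_nat p"
        using pmf_cyclic_position[OF assms that, of w x] x by simp
      then show ?thesis by (metis Re_complex_of_real)
    qed
    ultimately show ?thesis by (rule continuous_on_eq) auto
  qed
  then show ?thesis
    unfolding cyclic_entropy_def
    by (intro continuous_on_minus continuous_on_sum continuous_on_compose2[OF continuous_on_mult_ln]) auto
qed

lemma cyclic_entropy_0: "p > 0 \<Longrightarrow> cyclic_entropy w p 0 = 0"
  by (simp add: cyclic_entropy_def cyclic_position_def int_position_def jump_count_def
      bind_return_pmf pmf_return)

lemma ex_cyclic_entropy_gt:
  assumes "p \<ge> 2" "h < ln (real p)"
  shows "\<exists>s\<ge>0. h < cyclic_entropy w p s"
proof -
  let ?T = "\<lambda>s. \<Sum>j\<in>{0..<int p}. exp (- 2 * s * (1 - cos (angle p j)))"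
  have "((\<lambda>s. exp (- 2 * s * (1 - cos (angle p j)))) \<longlongrightarrow> (if j = 0 then 1 else 0)) at_top"
    if "j \<in> {0..<int p}" for j
  proof (cases "j = 0")
    case False
    then have "1 - cos (angle p j) > 0" using cos_angle_less_1[of p j] assms that by auto
    then have "((\<lambda>s. exp (- 2 * s * (1 - cos (angle p j)))) \<longlongrightarrow> 0) at_top"
      by real_asymp
    then show ?thesis using False by simp
  qed (simp add: angle_def)
  then have "(?T \<longlongrightarrow> (\<Sum>j\<in>{0..<int p}. if j = 0 then 1 else 0)) at_top"
    by (intro tendsto_sum)
  then have "(?T \<longlongrightarrow> 1) at_top" using assms by simp
  from tendsto_ln[OF this] have "((\<lambda>s. ln (?T s)) \<longlongrightarrow> ln 1) at_top"
    by simp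
  then have "((\<lambda>s. ln (real p) - ln (?T s)) \<longlongrightarrow> ln (real p) - ln 1) at_top"
    by (rule tendsto_diff[OF tendsto_const])
  then have "\<forall>\<^sub>F s in at_top. h < ln (real p) - ln (?T s)"
    using assms by (intro order_tendstoD) auto
  moreover have "\<forall>\<^sub>F s::real in at_top. s \<ge> 0" by (rule eventually_ge_at_top)
  ultimately have "\<forall>\<^sub>F s in at_top. s \<ge> 0 \<and> h < ln (real p) - ln (?T s)"
    by eventually_elim simp
  from eventually_happens'[OF trivial_limit_at_top_linorder this]
  obtain s where "s \<ge> 0" "h < ln (real p) - ln (?T s)" by (elim exE conjE)
  then show ?thesis using entropy_deficit_upper[of p s w] assms by (intro exI[of _ s]) auto
qed

text \<open>
  Existence is the intermediate value theorem, uniqueness is strict monotonicity; together they give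
  the definite description in the definition of the entropic time its meaning.
\<close>

lemma entropic_time_characterization:
  assumes "p \<ge> 2" "d < k"
  shows "entropic_time w d p k \<ge> 0"
    and "cyclic_entropy w p (entropic_time w d p k / real k) = real d / real k * ln (real p)"
proof -
  have p: "p > 0" and k: "k > 0" using assms by auto
  let ?h = "real d / real k * ln (real p)"
  have "?h < 1 * ln (real p)" using assms by (intro mult_strict_right_mono) auto
  then obtain s1 where s1: "s1 \<ge> 0" "?h < cyclic_entropy w p s1"
    using ex_cyclic_entropy_gt[OF assms(1), of ?h w] by auto
  have "continuous_on {0..s1} (cyclic_entropy w p)"
    using continuous_on_cyclic_entropy[OF p] by (rule continuous_on_subset) auto
  moreover have "cyclic_entropy w p 0 \<le> ?h" using assms p by (simp add: cyclic_entropy_0)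
  ultimately obtain s where s: "0 \<le> s" "cyclic_entropy w p s = ?h"
    using IVT'[of "cyclic_entropy w p" 0 ?h s1] s1 by auto
  have walk: "walk_entropy w p k t = real d * ln (real p) \<longleftrightarrow> cyclic_entropy w p (t / real k) = ?h"
    if "t \<ge> 0" for t
    unfolding walk_entropy_eq[OF p k that] using k by (simp add: field_simps)
  have uniq: "u = v" if "u \<ge> 0" "v \<ge> 0" "cyclic_entropy w p u = cyclic_entropy w p v" for u v
  proof (rule linorder_cases)
    assume "u < v" then show ?thesis
      using cyclic_entropy_strict_mono[OF assms(1), of u "v - u" w] that by simp
  next
    assume "v < u" then show ?thesis
      using cyclic_entropy_strict_mono[OF assms(1), of v "u - v" w] that by simp
  qed
  let ?P = "\<lambda>t. t \<ge> 0 \<and> walk_entropy w p k t = real d * ln (real p)"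
  have "?P (THE t. ?P t)"
  proof (rule theI[of _ "s * real k"])
    have e: "s * real k / real k = s" using k by simp
    have nn: "0 \<le> s * real k" using s(1) by simp
    show "?P (s * real k)" by (simp only: walk[OF nn] e s(2) nn)
    fix t assume t: "?P t"
    then have nt: "t \<ge> 0" by (rule conjunct1)
    have "cyclic_entropy w p (t / real k) = ?h"
      using t unfolding walk[OF nt] by (rule conjunct2)
    then have "cyclic_entropy w p (t / real k) = cyclic_entropy w p s" by (simp only: s(2))
    moreover have "0 \<le> t / real k" using nt k by simp
    ultimately have "t / real k = s" using s(1) uniq by metis
    then have "s * real k = t / real k * real k" by (simp only:)
    then show "t = s * real k" using k by simp
  qed
  then have "?P (entropic_time w d p k)"
    unfolding entropic_time_def .
  then show "entropic_time w d p k \<ge> 0"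
    and "cyclic_entropy w p (entropic_time w d p k / real k) = real d / real k * ln (real p)"
    using walk[of "entropic_time w d p k"] by (simp_all only: simp_thms)
qed

section \<open>Spectral gaps and the entropy deficit\<close>

lemma one_minus_cos_eq: "1 - cos x = 2 * (sin (x / 2))\<^sup>2" for x :: real
  using cos_double_sin[of "x / 2"] by simp

text \<open>
  A weak form of Jordan's inequality, from the Taylor bound \<open>y - y\<^sup>3 / 6 \<le> sin y\<close>.
\<close>

lemma half_le_sin:
  assumes "0 \<le> y" "y \<le> pi / 2"
  shows "y / 2 \<le> sin y"
proof -
  have "\<bar>sin y - (\<Sum>m<3. sin_coeff m * y ^ m)\<bar> \<le> inverse (fact 3) * \<bar>y\<bar> ^ 3"
    by (rule Maclaurin_sin_bound)
  also have "(\<Sum>m<3. sin_coeff m * y ^ m) = y"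
    by (simp add: numeral_3_eq_3 sin_coeff_def)
  also have "inverse (fact 3) * \<bar>y\<bar> ^ 3 = y ^ 3 / 6"
    using assms by (simp add: fact_numeral)
  finally have "y - y ^ 3 / 6 \<le> sin y" by linarith
  moreover have "y\<^sup>2 \<le> 3"
  proof -
    have "y \<le> 3.15 / 2" using assms pi_approx(2) by simp
    then have "y\<^sup>2 \<le> (3.15 / 2)\<^sup>2" using assms by (intro power_mono) auto
    then show ?thesis by (simp add: power2_eq_square)
  qed
  moreover have "y ^ 3 = y * y\<^sup>2" by (simp add: power3_eq_cube power2_eq_square)
  ultimately show ?thesis
    using mult_left_mono[of "y\<^sup>2" 3 y] assms by simp
qed

lemma one_minus_cos_ge:
  assumes "\<bar>x\<bar> \<le> pi"
  shows "x\<^sup>2 / 8 \<le> 1 - cos x"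
proof -
  have "\<bar>x\<bar> / 2 / 2 \<le> sin (\<bar>x\<bar> / 2)" using assms by (intro half_le_sin) auto
  then have "(\<bar>x\<bar> / 2 / 2)\<^sup>2 \<le> (sin (\<bar>x\<bar> / 2))\<^sup>2" by (intro power_mono) auto
  then have "x\<^sup>2 / 16 \<le> (sin (\<bar>x\<bar> / 2))\<^sup>2" by (simp add: power_divide)
  moreover have "1 - cos x = 2 * (sin (\<bar>x\<bar> / 2))\<^sup>2"
    using one_minus_cos_eq[of "\<bar>x\<bar>"] by simp
  ultimately show ?thesis by simp
qed

text \<open>
  By induction on \<open>j\<close>: the increment \<open>sin\<^sup>2 ((j + 1) \<theta>) - sin\<^sup>2 (j \<theta>) = sin ((2 j + 1) \<theta>) sin \<theta>\<close> is at
  least \<open>sin\<^sup>2 \<theta>\<close>, as \<open>\<theta> \<le> (2 j + 1) \<theta> \<le> \<pi> - \<theta>\<close> when \<open>(j + 1) \<theta> \<le> \<pi> / 2\<close>.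
\<close>

lemma sin_multiple_square_ge:
  fixes \<theta> :: real
  assumes "0 \<le> \<theta>" "j \<ge> 1" "real j * \<theta> \<le> pi / 2"
  shows "real j * (sin \<theta>)\<^sup>2 \<le> (sin (real j * \<theta>))\<^sup>2"
  using assms(2,3)
proof (induction j rule: nat_induct_at_least)
  case (Suc j)
  let ?x = "real (2 * j + 1) * \<theta>"
  have le: "real j * \<theta> \<le> real (Suc j) * \<theta>" using assms by (intro mult_right_mono) auto
  have IH: "real j * (sin \<theta>)\<^sup>2 \<le> (sin (real j * \<theta>))\<^sup>2" using Suc le by auto
  have "\<theta> \<le> real (Suc j) * \<theta>" using mult_right_mono[of 1 "real (Suc j)" \<theta>] assms by simp
  then have \<theta>: "\<theta> \<le> pi / 2" using Suc.prems by simp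
  have "sin ?x - sin \<theta> = 2 * sin (real j * \<theta>) * cos (real (Suc j) * \<theta>)"
  proof -
    have "(?x - \<theta>) / 2 = real j * \<theta>" "(?x + \<theta>) / 2 = real (Suc j) * \<theta>"
      by (simp_all add: field_simps)
    then show ?thesis using sin_diff_sin[of ?x \<theta>] by (simp only:)
  qed
  moreover have "0 \<le> sin (real j * \<theta>)"
  proof (rule sin_ge_zero)
    show "real j * \<theta> \<le> pi" using Suc.prems le pi_gt_zero by linarith
  qed (use assms in simp)
  moreover have "0 \<le> cos (real (Suc j) * \<theta>)"
  proof (rule cos_ge_zero)
    have "0 \<le> real (Suc j) * \<theta>" using assms by simp
    then show "- (pi / 2) \<le> real (Suc j) * \<theta>" using pi_gt_zero by linarith
  qed (use Suc.prems in simp)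
  ultimately have "sin \<theta> \<le> sin ?x" by (smt (verit) mult_nonneg_nonneg)
  moreover have "0 \<le> sin \<theta>" using assms \<theta> by (intro sin_ge_zero) auto
  ultimately have "(sin \<theta>)\<^sup>2 \<le> sin ?x * sin \<theta>"
    by (simp add: power2_eq_square mult_right_mono)
  also have "\<dots> = (sin (real (Suc j) * \<theta>))\<^sup>2 - (sin (real j * \<theta>))\<^sup>2"
  proof -
    have x: "?x = real (Suc j) * \<theta> + real j * \<theta>" and t: "\<theta> = real (Suc j) * \<theta> - real j * \<theta>"
      by (simp_all add: algebra_simps)
    have gen: "sin (a + b) * sin (a - b) = (sin a)\<^sup>2 - (sin b)\<^sup>2" for a b :: real
    proof -
      have "sin (a + b) * sin (a - b) = (sin a)\<^sup>2 * (cos b)\<^sup>2 - (cos a)\<^sup>2 * (sin b)\<^sup>2"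
        by (simp add: sin_add sin_diff power2_eq_square algebra_simps)
      then show ?thesis by (simp add: cos_squared_eq algebra_simps)
    qed
    show ?thesis using gen[of "real (Suc j) * \<theta>" "real j * \<theta>"] x t by simp
  qed
  finally show ?case using IH by (simp add: algebra_simps)
qed simp

text \<open>
  The decay rate of the modulus of the \<open>j\<close>-th Fourier coefficient.
\<close>

definition gap :: "nat \<Rightarrow> int \<Rightarrow> real" where
  "gap p j = 1 - cos (angle p j)"

lemma gap_reflect: "p > 0 \<Longrightarrow> gap p (int p - j) = gap p j"
proof -
  assume "p > 0"
  then have "angle p (int p - j) = 2 * pi - angle p j" by (simp add: angle_def field_simps)
  then show ?thesis by (simp add: gap_def)
qed

text \<open>
  Linear growth in units of the first gap bounds the sum over the modes by a geometric series,
  uniformly in \<open>p\<close>, at times beyond the relaxation time.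
\<close>

lemma gap_ge_linear:
  assumes "1 \<le> j" "2 * j \<le> int p"
  shows "of_int j * gap p 1 \<le> gap p j"
proof -
  have p: "p > 0" using assms by simp
  have eq: "angle p j / 2 = real (nat j) * (pi / real p)" "angle p 1 / 2 = pi / real p"
    using assms by (simp_all add: angle_def)
  have "real_of_int (2 * j) \<le> real p" using assms by linarith
  then have "real (nat j) * (pi / real p) \<le> pi / 2"
    using assms p by (simp add: field_simps)
  then have "real (nat j) * (sin (pi / real p))\<^sup>2 \<le> (sin (real (nat j) * (pi / real p)))\<^sup>2"
    using assms by (intro sin_multiple_square_ge) auto
  then show ?thesis
    unfolding gap_def one_minus_cos_eq eq using assms by simp
qed

text \<open>
  Quadratic growth with a constant free of \<open>p\<close> serves at times up to order \<open>p\<^sup>2\<close>, when many modes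
  contribute.
\<close>

lemma gap_ge_square:
  assumes "1 \<le> j" "2 * j \<le> int p"
  shows "2 * (of_int j / real p)\<^sup>2 \<le> gap p j"
proof -
  have p: "p > 0" using assms by simp
  have "real_of_int (2 * j) \<le> real p" using assms by linarith
  then have "angle p j \<le> pi" using p by (simp add: angle_def field_simps)
  moreover have "0 \<le> angle p j" using assms by (simp add: angle_def)
  ultimately have "(angle p j)\<^sup>2 / 8 \<le> gap p j"
    unfolding gap_def by (intro one_minus_cos_ge) auto
  moreover have "(angle p j)\<^sup>2 / 8 = (pi\<^sup>2 / 2) * (of_int j / real p)\<^sup>2"
    by (simp add: angle_def power_divide power_mult_distrib)
  moreover have "2 * (of_int j / real p)\<^sup>2 \<le> (pi\<^sup>2 / 2) * (of_int j / real p)\<^sup>2"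
  proof (rule mult_right_mono)
    have "2 * 2 \<le> pi * pi" by (intro mult_mono pi_ge_two) auto
    then show "2 \<le> pi\<^sup>2 / 2" by (simp add: power2_eq_square)
  qed simp
  ultimately show ?thesis by linarith
qed

text \<open>
  The gaps at \<open>j\<close> and \<open>p - j\<close> agree, so all modes but \<open>j = 0\<close> are covered twice by \<open>1 \<le> j \<le> p / 2\<close>.
\<close>

lemma sum_modes_le_half:
  fixes f :: "real \<Rightarrow> real"
  assumes "p > 0" "\<And>x. 0 \<le> f x"
  shows "(\<Sum>j\<in>{0..<int p}. f (gap p j)) \<le> f 0 + 2 * (\<Sum>j\<in>{j. 1 \<le> j \<and> 2 * j \<le> int p}. f (gap p j))"
proof -
  let ?B = "{j. 1 \<le> j \<and> 2 * j \<le> int p}"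
  have fin: "finite ?B" by (rule finite_subset[of _ "{0..int p}"]) auto
  have "{0..<int p} \<subseteq> insert 0 (?B \<union> (\<lambda>j. int p - j) ` ?B)"
  proof
    fix j assume "j \<in> {0..<int p}"
    then have "j = 0 \<or> j \<in> ?B \<or> int p - j \<in> ?B" by auto
    then show "j \<in> insert 0 (?B \<union> (\<lambda>j. int p - j) ` ?B)"
      by (auto intro!: image_eqI[of _ _ "int p - j"])
  qed
  then have "(\<Sum>j\<in>{0..<int p}. f (gap p j)) \<le> (\<Sum>j\<in>insert 0 (?B \<union> (\<lambda>j. int p - j) ` ?B). f (gap p j))"
    using fin assms by (intro sum_mono2) auto
  also have "\<dots> \<le> f (gap p 0) + (\<Sum>j\<in>?B \<union> (\<lambda>j. int p - j) ` ?B. f (gap p j))"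
    using fin assms by (subst sum.insert_if) auto
  also have "(\<Sum>j\<in>?B \<union> (\<lambda>j. int p - j) ` ?B. f (gap p j))
      \<le> (\<Sum>j\<in>?B. f (gap p j)) + (\<Sum>j\<in>(\<lambda>j. int p - j) ` ?B. f (gap p j))"
    using fin assms by (subst sum_Un) (auto intro!: sum_nonneg)
  also have "(\<Sum>j\<in>(\<lambda>j. int p - j) ` ?B. f (gap p j)) = (\<Sum>j\<in>?B. f (gap p j))"
    using assms by (subst sum.reindex) (auto simp: inj_on_def gap_reflect)
  finally show ?thesis by (simp add: gap_def angle_def)
qed

lemma sum_modes_le_geometric:
  assumes "p \<ge> 2" "s \<ge> 0" and x: "x = exp (- 2 * s * gap p 1)" "x \<le> 1 / 2"
  shows "(\<Sum>j\<in>{0..<int p}. exp (- 2 * s * gap p j)) \<le> 1 + 4 * x"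
proof -
  let ?B = "{j. 1 \<le> j \<and> 2 * j \<le> int p}"
  have x0: "0 < x" using x by simp
  have "(\<Sum>j\<in>?B. exp (- 2 * s * gap p j)) \<le> (\<Sum>j\<in>?B. x ^ nat j)"
  proof (intro sum_mono)
    fix j assume j: "j \<in> ?B"
    have "2 * s * (of_int j * gap p 1) \<le> 2 * s * gap p j"
      using j assms by (intro mult_left_mono gap_ge_linear) auto
    then have "exp (- 2 * s * gap p j) \<le> exp (real (nat j) * (- 2 * s * gap p 1))"
      using j by (simp add: algebra_simps)
    then show "exp (- 2 * s * gap p j) \<le> x ^ nat j" by (simp only: x exp_of_nat_mult)
  qed
  also have "\<dots> = (\<Sum>i\<in>nat ` ?B. x ^ i)"
    by (subst sum.reindex) (auto simp: inj_on_def)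
  also have "\<dots> \<le> (\<Sum>i\<in>{1..p}. x ^ i)"
    using x0 by (intro sum_mono2) (auto simp: nat_le_iff)
  also have "\<dots> = (\<Sum>i<p. x * x ^ i)"
    by (rule sum.reindex_bij_witness[of _ Suc "\<lambda>i. i - 1"]) (auto simp flip: power_Suc)
  also have "\<dots> = x * ((1 - x ^ p) / (1 - x))"
  proof -
    have "x \<noteq> 1" using x(2) by auto
    then show ?thesis by (simp only: sum_distrib_left[symmetric] sum_gp_strict if_False)
  qed
  also have "\<dots> \<le> x * 2"
  proof (rule mult_left_mono)
    have "(1 - x ^ p) / (1 - x) \<le> 1 / (1 - x)" using x(2) x0 by (intro divide_right_mono) auto
    also have "\<dots> \<le> 2" using x(2) by (simp add: field_simps)
    finally show "(1 - x ^ p) / (1 - x) \<le> 2" .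
  qed (use x0 in simp)
  finally have "(\<Sum>j\<in>?B. exp (- 2 * s * gap p j)) \<le> x * 2" .
  then show ?thesis
    using sum_modes_le_half[of p "\<lambda>g. exp (- 2 * s * g)"] assms by simp
qed

text \<open>
  Since \<open>exp (- y\<^sup>2) \<le> 1 / (1 + y\<^sup>2) \<le> 2 / (1 + y)\<^sup>2\<close>, the sum is dominated by a telescoping one.
\<close>

lemma sum_exp_square_le:
  fixes b :: real
  assumes "b > 0"
  shows "(\<Sum>i\<in>{1..m}. exp (- (b * real i)\<^sup>2)) \<le> 2 / b"
proof -
  have "(\<Sum>i\<in>{1..m}. exp (- (b * real i)\<^sup>2)) \<le> 2 / b - 2 / (b * (1 + b * real m))"
  proof (induction m)
    case (Suc m)
    let ?y = "b * real (Suc m)" and ?z = "b * real m"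
    have z: "?z \<ge> 0" and yz: "?y = ?z + b" using assms by (simp_all add: algebra_simps)
    then have y: "?y > 0" using assms by linarith
    have "exp (- ?y\<^sup>2) = 1 / exp (?y\<^sup>2)" by (simp add: exp_minus inverse_eq_divide)
    also have "\<dots> \<le> 1 / (1 + ?y\<^sup>2)"
      using exp_ge_add_one_self[of "?y\<^sup>2"] by (intro divide_left_mono) (auto intro!: mult_pos_pos add_pos_nonneg)
    also have "\<dots> \<le> 2 / (1 + ?y)\<^sup>2"
    proof -
      have "0 \<le> (1 - ?y)\<^sup>2" by simp
      then have "(1 + ?y)\<^sup>2 \<le> 2 * (1 + ?y\<^sup>2)" unfolding power2_eq_square by (simp add: algebra_simps)
      then show ?thesis using y by (simp add: field_simps add_pos_nonneg)
    qed
    also have "\<dots> \<le> 2 / ((1 + ?z) * (1 + ?y))"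
    proof (rule divide_left_mono)
      have "1 + ?z \<le> 1 + ?y" using yz assms by linarith
      then show "(1 + ?z) * (1 + ?y) \<le> (1 + ?y)\<^sup>2"
        using y unfolding power2_eq_square by (intro mult_right_mono) simp_all
      have "0 < 1 + ?z" "0 < 1 + ?y" using y z by linarith+
      then show "0 < (1 + ?y)\<^sup>2 * ((1 + ?z) * (1 + ?y))" by (simp only: zero_less_mult_iff zero_less_power simp_thms)
    qed simp
    also have "\<dots> = 2 / (b * (1 + ?z)) - 2 / (b * (1 + ?y))"
    proof -
      have "1 + ?z > 0" "1 + ?y > 0" using y z by auto
      then have "2 / (b * (1 + ?z)) - 2 / (b * (1 + ?y)) = 2 * (?y - ?z) / (b * ((1 + ?z) * (1 + ?y)))"
        using assms by (simp add: divide_simps)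
      also have "?y - ?z = b" using yz by simp
      finally show ?thesis using assms by simp
    qed
    finally show ?case using Suc.IH by simp
  qed simp
  also have "\<dots> \<le> 2 / b" using assms by simp
  finally show ?thesis .
qed

lemma sum_modes_le_sqrt:
  assumes "p > 0" "s > 0"
  shows "(\<Sum>j\<in>{0..<int p}. exp (- 2 * s * gap p j)) \<le> 1 + 2 * real p / sqrt s"
proof -
  let ?B = "{j. 1 \<le> j \<and> 2 * j \<le> int p}"
  define b where "b = 2 * sqrt s / real p"
  have b: "b > 0" using assms by (simp add: b_def)
  have "(\<Sum>j\<in>?B. exp (- 2 * s * gap p j)) \<le> (\<Sum>j\<in>?B. exp (- (b * real (nat j))\<^sup>2))"
  proof (intro sum_mono)
    fix j assume j: "j \<in> ?B"
    have "2 * s * (2 * (of_int j / real p)\<^sup>2) \<le> 2 * s * gap p j"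
      using j assms by (intro mult_left_mono gap_ge_square) auto
    moreover have "(b * real (nat j))\<^sup>2 = 2 * s * (2 * (of_int j / real p)\<^sup>2)"
      using j assms by (simp add: b_def power_mult_distrib power_divide)
    ultimately show "exp (- 2 * s * gap p j) \<le> exp (- (b * real (nat j))\<^sup>2)" by simp
  qed
  also have "\<dots> = (\<Sum>i\<in>nat ` ?B. exp (- (b * real i)\<^sup>2))"
    by (subst sum.reindex) (auto simp: inj_on_def)
  also have "\<dots> \<le> (\<Sum>i\<in>{1..p}. exp (- (b * real i)\<^sup>2))"
    by (intro sum_mono2) (auto simp: nat_le_iff)
  also have "\<dots> \<le> 2 / b" using b by (rule sum_exp_square_le)
  finally have "(\<Sum>j\<in>?B. exp (- 2 * s * gap p j)) \<le> 2 / b" .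
  then show ?thesis
    using sum_modes_le_half[of p "\<lambda>g. exp (- 2 * s * g)"] assms by (simp add: b_def)
qed

text \<open>
  The lower bound holds at all times and makes the first squared coefficient at most \<open>1 / 2\<close> when the
  deficit is at most \<open>1 / 8\<close>; this is what the geometric series in the upper bound requires.
\<close>

lemma entropy_deficit_bounds:
  assumes "p \<ge> 2" "s \<ge> 0" and R: "R = ln (real p) - cyclic_entropy w p s" "R \<le> 1 / 8"
  shows "exp (- 2 * s * gap p 1) / 4 \<le> R" "R \<le> 4 * exp (- 2 * s * gap p 1)"
proof -
  let ?x = "exp (- 2 * s * gap p 1)"
  show lower: "?x / 4 \<le> R"
    using entropy_deficit_lower[of p s w] assms by (simp add: gap_def angle_def)
  have "R \<le> ln (\<Sum>j\<in>{0..<int p}. exp (- 2 * s * gap p j))"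
    using entropy_deficit_upper[of p s w] assms by (simp add: gap_def)
  also have "\<dots> \<le> ln (1 + 4 * ?x)"
  proof (rule ln_mono)
    show "0 < (\<Sum>j\<in>{0..<int p}. exp (- 2 * s * gap p j))"
      using assms by (intro sum_pos) auto
    show "(\<Sum>j\<in>{0..<int p}. exp (- 2 * s * gap p j)) \<le> 1 + 4 * ?x"
      using assms lower by (intro sum_modes_le_geometric) auto
  qed
  also have "\<dots> \<le> 4 * ?x" by (rule ln_add_one_self_le_self) simp
  finally show "R \<le> 4 * ?x" .
qed

text \<open>
  The upper bound on the deficit, rearranged into an upper bound on the time at which a given entropy
  is reached.
\<close>

lemma sqrt_time_le:
  assumes "p > 0" "s > 0"
  shows "sqrt s * (exp (ln (real p) - cyclic_entropy w p s) - 1) \<le> 2 * real p"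
proof -
  have "ln (real p) - cyclic_entropy w p s \<le> ln (\<Sum>j\<in>{0..<int p}. exp (- 2 * s * gap p j))"
    using entropy_deficit_upper[of p s w] assms by (simp add: gap_def)
  also have "\<dots> \<le> ln (1 + 2 * real p / sqrt s)"
    using assms by (intro ln_mono sum_modes_le_sqrt sum_pos) auto
  finally have "exp (ln (real p) - cyclic_entropy w p s) \<le> 1 + 2 * real p / sqrt s"
    using assms by (subst (asm) ln_ge_iff[symmetric, THEN sym]) (auto intro: add_pos_nonneg)
  then show ?thesis using assms by (simp add: field_simps)
qed

lemma cyclic_prob_le:
  assumes "p > 0" "s > 0"
  shows "cyclic_prob w p s (z mod int p) \<le> 1 / real p + 4 / sqrt s"
proof -
  have "cyclic_prob w p s (z mod int p) = norm (complex_of_real (cyclic_prob w p s (z mod int p)))"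
    by simp
  also have "\<dots> \<le> (\<Sum>j\<in>{0..<int p}. norm (cis (- angle p j * of_int z) * mode w p s j)) / real p"
    using assms by (subst pmf_cyclic_position) (auto simp: norm_divide intro!: divide_right_mono norm_sum)
  also have "\<dots> = (\<Sum>j\<in>{0..<int p}. exp (- 2 * (s / 2) * gap p j)) / real p"
    by (simp add: norm_mult norm_mode gap_def)
  also have "\<dots> \<le> (1 + 2 * real p / sqrt (s / 2)) / real p"
    using assms by (intro divide_right_mono sum_modes_le_sqrt) auto
  also have "\<dots> = 1 / real p + 2 / sqrt (s / 2)" using assms by (simp add: field_simps)
  also have "\<dots> \<le> 1 / real p + 4 / sqrt s"
  proof -
    have "sqrt s / 2 \<le> sqrt (s / 2)"
      using assms by (intro real_le_rsqrt) (simp add: power_divide)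
    then have "2 / sqrt (s / 2) \<le> 2 / (sqrt s / 2)"
      using assms by (intro divide_left_mono) auto
    then show ?thesis by simp
  qed
  finally show ?thesis .
qed

section \<open>Upper bounds on the entropy by comparison with a reference law\<close>

text \<open>
  Factorial moments of the Poisson law: multiplying by \<open>n\<close> shifts the law by one and contributes a
  factor \<open>s\<close>.
\<close>

lemma poisson_sums:
  assumes "s > 0"
  shows "(\<lambda>n. pmf (poisson_pmf s) n) sums 1"
    and "(\<lambda>n. pmf (poisson_pmf s) n * real n) sums s"
    and "(\<lambda>n. pmf (poisson_pmf s) n * (real n * (real n - 1))) sums s\<^sup>2"
proof -
  have "(\<lambda>n. s ^ n /\<^sub>R fact n * exp (- s)) sums (exp s * exp (- s))"
    by (intro sums_mult2 exp_converges)
  then show 0: "(\<lambda>n. pmf (poisson_pmf s) n) sums 1"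
    using assms by (simp add: exp_minus field_simps)
  have shift: "pmf (poisson_pmf s) (Suc n) * real (Suc n) = s * pmf (poisson_pmf s) n" for n
    using assms by (simp add: field_simps del: of_nat_Suc)
  have "(\<lambda>n. pmf (poisson_pmf s) (Suc n) * real (Suc n)) sums (s * 1)"
    unfolding shift by (intro sums_mult 0)
  from sums_Suc[OF this] show 1: "(\<lambda>n. pmf (poisson_pmf s) n * real n) sums s"
    by simp
  have "pmf (poisson_pmf s) (Suc n) * (real (Suc n) * (real (Suc n) - 1))
      = s * (pmf (poisson_pmf s) n * real n)" for n
    by (simp only: mult.assoc[symmetric] shift) simp
  moreover have "(\<lambda>n. s * (pmf (poisson_pmf s) n * real n)) sums (s * s)"
    by (intro sums_mult 1)
  ultimately have "(\<lambda>n. pmf (poisson_pmf s) (Suc n) * (real (Suc n) * (real (Suc n) - 1))) sums (s * s)"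
    by presburger
  from sums_Suc[OF this] show "(\<lambda>n. pmf (poisson_pmf s) n * (real n * (real n - 1))) sums s\<^sup>2"
    by (simp add: power2_eq_square)
qed

lemma nn_integral_poisson:
  assumes "s > 0" "\<And>n. 0 \<le> f n" "(\<lambda>n. pmf (poisson_pmf s) n * f n) sums x"
  shows "(\<integral>\<^sup>+n. ennreal (f n) \<partial>poisson_pmf s) = ennreal x"
proof -
  have "(\<integral>\<^sup>+n. ennreal (f n) \<partial>poisson_pmf s) = (\<Sum>n. ennreal (pmf (poisson_pmf s) n * f n))"
    using assms(2) by (simp add: nn_integral_measure_pmf nn_integral_count_space_nat ennreal_mult' del: pmf_poisson)
  also have "\<dots> = ennreal x"
    using assms by (intro suminf_ennreal_eq) (auto simp del: pmf_poisson)
  finally show ?thesis .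
qed

text \<open>
  The mean of the integer walk at time \<open>s\<close>.
\<close>

definition drift :: "walk \<Rightarrow> real \<Rightarrow> real" where
  "drift w s = (case w of Simple \<Rightarrow> 0 | Directed \<Rightarrow> s)"

lemma int_walk_Directed: "int_walk Directed n = return_pmf (int n)"
  by (induction n) (auto simp: bind_return_pmf)

lemma nn_integral_int_walk_Simple:
  "(\<integral>\<^sup>+z. ennreal ((of_int z)\<^sup>2) \<partial>int_walk Simple n) = ennreal (real n)"
proof (induction n)
  case (Suc n)
  have "(\<integral>\<^sup>+e. ennreal ((of_int (z + e))\<^sup>2) \<partial>pmf_of_set {-1, 1}) = ennreal ((of_int z)\<^sup>2) + 1" for z :: int
  proof -
    have "(\<integral>\<^sup>+e. ennreal ((of_int (z + e))\<^sup>2) \<partial>pmf_of_set {-1, 1})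
        = ennreal ((of_int z - 1)\<^sup>2 * (1 / 2)) + ennreal ((of_int z + 1)\<^sup>2 * (1 / 2))"
      by (subst nn_integral_measure_pmf_finite) (auto simp: ennreal_mult'' divide_ennreal_def simp flip: ennreal_divide_numeral)
    also have "\<dots> = ennreal ((of_int z)\<^sup>2 + 1)"
    proof (subst ennreal_plus[symmetric])
      show "ennreal ((of_int z - 1)\<^sup>2 * (1 / 2) + (of_int z + 1)\<^sup>2 * (1 / 2)) = ennreal ((of_int z)\<^sup>2 + 1)"
        by (rule arg_cong[where f = ennreal]) (simp add: power2_eq_square algebra_simps)
    qed auto
    finally show ?thesis by simp
  qed
  then have "(\<integral>\<^sup>+z. ennreal ((of_int z)\<^sup>2) \<partial>int_walk Simple (Suc n))
      = (\<integral>\<^sup>+z. ennreal ((of_int z)\<^sup>2) + 1 \<partial>int_walk Simple n)"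
    by simp
  also have "\<dots> = ennreal (real n) + 1"
    by (subst nn_integral_add) (auto simp: Suc)
  also have "\<dots> = ennreal (real (Suc n))"
    using ennreal_plus[of "real n" 1] by (simp add: add.commute)
  finally show ?case .
qed simp

lemma nn_integral_second_moment:
  assumes "s \<ge> 0"
  shows "(\<integral>\<^sup>+z. ennreal ((of_int z - drift w s)\<^sup>2) \<partial>int_position w s) = ennreal s"
proof (cases "s = 0")
  case True
  then show ?thesis
    by (cases w) (auto simp: int_position_def jump_count_def drift_def bind_return_pmf)
next
  case False
  then have s: "s > 0" using assms by simp
  show ?thesis
  proof (cases w)
    case Simple
    then show ?thesis
      using s poisson_sums(2)[OF s]
      by (simp add: int_position_def jump_count_def drift_def nn_integral_int_walk_Simple nn_integral_poisson)
  next
    case Directed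
    have "(\<lambda>n. pmf (poisson_pmf s) n * (real n * (real n - 1)) + (1 - 2 * s) * (pmf (poisson_pmf s) n * real n)
        + s\<^sup>2 * pmf (poisson_pmf s) n) sums (s\<^sup>2 + (1 - 2 * s) * s + s\<^sup>2 * 1)"
      by (intro sums_add sums_mult poisson_sums s)
    moreover have "pmf (poisson_pmf s) n * (real n * (real n - 1)) + (1 - 2 * s) * (pmf (poisson_pmf s) n * real n)
        + s\<^sup>2 * pmf (poisson_pmf s) n = pmf (poisson_pmf s) n * (real n - s)\<^sup>2" for n
      by (simp add: power2_eq_square algebra_simps del: pmf_poisson)
    moreover have "s\<^sup>2 + (1 - 2 * s) * s + s\<^sup>2 * 1 = s" by (simp add: power2_eq_square algebra_simps)
    ultimately have "(\<lambda>n. pmf (poisson_pmf s) n * (real n - s)\<^sup>2) sums s" by simp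
    then show ?thesis
      using s Directed
      by (simp add: int_position_def jump_count_def drift_def int_walk_Directed nn_integral_poisson)
  qed
qed

lemma second_moment:
  assumes "s \<ge> 0"
  shows "integrable (int_position w s) (\<lambda>z. (of_int z - drift w s)\<^sup>2)"
    and "measure_pmf.expectation (int_position w s) (\<lambda>z. (of_int z - drift w s)\<^sup>2) = s"
proof -
  show "integrable (int_position w s) (\<lambda>z. (of_int z - drift w s)\<^sup>2)"
    by (rule integrableI_nonneg) (auto simp: nn_integral_second_moment[OF assms])
  show "measure_pmf.expectation (int_position w s) (\<lambda>z. (of_int z - drift w s)\<^sup>2) = s"
    by (subst integral_eq_nn_integral) (auto simp: nn_integral_second_moment[OF assms] assms)
qed

lemma expectation_mod:
  fixes h :: "int \<Rightarrow> real"
  assumes "p > 0"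
  shows "measure_pmf.expectation (int_position w s) (\<lambda>z. h (z mod int p))
    = (\<Sum>x\<in>{0..<int p}. cyclic_prob w p s x * h x)"
    and "integrable (int_position w s) (\<lambda>z. h (z mod int p))"
proof -
  have "measure_pmf.expectation (int_position w s) (\<lambda>z. h (z mod int p))
      = measure_pmf.expectation (cyclic_position w p s) h"
    by (simp add: cyclic_position_def)
  also have "\<dots> = (\<Sum>x\<in>{0..<int p}. cyclic_prob w p s x * h x)"
    using set_cyclic_position[OF assms, of w s]
    by (subst integral_measure_pmf_real[of "{0..<int p}"]) (auto simp: mult.commute)
  finally show "measure_pmf.expectation (int_position w s) (\<lambda>z. h (z mod int p))
    = (\<Sum>x\<in>{0..<int p}. cyclic_prob w p s x * h x)" .
  have "norm (h (z mod int p)) \<le> (\<Sum>x\<in>{0..<int p}. \<bar>h x\<bar>)" for z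
    using assms by (auto intro!: member_le_sum[of _ _ "\<lambda>x. \<bar>h x\<bar>"])
  then show "integrable (int_position w s) (\<lambda>z. h (z mod int p))"
    by (intro measure_pmf.integrable_const_bound[where B = "\<Sum>x\<in>{0..<int p}. \<bar>h x\<bar>"]) auto
qed

text \<open>
  Gibbs' inequality against the reference law of \<open>g\<close> under \<open>N\<close>. The reference law is given on the
  integers; reducing it modulo \<open>p\<close> only increases the mass at the position of the walk, so the cross
  entropy may be computed on the integers, where \<open>f\<close> is a simple function of the position.
\<close>

lemma cyclic_entropy_le_cross_entropy:
  fixes g :: "'a \<Rightarrow> int" and f :: "int \<Rightarrow> real"
  assumes p: "p > 0" and N: "prob_space N" and g[measurable]: "g \<in> measurable N (count_space UNIV)"
    and f: "integrable (int_position w s) f"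
    and low: "\<And>z. exp (- f z) \<le> measure N {\<omega> \<in> space N. g \<omega> = z}"
  shows "cyclic_entropy w p s \<le> measure_pmf.expectation (int_position w s) f"
proof -
  interpret N: prob_space N by (rule N)
  define b where "b = (\<lambda>x. measure N {\<omega> \<in> space N. g \<omega> mod int p = x})"
  have b: "exp (- f z) \<le> b (z mod int p)" for z
  proof -
    have "measure N {\<omega> \<in> space N. g \<omega> = z} \<le> b (z mod int p)"
      unfolding b_def by (intro N.finite_measure_mono) auto
    then show ?thesis using low[of z] by linarith
  qed
  have pos: "0 < b x" if "x \<in> {0..<int p}" for x
  proof -
    have "exp (- f x) \<le> b x" using b[of x] that by simp
    then show ?thesis by (rule less_le_trans[OF exp_gt_zero])
  qed
  have "sum b {0..<int p} = measure N (\<Union>x\<in>{0..<int p}. {\<omega> \<in> space N. g \<omega> mod int p = x})"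
    unfolding b_def by (intro N.finite_measure_finite_Union[symmetric]) (auto simp: disjoint_family_on_def)
  also have "\<dots> \<le> 1" by (rule N.prob_le_1)
  finally have "cyclic_entropy w p s \<le> - (\<Sum>x\<in>{0..<int p}. cyclic_prob w p s x * ln (b x))"
    unfolding cyclic_entropy_def using p pos by (intro gibbs_le) (auto simp: sum_cyclic_prob)
  also have "\<dots> = measure_pmf.expectation (int_position w s) (\<lambda>z. - ln (b (z mod int p)))"
    by (subst expectation_mod(1)[OF p, where h = "\<lambda>x. - ln (b x)"]) (simp add: sum_negf)
  also have "\<dots> \<le> measure_pmf.expectation (int_position w s) f"
  proof (rule integral_mono)
    show "integrable (int_position w s) (\<lambda>z. - ln (b (z mod int p)))"
      by (rule expectation_mod(2)[OF p, where h = "\<lambda>x. - ln (b x)"])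
    show "- ln (b (z mod int p)) \<le> f z" for z
    proof -
      have "ln (exp (- f z)) \<le> ln (b (z mod int p))" using b[of z] by (intro ln_mono) auto
      then show ?thesis by simp
    qed
  qed (rule f)
  finally show ?thesis .
qed

text \<open>
  The reference law is a geometric law with parameter \<open>q\<close>, transported to the integers by \<open>int_decode\<close>.
  Its mass at \<open>z\<close> decays no faster than exponentially in \<open>\<bar>z\<bar> \<le> z\<^sup>2\<close>, so the cross entropy is controlled by the second
  moment.
\<close>

lemma cyclic_entropy_le_small:
  assumes "p > 0" "s \<ge> 0" "0 < q" "q < 1"
  shows "cyclic_entropy w p s \<le> - ln q - 4 * (s + s\<^sup>2) * ln (1 - q)"
proof -
  define c where "c = drift w s"
  define f where "f = (\<lambda>z::int. - ln q - 4 * ((of_int z - c)\<^sup>2 + c\<^sup>2) * ln (1 - q))"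
  have int: "integrable (int_position w s) f"
    unfolding f_def c_def using second_moment(1)[OF assms(2)] by auto
  have "cyclic_entropy w p s \<le> measure_pmf.expectation (int_position w s) f"
  proof (rule cyclic_entropy_le_cross_entropy[where N = "geometric_pmf q" and g = int_decode])
    fix z :: int
    have "real (int_encode z) \<le> 2 * \<bar>of_int z\<bar>"
      by (simp add: int_encode_def sum_encode_def)
    also have "\<dots> \<le> 2 * (of_int z)\<^sup>2"
    proof -
      have "\<bar>z\<bar> \<le> \<bar>z\<bar> * \<bar>z\<bar>" using mult_right_mono[of 1 "\<bar>z\<bar>" "\<bar>z\<bar>"] by (cases "z = 0") auto
      then have "\<bar>z\<bar> \<le> z\<^sup>2" by (simp add: power2_eq_square flip: abs_mult)
      then have "real_of_int \<bar>z\<bar> \<le> real_of_int (z\<^sup>2)" by (simp only: of_int_le_iff)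
      then show ?thesis by simp
    qed
    also have "\<dots> \<le> 4 * ((of_int z - c)\<^sup>2 + c\<^sup>2)"
    proof -
      have "0 \<le> (of_int z - 2 * c)\<^sup>2" by simp
      then show ?thesis by (simp add: power2_eq_square algebra_simps)
    qed
    finally have "real (int_encode z) * (- ln (1 - q)) \<le> 4 * ((of_int z - c)\<^sup>2 + c\<^sup>2) * (- ln (1 - q))"
      using assms by (intro mult_right_mono) auto
    then have "exp (- f z) \<le> exp (ln q + real (int_encode z) * ln (1 - q))"
      by (simp add: f_def)
    also have "\<dots> = (1 - q) ^ int_encode z * q"
      using assms by (simp add: exp_add exp_of_nat_mult mult.commute)
    also have "\<dots> = measure (geometric_pmf q) {int_encode z}"
      using assms by (simp add: measure_pmf_single)
    also have "{int_encode z} = {\<omega> \<in> space (measure_pmf (geometric_pmf q)). int_decode \<omega> = z}"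
      by auto
    finally show "exp (- f z) \<le> measure (geometric_pmf q) {\<omega> \<in> space (measure_pmf (geometric_pmf q)). int_decode \<omega> = z}" .
  qed (use assms int in \<open>auto simp: measure_pmf.prob_space_axioms\<close>)
  also have "\<dots> = - ln q - 4 * (s + c\<^sup>2) * ln (1 - q)"
    unfolding f_def using second_moment[OF assms(2), of w] by (simp add: c_def)
  also have "\<dots> \<le> - ln q - 4 * (s + s\<^sup>2) * ln (1 - q)"
  proof -
    have "c\<^sup>2 \<le> s\<^sup>2" by (cases w) (auto simp: c_def drift_def)
    then have "4 * (s + c\<^sup>2) * - ln (1 - q) \<le> 4 * (s + s\<^sup>2) * - ln (1 - q)"
      using assms by (intro mult_right_mono) auto
    then show ?thesis by simp
  qed
  finally show ?thesis .
qed

text \<open>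
  The point is uniformity in \<open>p\<close>: even for large \<open>p\<close> little entropy is produced in a short time. Take
  \<open>q\<close> close to \<open>1\<close> in \<open>cyclic_entropy_le_small\<close>, then \<open>s\<close> small.
\<close>

lemma cyclic_entropy_small_time:
  assumes "c > 0"
  obtains \<delta> where "\<delta> > 0" "\<And>w p s. p > 0 \<Longrightarrow> 0 \<le> s \<Longrightarrow> s < \<delta> \<Longrightarrow> cyclic_entropy w p s < c"
proof -
  define q where "q = exp (- c / 2)"
  have q: "0 < q" "q < 1" using assms by (auto simp: q_def)
  define L where "L = - ln (1 - q)"
  have L: "L > 0" using q by (simp add: L_def)
  \<comment> \<open>For \<open>s \<le> 1\<close> the term \<open>4 (s + s\<^sup>2) L\<close> is at most \<open>8 s L\<close>; the bound \<open>c / (16 L)\<close> makes this less than \<open>c / 2\<close>.\<close>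
  define \<delta> where "\<delta> = min 1 (c / (16 * L))"
  show thesis
  proof (rule that[of \<delta>])
    show "\<delta> > 0" using assms L by (simp add: \<delta>_def)
    fix w :: walk and p :: nat and s :: real
    assume "p > 0" "0 \<le> s" "s < \<delta>"
    then have "cyclic_entropy w p s \<le> c / 2 + 4 * (s + s\<^sup>2) * L"
      using cyclic_entropy_le_small[of p s q w] q by (simp add: L_def q_def)
    also have "s\<^sup>2 \<le> s" using \<open>0 \<le> s\<close> \<open>s < \<delta>\<close> mult_left_mono[of s 1 s]
      by (simp add: \<delta>_def power2_eq_square)
    then have "4 * (s + s\<^sup>2) * L \<le> 8 * s * L" using L by (intro mult_right_mono) auto
    also have "\<dots> < c / 2" using \<open>s < \<delta>\<close> L by (simp add: \<delta>_def field_simps)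
    finally show "cyclic_entropy w p s < c" by simp
  qed
qed

text \<open>
  On the interval, the density is at least its value at distance \<open>sqrt ((z - c)\<^sup>2 + 1 / 4)\<close> from the mean
  times the linear function \<open>1 - (z - c) (t - z) / \<sigma>\<^sup>2\<close>, by the tangent to the exponential. The linear
  term integrates to zero because the interval is symmetric around \<open>z\<close>.
\<close>

lemma normal_mass_unit_interval_ge:
  fixes z c \<sigma> :: real
  assumes "\<sigma> > 0"
  shows "exp (- ((z - c)\<^sup>2 + 1 / 4) / (2 * \<sigma>\<^sup>2)) / sqrt (2 * pi * \<sigma>\<^sup>2)
    \<le> measure (density lborel (normal_density c \<sigma>)) {z - 1 / 2..<z + 1 / 2}"
proof -
  let ?N = "density lborel (normal_density c \<sigma>)"
  interpret N: prob_space ?N using assms by (rule prob_space_normal_density)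
  define K where "K = exp (- ((z - c)\<^sup>2 + 1 / 4) / (2 * \<sigma>\<^sup>2)) / sqrt (2 * pi * \<sigma>\<^sup>2)"
  have K: "K > 0" using assms by (simp add: K_def)
  let ?I = "{z - 1 / 2..z + 1 / 2}"
  define F where "F = (\<lambda>t. t - (z - c) * (t - z)\<^sup>2 / (2 * \<sigma>\<^sup>2))"
  let ?f = "\<lambda>t. 1 - (z - c) * (t - z) / \<sigma>\<^sup>2"
  have F: "has_bochner_integral lborel (\<lambda>t. ?f t * indicator ?I t) (F (z + 1 / 2) - F (z - 1 / 2))"
  proof (rule has_bochner_integral_FTC_Icc_real)
    fix t
    show "DERIV F t :> ?f t"
      unfolding F_def using assms by (auto intro!: derivative_eq_intros simp: field_simps power2_eq_square)
    show "isCont ?f t" using assms by (intro continuous_intros) auto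
  qed simp
  have F1: "F (z + 1 / 2) - F (z - 1 / 2) = 1" by (simp add: F_def)
  have low: "K * ?f t \<le> normal_density c \<sigma> t" if t: "t \<in> ?I" for t
  proof -
    have "\<bar>t - z\<bar> \<le> 1 / 2" using t by (intro abs_leI) auto
    then have "(t - z)\<^sup>2 \<le> (1 / 2)\<^sup>2" by (metis abs_ge_zero power2_abs power_mono)
    then have sq: "(t - z)\<^sup>2 \<le> 1 / 4" by (simp add: power2_eq_square)
    have "(t - c)\<^sup>2 = (z - c)\<^sup>2 + 2 * ((z - c) * (t - z)) + (t - z)\<^sup>2"
      by (simp add: power2_eq_square algebra_simps)
    then have "- ((z - c)\<^sup>2 + 1 / 4) - 2 * ((z - c) * (t - z)) \<le> - (t - c)\<^sup>2"
      using sq by linarith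
    then have "(- ((z - c)\<^sup>2 + 1 / 4) - 2 * ((z - c) * (t - z))) / (2 * \<sigma>\<^sup>2) \<le> - (t - c)\<^sup>2 / (2 * \<sigma>\<^sup>2)"
      by (rule divide_right_mono) simp
    then have "- ((z - c)\<^sup>2 + 1 / 4) / (2 * \<sigma>\<^sup>2) + - ((z - c) * (t - z) / \<sigma>\<^sup>2) \<le> - (t - c)\<^sup>2 / (2 * \<sigma>\<^sup>2)"
      by (simp add: diff_divide_distrib)
    then have "exp (- ((z - c)\<^sup>2 + 1 / 4) / (2 * \<sigma>\<^sup>2)) * exp (- ((z - c) * (t - z) / \<sigma>\<^sup>2))
        \<le> exp (- (t - c)\<^sup>2 / (2 * \<sigma>\<^sup>2))"
      unfolding exp_add[symmetric] by (simp only: exp_le_cancel_iff)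
    moreover have "?f t \<le> exp (- ((z - c) * (t - z) / \<sigma>\<^sup>2))"
      using exp_ge_add_one_self[of "- ((z - c) * (t - z) / \<sigma>\<^sup>2)"] by simp
    then have "exp (- ((z - c)\<^sup>2 + 1 / 4) / (2 * \<sigma>\<^sup>2)) * ?f t
        \<le> exp (- ((z - c)\<^sup>2 + 1 / 4) / (2 * \<sigma>\<^sup>2)) * exp (- ((z - c) * (t - z) / \<sigma>\<^sup>2))"
      by (rule mult_left_mono) simp
    ultimately have "exp (- ((z - c)\<^sup>2 + 1 / 4) / (2 * \<sigma>\<^sup>2)) * ?f t \<le> exp (- (t - c)\<^sup>2 / (2 * \<sigma>\<^sup>2))"
      by linarith
    then have "exp (- ((z - c)\<^sup>2 + 1 / 4) / (2 * \<sigma>\<^sup>2)) * ?f t / sqrt (2 * pi * \<sigma>\<^sup>2)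
        \<le> exp (- (t - c)\<^sup>2 / (2 * \<sigma>\<^sup>2)) / sqrt (2 * pi * \<sigma>\<^sup>2)"
      by (rule divide_right_mono) simp
    then show ?thesis by (simp add: K_def normal_density_def)
  qed
  have "K = K * (\<integral>t. ?f t * indicator ?I t \<partial>lborel)"
    using F F1 by (simp add: has_bochner_integral_integral_eq)
  also have "\<dots> = (\<integral>t. K * (?f t * indicator ?I t) \<partial>lborel)" by simp
  also have "\<dots> \<le> (\<integral>t. normal_density c \<sigma> t * indicator ?I t \<partial>lborel)"
  proof (rule integral_mono)
    show "integrable lborel (\<lambda>t. K * (?f t * indicator ?I t))"
      using F by (intro integrable_mult_right) (simp add: has_bochner_integral_iff)
    show "integrable lborel (\<lambda>t. normal_density c \<sigma> t * indicator ?I t)"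
      using integrable_normal_density[OF assms] by (rule integrable_real_mult_indicator[rotated]) simp
    show "K * (?f t * indicator ?I t) \<le> normal_density c \<sigma> t * indicator ?I t" for t
      using low[of t] by (auto simp: indicator_def)
  qed
  also have "\<dots> = (\<integral>t. normal_density c \<sigma> t * indicator {z - 1 / 2..<z + 1 / 2} t \<partial>lborel)"
  proof (rule integral_cong_AE)
    have "AE t in lborel. t \<noteq> z + 1 / 2" by (rule AE_lborel_singleton)
    then show "AE t in lborel. normal_density c \<sigma> t * indicator ?I t
        = normal_density c \<sigma> t * indicator {z - 1 / 2..<z + 1 / 2} t"
      by eventually_elim (auto simp: indicator_def)
  qed auto
  also have "\<dots> = (\<integral>t. indicator {z - 1 / 2..<z + 1 / 2} t \<partial>?N)"
    by (subst integral_density) (auto simp: normal_density_nonneg)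
  also have "\<dots> = measure ?N {z - 1 / 2..<z + 1 / 2}" by simp
  finally show ?thesis unfolding K_def .
qed

text \<open>
  The reference law is a Gaussian with the mean and the variance of the walk, rounded to the nearest
  integer. The logarithm of its mass is quadratic up to the rounding error, so the cross entropy is
  determined by the variance of the walk.
\<close>

lemma cyclic_entropy_le_gaussian:
  assumes "p > 0" "s > 0"
  shows "cyclic_entropy w p s \<le> ln (2 * pi * exp 1 * s) / 2 + 1 / (8 * s)"
proof -
  define c where "c = drift w s"
  define f where "f = (\<lambda>z::int. ln (sqrt (2 * pi * s)) + ((of_int z - c)\<^sup>2 + 1 / 4) / (2 * s))"
  have int: "integrable (int_position w s) f"
    unfolding f_def c_def using second_moment(1)[of s w] assms by auto
  have "cyclic_entropy w p s \<le> measure_pmf.expectation (int_position w s) f"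
  proof (rule cyclic_entropy_le_cross_entropy[where N = "density lborel (normal_density c (sqrt s))"
        and g = "\<lambda>t. \<lfloor>t + 1 / 2\<rfloor>"])
    have "0 < sqrt s" using assms(2) by simp
    then show "prob_space (density lborel (normal_density c (sqrt s)))"
      by (rule prob_space_normal_density)
    fix z :: int
    have "exp (- f z) = exp (- ((of_int z - c)\<^sup>2 + 1 / 4) / (2 * (sqrt s)\<^sup>2)) / sqrt (2 * pi * (sqrt s)\<^sup>2)"
    proof -
      have "- f z = - ((of_int z - c)\<^sup>2 + 1 / 4) / (2 * s) - ln (sqrt (2 * pi * s))"
        unfolding f_def by (subst minus_divide_left[symmetric]) linarith
      then have "exp (- f z) = exp (- ((of_int z - c)\<^sup>2 + 1 / 4) / (2 * s)) / exp (ln (sqrt (2 * pi * s)))"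
        by (simp only: exp_diff)
      then show ?thesis using assms by simp
    qed
    also have "\<dots> \<le> measure (density lborel (normal_density c (sqrt s))) {of_int z - 1 / 2..<of_int z + 1 / 2}"
      using assms by (intro normal_mass_unit_interval_ge) auto
    also have "{of_int z - 1 / 2..<of_int z + 1 / 2}
        = {\<omega> \<in> space (density lborel (normal_density c (sqrt s))). \<lfloor>\<omega> + 1 / 2\<rfloor> = z}"
      by (auto simp: floor_eq_iff)
    finally show "exp (- f z) \<le> measure (density lborel (normal_density c (sqrt s)))
        {\<omega> \<in> space (density lborel (normal_density c (sqrt s))). \<lfloor>\<omega> + 1 / 2\<rfloor> = z}" .
  qed (use assms int in auto)
  also have "\<dots> = ln (sqrt (2 * pi * s)) + (s + 1 / 4) / (2 * s)"
    unfolding f_def using second_moment[of s w] assms by (simp add: c_def)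
  also have "\<dots> = ln (2 * pi * exp 1 * s) / 2 + 1 / (8 * s)"
    using assms by (simp add: ln_sqrt ln_mult field_simps)
  finally show ?thesis .
qed

section \<open>A local limit theorem and a sharp lower bound on the entropy\<close>

lemma sum_periodic_shift:
  fixes f :: "int \<Rightarrow> complex"
  assumes "p > 0" "\<And>j. f (j mod int p) = f j"
  shows "(\<Sum>j\<in>{a..<a + int p}. f j) = (\<Sum>j\<in>{0..<int p}. f j)"
proof (rule sum.reindex_bij_witness[of _ "\<lambda>j. (j - a) mod int p + a" "\<lambda>j. j mod int p"])
  fix j assume "j \<in> {a..<a + int p}"
  then have "(j - a) mod int p = j - a" by simp
  then show "(j mod int p - a) mod int p + a = j" by (simp add: mod_simps)
next
  fix j assume "j \<in> {0..<int p}"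
  then show "((j - a) mod int p + a) mod int p = j" by (simp add: mod_simps)
qed (use assms in auto)

text \<open>
  Frequencies represented in \<open>[- \<pi>, \<pi>]\<close>, the range in which \<open>1 - cos x \<ge> x\<^sup>2 / 8\<close> yields Gaussian
  domination.
\<close>

definition centred_modes :: "nat \<Rightarrow> int set" where
  "centred_modes p = {- int (p div 2)..<- int (p div 2) + int p}"

lemma pmf_cyclic_position_centred:
  assumes "p > 0" "s \<ge> 0"
  shows "complex_of_real (cyclic_prob w p s (z mod int p))
    = (\<Sum>j\<in>centred_modes p. cis (- angle p j * of_int z) * mode w p s j) / of_nat p"
proof -
  have per: "cis (angle p (j mod int p) * of_int e) = cis (angle p j * of_int e)" for j e
  proof -
    have swap: "angle p i * of_int e = angle p e * of_int i" for i by (simp add: angle_def)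
    show ?thesis unfolding swap by (rule cis_angle_mod[OF assms(1)])
  qed
  have "mode w p s (j mod int p) = mode w p s j" for j
    by (simp only: mode_def step_char_def per)
  moreover have "cis (- angle p (j mod int p) * of_int z) = cis (- angle p j * of_int z)" for j
    using per[of j "- z"] by simp
  ultimately show ?thesis
    unfolding pmf_cyclic_position[OF assms] centred_modes_def
    by (subst sum_periodic_shift[OF assms(1)]) simp_all
qed

text \<open>
  The characteristic function of the centred walk divided by its standard deviation \<open>sqrt s\<close>.
\<close>

definition normalized_char :: "walk \<Rightarrow> real \<Rightarrow> real \<Rightarrow> complex" where
  "normalized_char w s u
    = exp (of_real s * (step_char w (u / sqrt s) - 1) - \<i> * of_real (u * drift w s / sqrt s))"

lemma cis_Taylor_bound: "norm (cis v - 1 - \<i> * of_real v + of_real (v\<^sup>2 / 2)) \<le> \<bar>v\<bar> ^ 3 / 6"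
  using iexp_approx1[of v 2]
  by (simp add: cis_conv_exp numeral_2_eq_2 numeral_3_eq_3 fact_numeral power2_eq_square algebra_simps)

lemma norm_cis_diff_le: "norm (cis a - cis b) \<le> \<bar>a - b\<bar>"
proof -
  have "cis a - cis b = cis b * (cis (a - b) - 1)"
    by (simp add: cis_mult right_diff_distrib)
  then have "norm (cis a - cis b) = norm (cis (a - b) - 1)" by (simp add: norm_mult)
  then show ?thesis using iexp_approx1[of "a - b" 0] by (simp add: cis_conv_exp)
qed

text \<open>
  Both walks have the same second-order term; \<open>drift w 1\<close> is the mean of a single increment.
\<close>

lemma step_char_Taylor_bound:
  "norm (step_char w v - 1 - \<i> * of_real (v * drift w 1) + of_real (v\<^sup>2 / 2)) \<le> \<bar>v\<bar> ^ 3 / 6"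
proof (cases w)
  case Simple
  have "\<bar>Re (cis v - 1 - \<i> * of_real v + of_real (v\<^sup>2 / 2))\<bar> \<le> \<bar>v\<bar> ^ 3 / 6"
    using cis_Taylor_bound[of v] abs_Re_le_cmod order_trans by blast
  moreover have "step_char w v - 1 - \<i> * of_real (v * drift w 1) + of_real (v\<^sup>2 / 2)
      = of_real (Re (cis v - 1 - \<i> * of_real v + of_real (v\<^sup>2 / 2)))"
    using Simple by (simp add: drift_def step_char_simps)
  ultimately show ?thesis by (simp only: norm_of_real)
next
  case Directed
  then show ?thesis using cis_Taylor_bound[of v] by (simp add: drift_def step_char_simps)
qed

lemma normalized_char_exponent:
  assumes "s > 0"
  shows "norm (of_real s * (step_char w (u / sqrt s) - 1) - \<i> * of_real (u * drift w s / sqrt s)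
    + of_real (u\<^sup>2 / 2)) \<le> \<bar>u\<bar> ^ 3 / (6 * sqrt s)"
proof -
  define r where "r = sqrt s"
  have r: "r > 0" "s = r\<^sup>2" using assms by (simp_all add: r_def)
  have "drift w s = s * drift w 1" by (cases w) (simp_all add: drift_def)
  then have "of_real s * (step_char w (u / r) - 1) - \<i> * of_real (u * drift w s / r) + of_real (u\<^sup>2 / 2)
      = of_real s * (step_char w (u / r) - 1 - \<i> * of_real (u / r * drift w 1) + of_real ((u / r)\<^sup>2 / 2))"
    using r by (simp add: field_simps power2_eq_square)
  then have "norm (of_real s * (step_char w (u / r) - 1) - \<i> * of_real (u * drift w s / r) + of_real (u\<^sup>2 / 2))
      = s * norm (step_char w (u / r) - 1 - \<i> * of_real (u / r * drift w 1) + of_real ((u / r)\<^sup>2 / 2))"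
    using assms by (simp add: norm_mult del: of_real_mult of_real_divide)
  also have "\<dots> \<le> s * (\<bar>u / r\<bar> ^ 3 / 6)"
    using assms by (intro mult_left_mono step_char_Taylor_bound) auto
  also have "\<dots> = \<bar>u\<bar> ^ 3 / (6 * r)"
    using r by (simp add: power_divide field_simps power2_eq_square power3_eq_cube)
  finally show ?thesis by (simp only: r_def)
qed

lemma normalized_char_tendsto:
  assumes "filterlim s at_top sequentially" "\<And>n. s n > 0" "u \<longlonglongrightarrow> v"
  shows "(\<lambda>n. normalized_char (w n) (s n) (u n)) \<longlonglongrightarrow> of_real (exp (- v\<^sup>2 / 2))"
proof -
  let ?e = "\<lambda>n. of_real (s n) * (step_char (w n) (u n / sqrt (s n)) - 1)
    - \<i> * of_real (u n * drift (w n) (s n) / sqrt (s n))"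
  have "filterlim (\<lambda>n. sqrt (s n)) at_top sequentially"
    by (rule filterlim_compose[OF sqrt_at_top assms(1)])
  then have "(\<lambda>n. \<bar>u n\<bar> ^ 3 / (6 * sqrt (s n))) \<longlonglongrightarrow> 0"
    by (intro tendsto_divide_0[where c = "\<bar>v\<bar> ^ 3"] tendsto_power tendsto_rabs assms(3)
        filterlim_at_top_imp_at_infinity filterlim_tendsto_pos_mult_at_top[OF tendsto_const]) auto
  then have "(\<lambda>n. ?e n + of_real ((u n)\<^sup>2 / 2)) \<longlonglongrightarrow> 0"
    by (rule Lim_null_comparison[rotated]) (use normalized_char_exponent[OF assms(2)] in auto)
  moreover have "(\<lambda>n. complex_of_real ((u n)\<^sup>2 / 2)) \<longlonglongrightarrow> of_real (v\<^sup>2 / 2)"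
    by (intro tendsto_intros assms(3)) auto
  ultimately have "(\<lambda>n. (?e n + of_real ((u n)\<^sup>2 / 2)) - of_real ((u n)\<^sup>2 / 2)) \<longlonglongrightarrow> 0 - of_real (v\<^sup>2 / 2)"
    by (rule tendsto_diff)
  then have "?e \<longlonglongrightarrow> - of_real (v\<^sup>2 / 2)" by simp
  then have "(\<lambda>n. exp (?e n)) \<longlonglongrightarrow> exp (- of_real (v\<^sup>2 / 2))" by (rule tendsto_exp)
  moreover have "exp (- complex_of_real (v\<^sup>2 / 2)) = of_real (exp (- v\<^sup>2 / 2))"
    by (simp add: exp_of_real[symmetric])
  ultimately show ?thesis unfolding normalized_char_def by simp
qed

lemma norm_normalized_char:
  assumes "s > 0"
  shows "norm (normalized_char w s u) = exp (- s * (1 - cos (u / sqrt s)))"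
  by (simp add: normalized_char_def Re_step_char algebra_simps)

lemma norm_normalized_char_le:
  assumes "s > 0" "\<bar>u\<bar> \<le> pi * sqrt s"
  shows "norm (normalized_char w s u) \<le> exp (- u\<^sup>2 / 8)"
proof -
  have "\<bar>u / sqrt s\<bar> \<le> pi" using assms by (simp add: field_simps)
  then have "(u / sqrt s)\<^sup>2 / 8 \<le> 1 - cos (u / sqrt s)" by (rule one_minus_cos_ge)
  then have "s * ((u / sqrt s)\<^sup>2 / 8) \<le> s * (1 - cos (u / sqrt s))"
    using assms by (intro mult_left_mono) auto
  moreover have "s * ((u / sqrt s)\<^sup>2 / 8) = u\<^sup>2 / 8" using assms by (simp add: power_divide)
  ultimately show ?thesis unfolding norm_normalized_char[OF assms(1)] by simp
qed

text \<open>
  Fourier inversion on the cycle is a Riemann sum, with step \<open>\<Delta>\<close>, of the Fourier inversion integral on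
  the line. Its frequencies \<open>j \<Delta>\<close> are \<open>angle p j * sqrt s\<close>.
\<close>

lemma scaled_cyclic_prob_Riemann_sum:
  assumes "p > 0" "s > 0"
  defines "\<Delta> \<equiv> 2 * pi * sqrt s / real p"
  shows "complex_of_real (2 * pi * sqrt s * cyclic_prob w p s (z mod int p))
    = (\<Sum>j\<in>centred_modes p. of_real \<Delta> *
        (normalized_char w s (of_int j * \<Delta>) * cis (- (of_int j * \<Delta>) * ((of_int z - drift w s) / sqrt s))))"
proof -
  have eq: "of_real \<Delta> * (normalized_char w s (of_int j * \<Delta>) * cis (- (of_int j * \<Delta>) * ((of_int z - drift w s) / sqrt s)))
      = of_real (2 * pi * sqrt s) * (cis (- angle p j * of_int z) * mode w p s j) / of_nat p" for j
  proof -
    have ang: "of_int j * \<Delta> / sqrt s = angle p j" using assms by (simp add: \<Delta>_def angle_def)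
    have "of_int j * \<Delta> * drift w s / sqrt s = angle p j * drift w s"
      unfolding ang[symmetric] by (rule times_divide_eq_left[symmetric])
    then have "normalized_char w s (of_int j * \<Delta>) = mode w p s j * exp (- (\<i> * of_real (angle p j * drift w s)))"
      unfolding normalized_char_def mode_def by (simp only: ang diff_conv_add_uminus exp_add)
    also have "exp (- (\<i> * of_real (angle p j * drift w s))) = cis (- (angle p j * drift w s))"
      by (simp add: cis_conv_exp)
    finally have "normalized_char w s (of_int j * \<Delta>) * cis (- (of_int j * \<Delta>) * ((of_int z - drift w s) / sqrt s))
        = mode w p s j * (cis (- (angle p j * drift w s)) * cis (- (of_int j * \<Delta>) * ((of_int z - drift w s) / sqrt s)))"
      by (simp only: mult.assoc)
    also have "cis (- (angle p j * drift w s)) * cis (- (of_int j * \<Delta>) * ((of_int z - drift w s) / sqrt s))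
        = cis (- angle p j * of_int z)"
    proof -
      have "- (of_int j * \<Delta>) * ((of_int z - drift w s) / sqrt s) = - (of_int j * \<Delta> / sqrt s) * (of_int z - drift w s)"
        by simp
      also have "\<dots> = - angle p j * (of_int z - drift w s)"
        by (simp only: ang)
      finally show ?thesis by (simp only: cis_mult) (simp add: algebra_simps)
    qed
    finally show ?thesis using assms by (simp add: \<Delta>_def)
  qed
  show ?thesis
    unfolding eq using assms
    by (simp add: pmf_cyclic_position_centred sum_distrib_left sum_divide_distrib)
qed

lemma gaussian_fourier:
  "(CLINT u|lborel. of_real (exp (- u\<^sup>2 / 2)) * cis (- u * y)) = of_real (sqrt (2 * pi) * exp (- y\<^sup>2 / 2))"
proof -
  have "complex_of_real (exp (- y\<^sup>2 / 2)) = char std_normal_distribution (- y)"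
    by (simp add: char_std_normal_distribution)
  also have "\<dots> = (CLINT u|lborel. std_normal_density u *\<^sub>R iexp (- y * u))"
    unfolding char_def by (subst integral_density) (auto simp: normal_density_nonneg)
  also have "\<dots> = (CLINT u|lborel. (of_real (exp (- u\<^sup>2 / 2)) * cis (- u * y)) / of_real (sqrt (2 * pi)))"
    by (intro Bochner_Integration.integral_cong)
      (auto simp: std_normal_density_def scaleR_conv_of_real cis_conv_exp mult_ac)
  also have "\<dots> = (CLINT u|lborel. of_real (exp (- u\<^sup>2 / 2)) * cis (- u * y)) / of_real (sqrt (2 * pi))"
    by (rule integral_divide_zero)
  finally show ?thesis by (simp add: field_simps)
qed

lemma integrable_exp_neg_square:
  assumes "a > 0"
  shows "integrable lborel (\<lambda>u::real. exp (- u\<^sup>2 / a))"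
proof -
  have "integrable lborel (\<lambda>u. sqrt (pi * a) * normal_density 0 (sqrt (a / 2)) u)"
    using assms by (intro integrable_mult_right integrable_normal_density) auto
  then show ?thesis using assms by (simp add: normal_density_def)
qed

text \<open>
  The Riemann sum is the integral of a step function \<open>f n\<close>. Once \<open>\<Delta> \<rightarrow> 0\<close> and \<open>s \<rightarrow> \<infinity>\<close>, this step
  function approaches the Gaussian integrand \<open>h n\<close> pointwise and is dominated by a fixed Gaussian, so
  dominated convergence applies. Boundedness of the rescaled position \<open>y n\<close> keeps the oscillating
  factor equicontinuous.
\<close>

lemma local_limit_sequence:
  fixes p :: "nat \<Rightarrow> nat" and s :: "nat \<Rightarrow> real" and z :: "nat \<Rightarrow> int" and w :: "nat \<Rightarrow> walk"
  assumes s: "\<And>n. real (Suc n) \<le> s n"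
    and sp: "\<And>n. 10 * real (Suc n) * sqrt (s n) \<le> real (p n)"
    and M: "\<And>n. \<bar>y n\<bar> \<le> M"
    and y: "\<And>n. y n = (of_int (z n) - drift (w n) (s n)) / sqrt (s n)"
  shows "(\<lambda>n. sqrt (s n) * cyclic_prob (w n) (p n) (s n) (z n mod int (p n))
    - exp (- (y n)\<^sup>2 / 2) / sqrt (2 * pi)) \<longlonglongrightarrow> 0"
proof -
  define \<Delta> where "\<Delta> = (\<lambda>n. 2 * pi * sqrt (s n) / real (p n))"
  have s0: "s n > 0" for n using s[of n] by linarith
  have p0: "p n > 0" for n
  proof -
    have "0 < 10 * real (Suc n) * sqrt (s n)" using s0[of n] by simp
    then have "0 < real (p n)" using sp[of n] by linarith
    then show ?thesis by simp
  qed
  have \<Delta>0: "\<Delta> n > 0" for n using s0[of n] p0[of n] by (simp add: \<Delta>_def)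
  \<comment> \<open>The factor \<open>10\<close> in the hypothesis absorbs the \<open>2 \<pi>\<close> in \<open>\<Delta>\<close>.\<close>
  have \<Delta>le: "\<Delta> n \<le> 1 / real (Suc n)" for n
  proof -
    have "2 * pi * sqrt (s n) * real (Suc n) \<le> 10 * sqrt (s n) * real (Suc n)"
      using pi_less_4 pi_approx(2) s0[of n] by (intro mult_right_mono) auto
    also have "\<dots> \<le> real (p n)" using sp[of n] by (simp add: mult_ac)
    finally show ?thesis using p0[of n] by (simp add: \<Delta>_def field_simps)
  qed
  have \<Delta>1: "\<Delta> n \<le> 1" for n
    using \<Delta>le[of n] by (rule order_trans) simp
  have \<Delta>lim: "\<Delta> \<longlonglongrightarrow> 0"
    by (rule tendsto_sandwich[OF _ _ tendsto_const LIMSEQ_inverse_real_of_nat])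
      (use \<Delta>0 \<Delta>le in \<open>auto simp: less_imp_le inverse_eq_divide intro!: always_eventually\<close>)
  have slim: "filterlim s at_top sequentially"
  proof (rule filterlim_at_top_mono)
    show "filterlim (\<lambda>n. real (Suc n)) at_top sequentially" by real_asymp
  qed (use s in auto)
  define G where "G = (\<lambda>n u. normalized_char (w n) (s n) u * cis (- u * y n))"
  define J where "J = (\<lambda>n. centred_modes (p n))"
  have Jbound: "\<bar>of_int j * \<Delta> n\<bar> \<le> pi * sqrt (s n)" if "j \<in> J n" for j n
  proof -
    have "\<bar>2 * j\<bar> \<le> int (p n)" using that by (auto simp: J_def centred_modes_def)
    then have "real_of_int \<bar>2 * j\<bar> \<le> real (p n)" by linarith
    then have "2 * \<bar>real_of_int j\<bar> * (pi * sqrt (s n)) \<le> real (p n) * (pi * sqrt (s n))"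
      using s0[of n] by (intro mult_right_mono) auto
    then show ?thesis using p0[of n] s0[of n] by (simp add: \<Delta>_def abs_mult field_simps)
  qed
  define f where "f = (\<lambda>n u. \<Sum>j\<in>J n. indicator {of_int j * \<Delta> n..<(of_int j + 1) * \<Delta> n} u *\<^sub>R G n (of_int j * \<Delta> n))"
  have finJ: "finite (J n)" for n by (simp add: J_def centred_modes_def)
  have f_eq: "f n u = (if \<lfloor>u / \<Delta> n\<rfloor> \<in> J n then G n (of_int \<lfloor>u / \<Delta> n\<rfloor> * \<Delta> n) else 0)" for n u
  proof -
    have "indicator {of_int j * \<Delta> n..<(of_int j + 1) * \<Delta> n} u = (if j = \<lfloor>u / \<Delta> n\<rfloor> then 1 else (0::real))" for j
    proof -
      have "(j = \<lfloor>u / \<Delta> n\<rfloor>) \<longleftrightarrow> of_int j * \<Delta> n \<le> u \<and> u < (of_int j + 1) * \<Delta> n"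
        using \<Delta>0[of n] floor_eq_iff[of "u / \<Delta> n" j]
        by (auto simp: pos_le_divide_eq pos_divide_less_eq)
      then show ?thesis by (simp add: indicator_def)
    qed
    then have "f n u = (\<Sum>j\<in>J n. if j = \<lfloor>u / \<Delta> n\<rfloor> then G n (of_int j * \<Delta> n) else 0)"
      unfolding f_def by (intro sum.cong) auto
    then show ?thesis using finJ by (simp add: sum.delta)
  qed
  have int_step: "integrable lborel (\<lambda>u. indicator {of_int j * \<Delta> n..<(of_int j + 1) * \<Delta> n} u *\<^sub>R G n (of_int j * \<Delta> n))" for j n
  proof (intro integrable_scaleR_left integrable_real_indicator)
    have "of_int j * \<Delta> n \<le> (of_int j + 1) * \<Delta> n" using \<Delta>0[of n] by (intro mult_right_mono) auto
    then show "emeasure lborel {of_int j * \<Delta> n..<(of_int j + 1) * \<Delta> n} < \<infinity>" by simp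
  qed simp
  have int_f: "(CLINT u|lborel. f n u) = of_real (2 * pi * sqrt (s n) * cyclic_prob (w n) (p n) (s n) (z n mod int (p n)))" for n
  proof -
    have "(CLINT u|lborel. indicator {of_int j * \<Delta> n..<(of_int j + 1) * \<Delta> n} u *\<^sub>R G n (of_int j * \<Delta> n))
        = of_real (\<Delta> n) * G n (of_int j * \<Delta> n)" for j
      using \<Delta>0[of n] by (subst integral_scaleR_left) (auto simp: scaleR_conv_of_real algebra_simps)
    then have "(CLINT u|lborel. f n u) = (\<Sum>j\<in>J n. of_real (\<Delta> n) * G n (of_int j * \<Delta> n))"
      unfolding f_def by (subst Bochner_Integration.integral_sum[OF int_step]) simp
    also have "\<dots> = of_real (2 * pi * sqrt (s n) * cyclic_prob (w n) (p n) (s n) (z n mod int (p n)))"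
      unfolding scaled_cyclic_prob_Riemann_sum[OF p0 s0] by (simp add: G_def J_def \<Delta>_def y)
    finally show ?thesis .
  qed
  define h where "h = (\<lambda>n u. complex_of_real (exp (- u\<^sup>2 / 2)) * cis (- u * y n))"
  have fl: "\<bar>of_int \<lfloor>u / \<Delta> n\<rfloor> * \<Delta> n - u\<bar> \<le> \<Delta> n" for n u
  proof -
    have "of_int \<lfloor>u / \<Delta> n\<rfloor> \<le> u / \<Delta> n" "u / \<Delta> n < of_int \<lfloor>u / \<Delta> n\<rfloor> + 1"
      by linarith+
    then have "of_int \<lfloor>u / \<Delta> n\<rfloor> * \<Delta> n \<le> u" "u < of_int \<lfloor>u / \<Delta> n\<rfloor> * \<Delta> n + \<Delta> n"
      unfolding pos_le_divide_eq[OF \<Delta>0] pos_divide_less_eq[OF \<Delta>0] by (simp_all add: distrib_right)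
    then show ?thesis by linarith
  qed
  have dom_f: "norm (f n u) \<le> 2 * exp (- u\<^sup>2 / 16)" for n u
  proof (cases "\<lfloor>u / \<Delta> n\<rfloor> \<in> J n")
    case True
    let ?v = "of_int \<lfloor>u / \<Delta> n\<rfloor> * \<Delta> n"
    have "norm (f n u) = norm (normalized_char (w n) (s n) ?v)"
      using True by (simp add: f_eq G_def norm_mult)
    also have "\<dots> \<le> exp (- ?v\<^sup>2 / 8)"
      by (rule norm_normalized_char_le[OF s0 Jbound[OF True]])
    also have "\<dots> \<le> exp (1 / 8 + - u\<^sup>2 / 16)"
    proof -
      have "\<bar>?v - u\<bar> \<le> 1" using fl[of u n] \<Delta>1[of n] by linarith
      then have "(?v - u)\<^sup>2 \<le> 1" by (simp add: abs_square_le_1)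
      moreover have "0 \<le> (2 * ?v - u)\<^sup>2" by simp
      ultimately have "u\<^sup>2 / 2 - 1 \<le> ?v\<^sup>2" unfolding power2_eq_square by (simp add: algebra_simps)
      then show ?thesis by simp
    qed
    also have "\<dots> = exp (1 / 8) * exp (- u\<^sup>2 / 16)" by (rule exp_add)
    also have "\<dots> \<le> 2 * exp (- u\<^sup>2 / 16)"
    proof (rule mult_right_mono)
      show "exp (1 / 8) \<le> (2::real)" using exp_half_le2 by (rule order_trans[rotated]) simp
    qed simp
    finally show ?thesis .
  qed (simp add: f_eq)
  have "(\<lambda>n. (CLINT u|lborel. f n u - h n u)) \<longlonglongrightarrow> (CLINT u|(lborel :: real measure). 0)"
  proof (rule integral_dominated_convergence[where w = "\<lambda>u. 3 * exp (- u\<^sup>2 / 16)"])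
    show "(\<lambda>u. f n u - h n u) \<in> borel_measurable lborel" for n
      unfolding f_def h_def cis_conv_exp by measurable
    show "integrable lborel (\<lambda>u::real. 3 * exp (- u\<^sup>2 / 16))"
      by (intro integrable_mult_right integrable_exp_neg_square) simp
    show "AE u in lborel. norm (f n u - h n u) \<le> 3 * exp (- u\<^sup>2 / 16)" for n
    proof (rule AE_I2)
      fix u :: real
      have "norm (h n u) = exp (- u\<^sup>2 / 2)" by (simp add: h_def norm_mult)
      also have "\<dots> \<le> exp (- u\<^sup>2 / 16)" by simp
      finally show "norm (f n u - h n u) \<le> 3 * exp (- u\<^sup>2 / 16)"
        using dom_f[of n u] norm_triangle_ineq4[of "f n u" "h n u"] by linarith
    qed
    show "AE u in lborel. (\<lambda>n. f n u - h n u) \<longlonglongrightarrow> 0"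
    proof (rule AE_I2)
      fix u :: real
      define v where "v = (\<lambda>n. of_int \<lfloor>u / \<Delta> n\<rfloor> * \<Delta> n)"
      have vlim0: "(\<lambda>n. v n - u) \<longlonglongrightarrow> 0"
        by (rule Lim_null_comparison[OF _ \<Delta>lim]) (use fl in \<open>auto simp: v_def\<close>)
      then have vlim: "v \<longlonglongrightarrow> u" by (simp add: LIM_zero_iff)
      have "\<forall>\<^sub>F n in sequentially. \<lfloor>u / \<Delta> n\<rfloor> \<in> J n"
      proof -
        have "\<forall>\<^sub>F n in sequentially. \<bar>u\<bar> + 1 < sqrt (s n)"
          using filterlim_compose[OF sqrt_at_top slim] by (simp add: filterlim_at_top_dense)
        then show ?thesis
        proof eventually_elim
          case (elim n)
          let ?j = "\<lfloor>u / \<Delta> n\<rfloor>"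
          have "\<bar>of_int ?j * \<Delta> n\<bar> < sqrt (s n)" using fl[of u n] \<Delta>1[of n] elim by linarith
          then have "\<bar>real_of_int ?j\<bar> * \<Delta> n < sqrt (s n)" using \<Delta>0[of n] by (simp add: abs_mult)
          then have "2 * pi * \<bar>real_of_int ?j\<bar> < real (p n)"
            using p0[of n] s0[of n] by (simp add: \<Delta>_def field_simps)
          moreover have "1 * (2 * \<bar>real_of_int ?j\<bar>) \<le> pi * (2 * \<bar>real_of_int ?j\<bar>)"
            using pi_ge_two by (intro mult_right_mono) auto
          ultimately have "real_of_int (2 * \<bar>?j\<bar>) < real (p n)" by simp
          then have "2 * \<bar>?j\<bar> < int (p n)" by linarith
          then show ?case by (auto simp: J_def centred_modes_def)
        qed
      qed
      then have "\<forall>\<^sub>F n in sequentially. G n (v n) - h n u = f n u - h n u"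
        by eventually_elim (simp add: f_eq v_def)
      moreover have "(\<lambda>n. G n (v n) - h n u) \<longlonglongrightarrow> 0"
      proof -
        have "(\<lambda>n. normalized_char (w n) (s n) (v n) - of_real (exp (- u\<^sup>2 / 2))) \<longlonglongrightarrow> 0"
          using normalized_char_tendsto[OF slim s0 vlim, of w] by (simp add: LIM_zero_iff)
        then have 1: "(\<lambda>n. norm (normalized_char (w n) (s n) (v n) - of_real (exp (- u\<^sup>2 / 2))) + M * \<bar>v n - u\<bar>) \<longlonglongrightarrow> 0 + M * 0"
          using vlim0 by (intro tendsto_intros tendsto_norm_zero tendsto_rabs_zero)
        show ?thesis
        proof (rule Lim_null_comparison[rotated])
          show "(\<lambda>n. norm (normalized_char (w n) (s n) (v n) - of_real (exp (- u\<^sup>2 / 2))) + M * \<bar>v n - u\<bar>) \<longlonglongrightarrow> 0"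
            using 1 by simp
          show "\<forall>\<^sub>F n in sequentially. norm (G n (v n) - h n u)
              \<le> norm (normalized_char (w n) (s n) (v n) - of_real (exp (- u\<^sup>2 / 2))) + M * \<bar>v n - u\<bar>"
          proof (rule always_eventually, rule allI)
            fix n
            have "G n (v n) - h n u = (normalized_char (w n) (s n) (v n) - of_real (exp (- u\<^sup>2 / 2))) * cis (- v n * y n)
                + of_real (exp (- u\<^sup>2 / 2)) * (cis (- v n * y n) - cis (- u * y n))"
              by (simp add: G_def h_def algebra_simps)
            then have "norm (G n (v n) - h n u) \<le> norm ((normalized_char (w n) (s n) (v n) - of_real (exp (- u\<^sup>2 / 2))) * cis (- v n * y n))
                + norm (of_real (exp (- u\<^sup>2 / 2)) * (cis (- v n * y n) - cis (- u * y n)))"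
              by (simp only: norm_triangle_ineq)
            also have "norm (of_real (exp (- u\<^sup>2 / 2)) * (cis (- v n * y n) - cis (- u * y n)))
                \<le> 1 * (\<bar>v n - u\<bar> * M)"
            proof -
              have "norm (cis (- v n * y n) - cis (- u * y n)) \<le> \<bar>- v n * y n - (- u * y n)\<bar>"
                by (rule norm_cis_diff_le)
              also have "\<dots> = \<bar>v n - u\<bar> * \<bar>y n\<bar>"
                by (simp add: abs_mult[symmetric] algebra_simps abs_minus_commute)
              also have "\<dots> \<le> \<bar>v n - u\<bar> * M" by (intro mult_left_mono M) auto
              finally show ?thesis
                unfolding norm_mult by (intro mult_mono) auto
            qed
            finally show "norm (G n (v n) - h n u)
              \<le> norm (normalized_char (w n) (s n) (v n) - of_real (exp (- u\<^sup>2 / 2))) + M * \<bar>v n - u\<bar>"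
              by (simp add: norm_mult mult.commute)
          qed
        qed
      qed
      ultimately show "(\<lambda>n. f n u - h n u) \<longlonglongrightarrow> 0"
        by (rule Lim_transform_eventually[rotated])
    qed
  qed auto
  then have lim: "(\<lambda>n. (CLINT u|lborel. f n u - h n u)) \<longlonglongrightarrow> 0" by simp
  have int_h: "integrable lborel (h n)" for n
    unfolding h_def cis_conv_exp
    by (rule Bochner_Integration.integrable_bound[OF integrable_exp_neg_square[of 2]])
      (auto simp: norm_mult)
  have "integrable lborel (f n)" for n
    unfolding f_def by (intro Bochner_Integration.integrable_sum int_step)
  then have "(CLINT u|lborel. f n u - h n u) = (CLINT u|lborel. f n u) - (CLINT u|lborel. h n u)" for n
    using int_h by (rule Bochner_Integration.integral_diff)
  also have "(CLINT u|lborel. f n u) - (CLINT u|lborel. h n u)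
     = of_real (2 * pi * (sqrt (s n) * cyclic_prob (w n) (p n) (s n) (z n mod int (p n)) - exp (- (y n)\<^sup>2 / 2) / sqrt (2 * pi)))" for n
  proof -
    have "sqrt (2 * pi) * exp (- (y n)\<^sup>2 / 2) = 2 * pi * (exp (- (y n)\<^sup>2 / 2) / sqrt (2 * pi))"
      using real_sqrt_mult_self[of "2 * pi"] by (simp add: field_simps)
    then show ?thesis
      unfolding int_f h_def gaussian_fourier of_real_diff[symmetric] by (simp only: right_diff_distrib mult.assoc)
  qed
  finally have "(\<lambda>n. complex_of_real (2 * pi * (sqrt (s n) * cyclic_prob (w n) (p n) (s n) (z n mod int (p n)) - exp (- (y n)\<^sup>2 / 2) / sqrt (2 * pi)))) \<longlonglongrightarrow> of_real 0"
    using lim by simp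
  then have "(\<lambda>n. 2 * pi * (sqrt (s n) * cyclic_prob (w n) (p n) (s n) (z n mod int (p n)) - exp (- (y n)\<^sup>2 / 2) / sqrt (2 * pi))) \<longlonglongrightarrow> 0"
    by (simp only: tendsto_of_real_iff)
  then have "(\<lambda>n. inverse (2 * pi) * (2 * pi * (sqrt (s n) * cyclic_prob (w n) (p n) (s n) (z n mod int (p n)) - exp (- (y n)\<^sup>2 / 2) / sqrt (2 * pi)))) \<longlonglongrightarrow> inverse (2 * pi) * 0"
    by (intro tendsto_intros)
  then show ?thesis by simp
qed

text \<open>
  A sequence of violations with \<open>S = 10 (n + 1)\<close> would contradict \<open>local_limit_sequence\<close>.
\<close>

lemma local_limit_uniform:
  assumes "\<epsilon> > 0"
  obtains S where "S > 0"
    "\<And>w p s z. S \<le> s \<Longrightarrow> S * sqrt s \<le> real p \<Longrightarrow> \<bar>of_int z - drift w s\<bar> \<le> M * sqrt s \<Longrightarrow>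
      sqrt s * cyclic_prob w p s (z mod int p)
        \<le> exp (- ((of_int z - drift w s) / sqrt s)\<^sup>2 / 2) / sqrt (2 * pi) + \<epsilon>"
proof (rule ccontr)
  note found = that
  let ?y = "\<lambda>w s z. (of_int z - drift w s) / sqrt s"
  let ?dens = "\<lambda>w s z. exp (- (?y w s z)\<^sup>2 / 2) / sqrt (2 * pi)"
  define bad where "bad = (\<lambda>S (w, p, s, z :: int). S \<le> s \<and> S * sqrt s \<le> real p \<and>
    \<bar>of_int z - drift w s\<bar> \<le> M * sqrt s \<and>
    \<not> sqrt s * cyclic_prob w p s (z mod int p) \<le> ?dens w s z + \<epsilon>)"
  assume "\<not> thesis"
  have "\<exists>x. bad S x" if S: "S > 0" for S
  proof (rule ccontr)
    assume none: "\<not> (\<exists>x. bad S x)"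
    have thesis
    proof (rule found[OF S])
      fix w p s z
      assume *: "S \<le> s" "S * sqrt s \<le> real p" "\<bar>of_int z - drift w s\<bar> \<le> M * sqrt s"
      have "\<not> bad S (w, p, s, z)" using none by blast
      then show "sqrt s * cyclic_prob w p s (z mod int p) \<le> ?dens w s z + \<epsilon>"
        using * by (simp add: bad_def)
    qed
    then show False using \<open>\<not> thesis\<close> by contradiction
  qed
  then have "\<exists>x. bad (10 * real (Suc n)) x" for n by simp
  then obtain x where x: "\<And>n. bad (10 * real (Suc n)) (x n)" by metis
  define w where "w = (\<lambda>n. fst (x n))"
  define p where "p = (\<lambda>n. fst (snd (x n)))"
  define s where "s = (\<lambda>n. fst (snd (snd (x n))))"
  define z where "z = (\<lambda>n. snd (snd (snd (x n))))"
  have "x n = (w n, p n, s n, z n)" for n by (simp add: w_def p_def s_def z_def)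
  then have b: "10 * real (Suc n) \<le> s n" "10 * real (Suc n) * sqrt (s n) \<le> real (p n)"
      "\<bar>of_int (z n) - drift (w n) (s n)\<bar> \<le> M * sqrt (s n)"
      "?dens (w n) (s n) (z n) + \<epsilon> < sqrt (s n) * cyclic_prob (w n) (p n) (s n) (z n mod int (p n))" for n
    using x[of n] by (auto simp: bad_def not_le)
  have s0: "s n > 0" for n using b(1)[of n] by (rule less_le_trans[rotated]) simp
  have "(\<lambda>n. sqrt (s n) * cyclic_prob (w n) (p n) (s n) (z n mod int (p n)) - ?dens (w n) (s n) (z n)) \<longlonglongrightarrow> 0"
  proof (rule local_limit_sequence)
    show "real (Suc n) \<le> s n" for n using b(1)[of n] by (rule order_trans[rotated]) simp
    show "\<bar>?y (w n) (s n) (z n)\<bar> \<le> M" for n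
      using b(3)[of n] s0[of n] by (simp add: pos_divide_le_eq)
  qed (use b(2) in auto)
  then have "\<forall>\<^sub>F n in sequentially. sqrt (s n) * cyclic_prob (w n) (p n) (s n) (z n mod int (p n)) - ?dens (w n) (s n) (z n) < \<epsilon>"
    using assms by (rule order_tendstoD(2))
  then obtain n where "sqrt (s n) * cyclic_prob (w n) (p n) (s n) (z n mod int (p n)) - ?dens (w n) (s n) (z n) < \<epsilon>"
    by (auto simp: eventually_sequentially)
  then show False using b(4)[of n] by linarith
qed

lemma cyclic_entropy_eq_expectation:
  assumes "p > 0"
  shows "measure_pmf.expectation (int_position w s) (\<lambda>z. - ln (cyclic_prob w p s (z mod int p))) = cyclic_entropy w p s"
  unfolding cyclic_entropy_def
  by (subst expectation_mod(1)[OF assms, where h = "\<lambda>x. - ln (cyclic_prob w p s x)"]) (simp add: sum_negf)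

lemma one_minus_cos_le: "1 - cos x \<le> x\<^sup>2 / 2" for x :: real
proof -
  have "\<bar>sin (x / 2)\<bar>\<^sup>2 \<le> \<bar>x / 2\<bar>\<^sup>2" by (intro power_mono abs_sin_x_le_abs_x) simp
  then show ?thesis by (simp add: one_minus_cos_eq power_divide)
qed

text \<open>
  The real part of a characteristic function is at most its modulus, which does not see the drift.
\<close>

lemma expectation_cos_le:
  assumes "s > 0" "u \<ge> 0"
  shows "measure_pmf.expectation (int_position w s) (\<lambda>z. cos (u * ((of_int z - drift w s) / sqrt s)))
    \<le> exp (- u\<^sup>2 / 2 + u ^ 3 / (6 * sqrt s))"
proof -
  let ?v = "u / sqrt s"
  have int: "integrable (int_position w s) (\<lambda>z. cis (?v * of_int z))"
    by (rule measure_pmf.integrable_const_bound[where B = 1]) auto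
  have eq: "cos (u * ((of_int z - drift w s) / sqrt s)) = Re (cis (?v * of_int z) * cis (- ?v * drift w s))" for z
  proof -
    have "u * ((of_int z - drift w s) / sqrt s) = ?v * of_int z + - ?v * drift w s"
      by (simp add: diff_divide_distrib right_diff_distrib)
    then show ?thesis by (simp only: cis_mult cis.sel)
  qed
  have "measure_pmf.expectation (int_position w s) (\<lambda>z. cos (u * ((of_int z - drift w s) / sqrt s)))
      = Re (measure_pmf.expectation (int_position w s) (\<lambda>z. cis (?v * of_int z) * cis (- ?v * drift w s)))"
    unfolding eq by (intro integral_Re integrable_mult_left int)
  also have "\<dots> = Re (exp (of_real s * (step_char w ?v - 1)) * cis (- ?v * drift w s))"
    by (subst integral_mult_left_zero) (simp only: char_int_position[OF less_imp_le[OF assms(1)]])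
  also have "\<dots> \<le> norm (exp (of_real s * (step_char w ?v - 1)) * cis (- ?v * drift w s))"
    by (rule complex_Re_le_cmod)
  also have "\<dots> = norm (normalized_char w s u)"
    using assms by (simp only: norm_mult norm_char_position norm_cis norm_normalized_char mult_1_right)
  also have "\<dots> = exp (Re (of_real s * (step_char w (u / sqrt s) - 1) - \<i> * of_real (u * drift w s / sqrt s)))"
    unfolding normalized_char_def by (rule norm_exp_eq_Re)
  also have "\<dots> \<le> exp (- u\<^sup>2 / 2 + u ^ 3 / (6 * sqrt s))"
  proof -
    let ?e = "of_real s * (step_char w (u / sqrt s) - 1) - \<i> * of_real (u * drift w s / sqrt s)"
    have "Re (?e + of_real (u\<^sup>2 / 2)) \<le> \<bar>u\<bar> ^ 3 / (6 * sqrt s)"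
      using complex_Re_le_cmod normalized_char_exponent[OF assms(1), of w u] by (rule order_trans)
    moreover have "Re (?e + of_real (u\<^sup>2 / 2)) = Re ?e + u\<^sup>2 / 2" by (simp only: plus_complex.sel Re_complex_of_real)
    moreover have "\<bar>u\<bar> = u" using assms by simp
    ultimately have "Re ?e \<le> - u\<^sup>2 / 2 + u ^ 3 / (6 * sqrt s)" by simp
    then show ?thesis by (simp only: exp_le_cancel_iff)
  qed
  finally show ?thesis .
qed

text \<open>
  The entropy is the mean of \<open>- ln q\<close>, with \<open>q\<close> the probability of the position. Let \<open>y\<close> be the position,
  centred and divided by \<open>sqrt s\<close>. For \<open>\<bar>y\<bar> \<le> M\<close> the local limit theorem bounds \<open>- ln q - ln s / 2\<close> from
  below by \<open>ln (2 \<pi>) / 2 + y\<^sup>2 / 2\<close> up to a small error, and for \<open>\<bar>y\<bar> > M\<close> a constant lower bound is enough,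
  by Chebyshev. It remains to see that truncation loses little of the mean of \<open>y\<^sup>2 / 2\<close>. To this end
  \<open>y\<^sup>2 / 2\<close> is replaced by the smaller, bounded function \<open>(1 - cos (u y)) / u\<^sup>2\<close>, whose mean is known from the
  characteristic function and is close to \<open>1 / 2\<close> for small \<open>u\<close>. All this becomes a single pointwise
  inequality, integrated once.
\<close>

lemma cyclic_entropy_ge_gaussian:
  assumes "\<delta> > 0"
  obtains S where "S > 0"
    "\<And>w p s. S \<le> s \<Longrightarrow> S * sqrt s \<le> real p \<Longrightarrow> ln (2 * pi * exp 1 * s) / 2 - \<delta> \<le> cyclic_entropy w p s"
proof -
  define \<eta> where "\<eta> = \<delta> / 3"
  have \<eta>: "\<eta> > 0" using assms by (simp add: \<eta>_def)
  have "((\<lambda>u::real. (1 - exp (- u\<^sup>2 / 2)) / u\<^sup>2) \<longlongrightarrow> 1 / 2) (at_right 0)" by real_asymp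
  then have "\<forall>\<^sub>F u::real in at_right 0. 1 / 2 - \<eta> < (1 - exp (- u\<^sup>2 / 2)) / u\<^sup>2"
    by (rule order_tendstoD(1)) (use \<eta> in simp)
  then have "\<forall>\<^sub>F u::real in at_right 0. 0 < u \<and> 1 / 2 - \<eta> < (1 - exp (- u\<^sup>2 / 2)) / u\<^sup>2"
    using eventually_at_right_less by eventually_elim simp
  from eventually_happens[OF this]
  obtain u :: real where u: "0 < u" "1 / 2 - \<eta> < (1 - exp (- u\<^sup>2 / 2)) / u\<^sup>2"
    by (auto simp: trivial_limit_at_right_real)
  have "((\<lambda>s. (1 - exp (- u\<^sup>2 / 2 + u ^ 3 / (6 * sqrt s))) / u\<^sup>2) \<longlongrightarrow> (1 - exp (- u\<^sup>2 / 2)) / u\<^sup>2) at_top"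
  proof -
    have "((\<lambda>s. u ^ 3 / (6 * sqrt s)) \<longlongrightarrow> 0) at_top" using u(1) by real_asymp
    from tendsto_add[OF tendsto_const this, of "- u\<^sup>2 / 2"]
    have "((\<lambda>s. - u\<^sup>2 / 2 + u ^ 3 / (6 * sqrt s)) \<longlongrightarrow> - u\<^sup>2 / 2) at_top" by simp
    then show ?thesis using u(1) by (intro tendsto_intros) auto
  qed
  from order_tendstoD(1)[OF this u(2)]
  obtain S1 where S1: "\<And>s. S1 \<le> s \<Longrightarrow> 1 / 2 - \<eta> < (1 - exp (- u\<^sup>2 / 2 + u ^ 3 / (6 * sqrt s))) / u\<^sup>2"
    by (auto simp: eventually_at_top_linorder)
  define K where "K = ln (2 * pi) / 2 + ln 5 + 2 / u\<^sup>2"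
  have "ln (2 * pi) \<ge> 0" using pi_ge_two by (intro ln_ge_zero) linarith
  then have K: "K > 0" using u by (auto simp: K_def intro!: add_nonneg_pos add_nonneg_nonneg)
  \<comment> \<open>The term \<open>K y\<^sup>2 / M\<^sup>2\<close> exceeds \<open>K\<close> for \<open>\<bar>y\<bar> > M\<close>, while its mean is only \<open>K / M\<^sup>2 = \<eta>\<close>.\<close>
  define M where "M = sqrt (K / \<eta>)"
  have M: "M > 0" "K / M\<^sup>2 = \<eta>" using K \<eta> by (simp_all add: M_def)
  \<comment> \<open>At most \<open>\<eta>\<close> times the Gaussian density wherever \<open>\<bar>y\<bar> \<le> M\<close>.\<close>
  define \<epsilon> where "\<epsilon> = \<eta> * (exp (- M\<^sup>2 / 2) / sqrt (2 * pi))"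
  have \<epsilon>: "\<epsilon> > 0" using \<eta> by (simp add: \<epsilon>_def)
  obtain S2 where S2: "S2 > 0" "\<And>w p s z. S2 \<le> s \<Longrightarrow> S2 * sqrt s \<le> real p \<Longrightarrow>
      \<bar>of_int z - drift w s\<bar> \<le> M * sqrt s \<Longrightarrow>
      sqrt s * cyclic_prob w p s (z mod int p)
        \<le> exp (- ((of_int z - drift w s) / sqrt s)\<^sup>2 / 2) / sqrt (2 * pi) + \<epsilon>"
    using local_limit_uniform[OF \<epsilon>, of M] by metis
  define S where "S = max 1 (max S1 S2)"
  show thesis
  proof (rule that[of S])
    show "S > 0" by (simp add: S_def)
    fix w p s
    assume "S \<le> s" and Sp: "S * sqrt s \<le> real p"
    then have s: "s \<ge> 1" "S1 \<le> s" "S2 \<le> s" by (auto simp: S_def)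
    have r: "sqrt s > 0" using s by simp
    have "S2 * sqrt s \<le> S * sqrt s" "1 * sqrt s \<le> S * sqrt s"
      using r by (intro mult_right_mono; simp add: S_def)+
    then have sp: "S2 * sqrt s \<le> real p" "sqrt s \<le> real p" using Sp by linarith+
    have p: "p > 0" using sp(2) r by (cases "p = 0") auto
    define y where "y = (\<lambda>z::int. (of_int z - drift w s) / sqrt s)"
    let ?q = "\<lambda>z. cyclic_prob w p s (z mod int p)"
    let ?low = "\<lambda>z. ln (2 * pi) / 2 - \<eta> + 1 / u\<^sup>2 - cos (u * y z) / u\<^sup>2 - K / M\<^sup>2 * ((of_int z - drift w s)\<^sup>2 / s)"
    have y2: "(y z)\<^sup>2 = (of_int z - drift w s)\<^sup>2 / s" for z using s by (simp add: y_def power_divide)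
    have pointwise: "?low z \<le> - ln (?q z) - ln s / 2" if q: "?q z > 0" for z
    proof -
      have ln_m: "ln (sqrt s * ?q z) = ln s / 2 + ln (?q z)" using q r s by (simp add: ln_mult ln_sqrt)
      show ?thesis
      proof (cases "\<bar>y z\<bar> \<le> M")
        case True
        let ?g = "exp (- (y z)\<^sup>2 / 2) / sqrt (2 * pi)"
        have g: "?g > 0" by simp
        have "\<bar>y z\<bar>\<^sup>2 \<le> M\<^sup>2" using True by (intro power_mono) auto
        then have "exp (- M\<^sup>2 / 2) / sqrt (2 * pi) \<le> ?g" by (intro divide_right_mono) auto
        then have "\<epsilon> \<le> \<eta> * ?g" unfolding \<epsilon>_def using \<eta> by (intro mult_left_mono) auto
        moreover have "\<bar>of_int z - drift w s\<bar> \<le> M * sqrt s"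
          using True r by (simp add: y_def pos_divide_le_eq)
        then have "sqrt s * ?q z \<le> ?g + \<epsilon>" using S2(2)[OF s(3) sp(1)] by (simp add: y_def)
        ultimately have "sqrt s * ?q z \<le> ?g + \<eta> * ?g" by linarith
        then have "sqrt s * ?q z \<le> ?g * (1 + \<eta>)" by (simp only: distrib_left mult_1_right mult.commute[of ?g \<eta>])
        then have "ln (sqrt s * ?q z) \<le> ln (?g * (1 + \<eta>))" using q r by (intro ln_mono) auto
        also have "\<dots> = - (y z)\<^sup>2 / 2 - ln (2 * pi) / 2 + ln (1 + \<eta>)"
          using g \<eta> by (simp add: ln_mult ln_div ln_sqrt)
        also have "\<dots> \<le> - (y z)\<^sup>2 / 2 - ln (2 * pi) / 2 + \<eta>"
          using ln_add_one_self_le_self[of \<eta>] \<eta> by simp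
        finally have 1: "ln (2 * pi) / 2 + (y z)\<^sup>2 / 2 - \<eta> \<le> - ln (?q z) - ln s / 2"
          unfolding ln_m by linarith
        have "(1 - cos (u * y z)) / u\<^sup>2 \<le> ((u * y z)\<^sup>2 / 2) / u\<^sup>2"
          by (intro divide_right_mono one_minus_cos_le) simp
        also have "\<dots> = (y z)\<^sup>2 / 2" using u by (simp add: power_mult_distrib)
        finally have 2: "1 / u\<^sup>2 - cos (u * y z) / u\<^sup>2 \<le> (y z)\<^sup>2 / 2" by (simp add: diff_divide_distrib)
        have "0 \<le> K / M\<^sup>2 * (y z)\<^sup>2" using K by simp
        then show ?thesis using 1 2 unfolding y2 by linarith
      next
        case False
        have "?q z \<le> 1 / real p + 4 / sqrt s" using p s by (intro cyclic_prob_le) auto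
        then have "sqrt s * ?q z \<le> sqrt s * (1 / real p + 4 / sqrt s)" using r by (intro mult_left_mono) auto
        also have "\<dots> = sqrt s / real p + 4" using r by (simp add: distrib_left)
        also have "\<dots> \<le> 5" using sp(2) p by simp
        finally have "ln (sqrt s * ?q z) \<le> ln 5" using q r by (intro ln_mono) auto
        then have 1: "- ln 5 \<le> - ln (?q z) - ln s / 2" unfolding ln_m by linarith
        have "M\<^sup>2 \<le> \<bar>y z\<bar>\<^sup>2" using False M by (intro power_mono) auto
        then have "1 \<le> (y z)\<^sup>2 / M\<^sup>2" using M by simp
        then have "K * 1 \<le> K * ((y z)\<^sup>2 / M\<^sup>2)" using K by (intro mult_left_mono) auto
        then have 2: "K \<le> K / M\<^sup>2 * (y z)\<^sup>2" by simp
        have "- cos (u * y z) / u\<^sup>2 \<le> 1 / u\<^sup>2"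
          using cos_ge_minus_one[of "u * y z"] by (intro divide_right_mono) auto
        then have "1 / u\<^sup>2 - cos (u * y z) / u\<^sup>2 \<le> 2 / u\<^sup>2" by simp
        then show ?thesis using 1 2 \<eta> unfolding y2 K_def by linarith
      qed
    qed
    have int_cos: "integrable (int_position w s) (\<lambda>z. cos (u * y z))"
      by (rule measure_pmf.integrable_const_bound[where B = 1]) auto
    note mom = second_moment[of s w]
    have "measure_pmf.expectation (int_position w s) ?low
        \<le> measure_pmf.expectation (int_position w s) (\<lambda>z. - ln (?q z) - ln s / 2)"
    proof (rule integral_mono_AE)
      show "integrable (int_position w s) ?low" using int_cos mom(1) s by auto
      show "integrable (int_position w s) (\<lambda>z. - ln (?q z) - ln s / 2)"
        by (rule expectation_mod(2)[OF p, where h = "\<lambda>x. - ln (cyclic_prob w p s x) - ln s / 2"])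
      show "AE z in int_position w s. ?low z \<le> - ln (?q z) - ln s / 2"
      proof (unfold AE_measure_pmf_iff, rule ballI, rule pointwise)
        fix z assume "z \<in> set_pmf (int_position w s)"
        then have "z mod int p \<in> set_pmf (cyclic_position w p s)" by (auto simp: cyclic_position_def)
        then show "?q z > 0" by (rule pmf_positive)
      qed
    qed
    also have "\<dots> = cyclic_entropy w p s - ln s / 2"
      using expectation_mod(2)[OF p, where h = "\<lambda>x. - ln (cyclic_prob w p s x)"]
        cyclic_entropy_eq_expectation[OF p, of w s]
      by (subst Bochner_Integration.integral_diff) auto
    also have "measure_pmf.expectation (int_position w s) ?low = ln (2 * pi) / 2 - \<eta> + 1 / u\<^sup>2
        - measure_pmf.expectation (int_position w s) (\<lambda>z. cos (u * y z)) / u\<^sup>2 - K / M\<^sup>2 * (s / s)"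
      using int_cos mom s by simp
    also have "\<dots> = ln (2 * pi) / 2 - 2 * \<eta> + (1 - measure_pmf.expectation (int_position w s) (\<lambda>z. cos (u * y z))) / u\<^sup>2"
      using s M by (simp add: diff_divide_distrib)
    finally have 1: "ln (2 * pi) / 2 - 2 * \<eta>
        + (1 - measure_pmf.expectation (int_position w s) (\<lambda>z. cos (u * y z))) / u\<^sup>2
        \<le> cyclic_entropy w p s - ln s / 2" .
    have "measure_pmf.expectation (int_position w s) (\<lambda>z. cos (u * y z)) \<le> exp (- u\<^sup>2 / 2 + u ^ 3 / (6 * sqrt s))"
      unfolding y_def using s u by (intro expectation_cos_le) auto
    then have "(1 - exp (- u\<^sup>2 / 2 + u ^ 3 / (6 * sqrt s))) / u\<^sup>2
        \<le> (1 - measure_pmf.expectation (int_position w s) (\<lambda>z. cos (u * y z))) / u\<^sup>2"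
      by (intro divide_right_mono) auto
    then have 2: "1 / 2 - \<eta> \<le> (1 - measure_pmf.expectation (int_position w s) (\<lambda>z. cos (u * y z))) / u\<^sup>2"
      using S1[OF s(2)] by linarith
    have arith: "(a + 1 + l) / 2 - \<delta> \<le> c" if "a / 2 - 2 * \<eta> + x \<le> c - l / 2" "1 / 2 - \<eta> \<le> x"
      for a c l x :: real using that by (simp add: \<eta>_def field_simps)
    have "ln (2 * pi * exp 1 * s) = ln (2 * pi) + 1 + ln s"
      using s by (simp add: ln_mult)
    then show "ln (2 * pi * exp 1 * s) / 2 - \<delta> \<le> cyclic_entropy w p s"
      by (simp only: arith[OF 1 2])
  qed
qed

section \<open>Asymptotics of the entropic time\<close>

text \<open>
  Since \<open>\<zeta>\<close> is the entropy deficit, the quantity \<open>p\<^sup>2 exp (- 2 \<zeta>)\<close> is \<open>exp (2 h)\<close>, the scale on which entropy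
  estimates the time.
\<close>

lemma exp_twice_entropy:
  assumes "p > 0" "\<zeta> = ln (real p) - h"
  shows "real p ^ 2 * exp (- 2 * \<zeta>) = exp (2 * h)"
proof -
  have "exp (2 * h) = exp (ln (real p) + ln (real p) + (- 2 * \<zeta>))" using assms by simp
  also have "\<dots> = real p * real p * exp (- 2 * \<zeta>)"
    using assms by (simp only: exp_add exp_ln of_nat_0_less_iff)
  finally show ?thesis by (simp add: power2_eq_square)
qed

text \<open>
  By the two-sided bound on the deficit, \<open>2 s (1 - cos (2 \<pi> / p))\<close> differs from \<open>ln (1 / \<zeta>)\<close> by at most
  \<open>ln 4\<close>, which is negligible as \<open>ln (1 / \<zeta>) \<rightarrow> \<infinity>\<close>.
\<close>

lemma small_deficit_asymp:
  assumes p: "\<And>n. p n \<ge> 2" and s: "\<And>n. s n \<ge> 0"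
    and \<zeta>: "\<And>n. \<zeta> n = ln (real (p n)) - cyclic_entropy w (p n) (s n)" "\<And>n. \<zeta> n > 0"
    and lim: "\<zeta> \<longlonglongrightarrow> 0"
  shows "s \<sim>[sequentially] (\<lambda>n. 1 / 2 * ln (1 / \<zeta> n) / (1 - cos (2 * pi / real (p n))))"
proof (rule asymp_equivI')
  define L where "L = (\<lambda>n. ln (1 / \<zeta> n))"
  define g where "g = (\<lambda>n. 1 - cos (2 * pi / real (p n)))"
  have g: "g n = gap (p n) 1" "g n > 0" for n
    using cos_angle_less_1[of "p n" 1] p[of n] by (simp_all add: g_def gap_def angle_def)
  have Llim: "filterlim L at_top sequentially"
  proof -
    have "filterlim (\<lambda>n. inverse (\<zeta> n)) at_top sequentially"
      using lim \<zeta>(2) by (intro filterlim_inverse_at_top) auto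
    then show ?thesis
      unfolding L_def by (auto simp: inverse_eq_divide intro: filterlim_compose[OF ln_at_top])
  qed
  have "\<forall>\<^sub>F n in sequentially. L n > 0"
    using Llim by (simp add: filterlim_at_top_dense)
  moreover have "\<forall>\<^sub>F n in sequentially. \<zeta> n < 1 / 8"
    using lim by (rule order_tendstoD) simp
  ultimately have bound: "\<forall>\<^sub>F n in sequentially. \<bar>s n / (1 / 2 * L n / g n) - 1\<bar> \<le> ln 4 / L n"
  proof eventually_elim
    case (elim n)
    let ?x = "exp (- 2 * s n * gap (p n) 1)"
    have b: "?x / 4 \<le> \<zeta> n" "\<zeta> n \<le> 4 * ?x"
      using entropy_deficit_bounds[OF p s \<zeta>(1)] elim by auto
    have "ln (?x / 4) \<le> ln (\<zeta> n)" "ln (\<zeta> n) \<le> ln (4 * ?x)"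
      using b \<zeta>(2)[of n] by (intro ln_mono; simp)+
    then have "\<bar>2 * s n * g n - L n\<bar> \<le> ln 4"
      using \<zeta>(2)[of n] by (simp add: L_def ln_div ln_mult g)
    then have "\<bar>2 * s n * g n - L n\<bar> / L n \<le> ln 4 / L n"
      using elim by (intro divide_right_mono) auto
    moreover have "s n / (1 / 2 * L n / g n) - 1 = (2 * s n * g n - L n) / L n"
      using elim g[of n] by (simp add: field_simps)
    ultimately show ?case using elim by (simp add: abs_divide)
  qed
  have "(\<lambda>n. ln 4 / L n) \<longlonglongrightarrow> 0"
    by (intro tendsto_divide_0[OF tendsto_const] filterlim_at_top_imp_at_infinity Llim)
  then have "(\<lambda>n. s n / (1 / 2 * L n / g n) - 1) \<longlonglongrightarrow> 0"
    by (rule Lim_null_comparison[rotated]) (use bound in simp)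
  then show "(\<lambda>n. s n / (1 / 2 * ln (1 / \<zeta> n) / (1 - cos (2 * pi / real (p n))))) \<longlonglongrightarrow> 1"
    by (simp add: LIM_zero_iff L_def g_def)
qed

lemma exp_twice_entropy_le:
  assumes "p > 0" "s > 0"
  shows "exp (2 * cyclic_entropy w p s) \<le> 2 * pi * exp 1 * s * exp (1 / (4 * s))"
proof -
  have "2 * cyclic_entropy w p s \<le> ln (2 * pi * exp 1 * s) + 1 / (4 * s)"
    using cyclic_entropy_le_gaussian[OF assms, of w] assms by (simp add: field_simps)
  then have "exp (2 * cyclic_entropy w p s) \<le> exp (ln (2 * pi * exp 1 * s) + 1 / (4 * s))"
    by (simp only: exp_le_cancel_iff)
  also have "\<dots> = 2 * pi * exp 1 * s * exp (1 / (4 * s))"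
    using assms by (simp add: exp_add)
  finally show ?thesis .
qed

text \<open>
  The upper bound on \<open>s\<close> comes from the collision probability. The lower bound comes from the Gaussian
  upper bound on the entropy, whose error term \<open>1 / (8 s)\<close> is harmless because an entropy of at least
  \<open>b\<close> keeps \<open>s\<close> away from \<open>0\<close>.
\<close>

lemma large_deficit_order:
  assumes p: "\<And>n. p n \<ge> 2" and s: "\<And>n. s n > 0"
    and \<zeta>: "\<And>n. \<zeta> n = ln (real (p n)) - cyclic_entropy w (p n) (s n)"
    and c: "c > 0" "\<forall>\<^sub>F n in sequentially. c \<le> \<zeta> n"
    and b: "b > 0" "\<forall>\<^sub>F n in sequentially. b \<le> cyclic_entropy w (p n) (s n)"
  shows "s \<in> \<Theta>(\<lambda>n. real (p n) ^ 2 * exp (- 2 * \<zeta> n))"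
proof
  have p0: "p n > 0" for n using p[of n] by simp
  define q where "q = 1 - exp (- c)"
  have q: "q > 0" using c by (simp add: q_def)
  show "s \<in> O(\<lambda>n. real (p n) ^ 2 * exp (- 2 * \<zeta> n))"
  proof (rule bigoI)
    show "\<forall>\<^sub>F n in sequentially. norm (s n) \<le> (4 / q\<^sup>2) * norm (real (p n) ^ 2 * exp (- 2 * \<zeta> n))"
      using c(2)
    proof eventually_elim
      case (elim n)
      have "exp (\<zeta> n) * q \<le> exp (\<zeta> n) - 1"
      proof -
        have "exp (0::real) \<le> exp (\<zeta> n - c)" using elim by (subst exp_le_cancel_iff) simp
        then show ?thesis by (simp add: q_def right_diff_distrib exp_diff exp_minus divide_inverse)
      qed
      then have "sqrt (s n) * (exp (\<zeta> n) * q) \<le> sqrt (s n) * (exp (\<zeta> n) - 1)"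
        by (intro mult_left_mono) (use s[of n] in auto)
      also have "\<dots> \<le> 2 * real (p n)" using sqrt_time_le[OF p0 s, of n n w] by (simp add: \<zeta>)
      finally have "(sqrt (s n) * (exp (\<zeta> n) * q))\<^sup>2 \<le> (2 * real (p n))\<^sup>2"
        using s[of n] q by (intro power_mono) auto
      then have "s n * (exp (\<zeta> n))\<^sup>2 * q\<^sup>2 \<le> 4 * real (p n) ^ 2"
        using s[of n] by (simp add: power_mult_distrib)
      then have "s n \<le> 4 / q\<^sup>2 * (real (p n) ^ 2 * inverse ((exp (\<zeta> n))\<^sup>2))"
        using q by (simp add: field_simps)
      also have "inverse ((exp (\<zeta> n))\<^sup>2) = exp (- 2 * \<zeta> n)"
        by (simp add: exp_minus exp_double)
      finally show ?case using s[of n] by simp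
    qed
  qed
  obtain \<delta> where \<delta>: "\<delta> > 0"
    "\<And>w p s. p > 0 \<Longrightarrow> 0 \<le> s \<Longrightarrow> s < \<delta> \<Longrightarrow> cyclic_entropy w p s < b"
    using cyclic_entropy_small_time[OF b(1)] by metis
  show "s \<in> \<Omega>(\<lambda>n. real (p n) ^ 2 * exp (- 2 * \<zeta> n))"
    unfolding bigomega_iff_bigo
  proof (rule bigoI)
    show "\<forall>\<^sub>F n in sequentially. norm (real (p n) ^ 2 * exp (- 2 * \<zeta> n))
        \<le> (2 * pi * exp 1 * exp (1 / (4 * \<delta>))) * norm (s n)"
      using b(2)
    proof eventually_elim
      case (elim n)
      have "\<delta> \<le> s n"
        using \<delta>(2)[OF p0[of n], of "s n" w] elim s[of n] by linarith
      then have "exp (1 / (4 * s n)) \<le> exp (1 / (4 * \<delta>))"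
        using \<delta>(1) s[of n] by (simp add: frac_le)
      then have "2 * pi * exp 1 * s n * exp (1 / (4 * s n)) \<le> 2 * pi * exp 1 * s n * exp (1 / (4 * \<delta>))"
        using s[of n] by (intro mult_left_mono) auto
      then have "exp (2 * cyclic_entropy w (p n) (s n)) \<le> 2 * pi * exp 1 * s n * exp (1 / (4 * \<delta>))"
        by (rule order_trans[OF exp_twice_entropy_le[OF p0 s]])
      then show ?case
        unfolding exp_twice_entropy[OF p0 \<zeta>] using s[of n] by (simp add: mult_ac)
    qed
  qed
qed

text \<open>
  Large entropy forces \<open>s \<rightarrow> \<infinity>\<close> and a large deficit forces \<open>sqrt s / p \<rightarrow> 0\<close>. In this regime the Gaussian
  upper and lower bounds on the entropy meet.
\<close>

lemma diverging_deficit_asymp: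
  assumes p: "\<And>n. p n \<ge> 2" and s: "\<And>n. s n > 0"
    and \<zeta>: "\<And>n. \<zeta> n = ln (real (p n)) - cyclic_entropy w (p n) (s n)"
    and lim\<zeta>: "filterlim \<zeta> at_top sequentially"
    and limH: "filterlim (\<lambda>n. cyclic_entropy w (p n) (s n)) at_top sequentially"
  shows "s \<sim>[sequentially] (\<lambda>n. real (p n) ^ 2 * exp (- 2 * \<zeta> n) / (2 * pi * exp 1))"
proof -
  have p0: "p n > 0" for n using p[of n] by simp
  let ?H = "\<lambda>n. cyclic_entropy w (p n) (s n)"
  have evH: "\<forall>\<^sub>F n in sequentially. h \<le> ?H n" for h
    using limH by (simp add: filterlim_at_top)
  have slim: "\<forall>\<^sub>F n in sequentially. A \<le> s n" for A
  proof -
    obtain \<delta> where \<delta>: "\<delta> > 0"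
      "\<And>w p s. p > 0 \<Longrightarrow> 0 \<le> s \<Longrightarrow> s < \<delta> \<Longrightarrow> cyclic_entropy w p s < 1"
      using cyclic_entropy_small_time[of 1] by (metis zero_less_one)
    define K where "K = 2 * pi * exp 1 * exp (1 / (4 * \<delta>))"
    have K: "K > 0" by (simp add: K_def)
    define B where "B = max 1 (ln (K * max A 1) / 2)"
    show ?thesis
      using evH[of B]
    proof eventually_elim
      case (elim n)
      then have H: "1 \<le> ?H n" "ln (K * max A 1) \<le> 2 * ?H n" by (simp_all add: B_def)
      have "\<delta> \<le> s n" using \<delta>(2)[OF p0[of n], of "s n" w] H s[of n] by linarith
      then have "exp (1 / (4 * s n)) \<le> exp (1 / (4 * \<delta>))"
        using \<delta>(1) s[of n] by (simp add: frac_le)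
      then have "2 * pi * exp 1 * s n * exp (1 / (4 * s n)) \<le> 2 * pi * exp 1 * s n * exp (1 / (4 * \<delta>))"
        using s[of n] by (intro mult_left_mono) auto
      then have "exp (2 * ?H n) \<le> 2 * pi * exp 1 * s n * exp (1 / (4 * \<delta>))"
        by (rule order_trans[OF exp_twice_entropy_le[OF p0 s]])
      also have "\<dots> = K * s n" by (simp add: K_def)
      finally have "exp (2 * ?H n) \<le> K * s n" .
      moreover have "exp (ln (K * max A 1)) \<le> exp (2 * ?H n)" using H(2) by (simp only: exp_le_cancel_iff)
      then have "K * max A 1 \<le> exp (2 * ?H n)" using K by simp
      ultimately have "K * max A 1 \<le> K * s n" by linarith
      then show "A \<le> s n" using K by (simp add: max_def split: if_splits)
    qed
  qed
  have splim: "\<forall>\<^sub>F n in sequentially. S * sqrt (s n) \<le> real (p n)" if "S > 0" for S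
  proof -
    have "\<forall>\<^sub>F n in sequentially. ln (1 + 2 * S) \<le> \<zeta> n"
      using lim\<zeta> by (simp add: filterlim_at_top)
    then show ?thesis
    proof eventually_elim
      case (elim n)
      then have "exp (ln (1 + 2 * S)) \<le> exp (\<zeta> n)" by (simp only: exp_le_cancel_iff)
      then have "2 * S \<le> exp (\<zeta> n) - 1" using that by simp
      then have "sqrt (s n) * (2 * S) \<le> sqrt (s n) * (exp (\<zeta> n) - 1)"
        using s[of n] by (intro mult_left_mono) auto
      also have "\<dots> \<le> 2 * real (p n)" using sqrt_time_le[OF p0 s, of n n w] by (simp add: \<zeta>)
      finally show ?case by (simp add: mult_ac)
    qed
  qed
  have "(\<lambda>n. ln (2 * pi * exp 1 * s n) - 2 * ?H n) \<longlonglongrightarrow> 0"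
  proof (rule tendstoI)
    fix e :: real assume e: "e > 0"
    obtain S where S: "S > 0"
      "\<And>w p s. S \<le> s \<Longrightarrow> S * sqrt s \<le> real p \<Longrightarrow> ln (2 * pi * exp 1 * s) / 2 - e / 4 \<le> cyclic_entropy w p s"
      using cyclic_entropy_ge_gaussian[of "e / 4"] e by (metis divide_pos_pos zero_less_numeral)
    show "\<forall>\<^sub>F n in sequentially. dist (ln (2 * pi * exp 1 * s n) - 2 * ?H n) 0 < e"
      using slim[of "max S (1 / e)"] splim[OF S(1)]
    proof eventually_elim
      case (elim n)
      have "ln (2 * pi * exp 1 * s n) / 2 - e / 4 \<le> ?H n" using S(2) elim by simp
      moreover have "?H n \<le> ln (2 * pi * exp 1 * s n) / 2 + 1 / (8 * s n)"
        by (rule cyclic_entropy_le_gaussian[OF p0 s])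
      moreover have "1 / (8 * s n) \<le> e / 8" using elim e s[of n] by (simp add: field_simps)
      ultimately show ?case using e by (simp add: dist_real_def abs_less_iff)
    qed
  qed
  then have "(\<lambda>n. exp (ln (2 * pi * exp 1 * s n) - 2 * ?H n)) \<longlonglongrightarrow> exp 0"
    by (rule tendsto_exp)
  moreover have "exp (ln (2 * pi * exp 1 * s n) - 2 * ?H n)
      = s n / (real (p n) ^ 2 * exp (- 2 * \<zeta> n) / (2 * pi * exp 1))" for n
    unfolding exp_twice_entropy[OF p0 \<zeta>] using s[of n] by (simp add: exp_diff)
  ultimately show ?thesis
    by (intro asymp_equivI') simp
qed

lemma smallo_1_imp_filterlim_at_top:
  fixes f :: "nat \<Rightarrow> real"
  assumes "(\<lambda>n. 1) \<in> o(f)" "\<And>n. f n > 0"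
  shows "filterlim f at_top sequentially"
  unfolding filterlim_at_top
proof
  fix Z :: real
  have "1 / max Z 1 > 0" by simp
  from landau_o.smallD[OF assms(1) this]
  show "\<forall>\<^sub>F n in sequentially. Z \<le> f n"
  proof eventually_elim
    case (elim n)
    then have "max Z 1 \<le> f n" using assms(2)[of n] by (simp add: field_simps)
    then show ?case by simp
  qed
qed

theorem propositionB:
  fixes w :: walk and d p k :: "nat \<Rightarrow> nat" and t\<^sub>0 s\<^sub>0 \<zeta> :: "nat \<Rightarrow> real"
  assumes "\<And>n. d n \<ge> 1" and "\<And>n. p n \<ge> 2" and "\<And>n. k n > d n"
    and "(\<lambda>n. 1) \<in> o(\<lambda>n. real (k n))"
    and "(\<lambda>n. real (k n)) \<in> O(\<lambda>n. real (d n) * ln (real (p n)))"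
    and "\<And>n. \<zeta> n = 1 / real (k n) * (real (k n) - real (d n)) * ln (real (p n))"
    and "\<And>n. t\<^sub>0 n = entropic_time w (d n) (p n) (k n)"
    and "\<And>n. s\<^sub>0 n = t\<^sub>0 n / real (k n)"
  shows
    "(\<zeta> \<in> o(\<lambda>n. 1) \<longrightarrow>
       s\<^sub>0 \<sim>[sequentially] (\<lambda>n. 1 / 2 * ln (1 / \<zeta> n) / (1 - cos (2 * pi / real (p n))))) \<and>
     ((\<lambda>n. 1) \<in> O(\<zeta>) \<longrightarrow>
       s\<^sub>0 \<in> \<Theta>(\<lambda>n. real (p n) ^ 2 * exp (- 2 * \<zeta> n))) \<and>
     ((\<lambda>n. real (k n)) \<in> o(\<lambda>n. real (d n) * ln (real (p n))) \<and> (\<lambda>n. 1) \<in> o(\<zeta>) \<longrightarrow>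
       s\<^sub>0 \<sim>[sequentially] (\<lambda>n. real (p n) ^ 2 * exp (- 2 * \<zeta> n) / (2 * pi * exp 1))) \<and>
     (\<forall>n. real (p n) ^ 2 * exp (- 2 * \<zeta> n) = (real (p n) ^ d n) powr (2 / real (k n))) \<and>
     (filterlim p at_top sequentially \<longrightarrow>
       (\<lambda>n. 1 - cos (2 * pi / real (p n))) \<sim>[sequentially] (\<lambda>n. 2 * pi ^ 2 / real (p n) ^ 2)) \<and>
     (\<forall>n. 2 * pi ^ 2 / real (p n) ^ 2 =
       2 * pi ^ 2 * real (p n) powr (- 2 * real (d n) / real (k n)) * exp (- 2 * \<zeta> n))"
proof -
  have p0: "p n > 0" for n using assms(2)[of n] by simp
  have k0: "k n > 0" for n using assms(3)[of n] by simp
  have lnp: "ln (real (p n)) > 0" for n using assms(2)[of n] by simp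
  define h where "h = (\<lambda>n. real (d n) / real (k n) * ln (real (p n)))"
  have h0: "h n > 0" for n using assms(1)[of n] k0[of n] lnp[of n] by (simp add: h_def)
  have H: "cyclic_entropy w (p n) (s\<^sub>0 n) = h n" for n
    using entropic_time_characterization(2)[OF assms(2,3)] by (simp add: assms(7,8) h_def)
  have s_nonneg: "s\<^sub>0 n \<ge> 0" for n
    using entropic_time_characterization(1)[OF assms(2,3), of w n n] k0[of n] by (simp add: assms(7,8))
  have s_pos: "s\<^sub>0 n > 0" for n
  proof -
    have "s\<^sub>0 n \<noteq> 0" using H[of n] h0[of n] cyclic_entropy_0[OF p0[of n], of w] by auto
    then show ?thesis using s_nonneg[of n] by simp
  qed
  have \<zeta>h: "\<zeta> n = ln (real (p n)) - h n" for n
    using k0[of n] by (simp add: assms(6) h_def field_simps)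
  have \<zeta>eq: "\<zeta> n = ln (real (p n)) - cyclic_entropy w (p n) (s\<^sub>0 n)" for n
    by (simp add: H \<zeta>h)
  have \<zeta>0: "\<zeta> n > 0" for n
    using assms(3)[of n] k0[of n] lnp[of n] by (simp add: assms(6))
  have p2: "real (p n) ^ 2 = exp (2 * ln (real (p n)))" for n
    using p0[of n] by (simp add: exp_double)
  show ?thesis
  proof (intro conjI impI allI)
    assume "\<zeta> \<in> o(\<lambda>n. 1)"
    then have "\<zeta> \<longlonglongrightarrow> 0" by (auto dest: smalloD_tendsto)
    then show "s\<^sub>0 \<sim>[sequentially] (\<lambda>n. 1 / 2 * ln (1 / \<zeta> n) / (1 - cos (2 * pi / real (p n))))"
      by (rule small_deficit_asymp[OF assms(2) s_nonneg \<zeta>eq \<zeta>0])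
  next
    assume "(\<lambda>n. 1) \<in> O(\<zeta>)"
    then obtain c where c: "c > 0" "\<forall>\<^sub>F n in sequentially. norm (1::real) \<le> c * norm (\<zeta> n)"
      by (rule landau_o.bigE)
    obtain b where b: "b > 0" "\<forall>\<^sub>F n in sequentially. norm (real (k n)) \<le> b * norm (real (d n) * ln (real (p n)))"
      using assms(5) by (rule landau_o.bigE)
    have "\<forall>\<^sub>F n in sequentially. 1 / c \<le> \<zeta> n"
      using c(2)
    proof eventually_elim
      case (elim n)
      then show ?case using c(1) \<zeta>0[of n] by (simp add: field_simps)
    qed
    \<comment> \<open>The growth condition on \<open>k\<close> says precisely that the entropy per coordinate is bounded below.\<close>
    moreover have "\<forall>\<^sub>F n in sequentially. 1 / b \<le> cyclic_entropy w (p n) (s\<^sub>0 n)"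
      using b(2)
    proof eventually_elim
      case (elim n)
      then have "real (k n) \<le> b * (real (d n) * ln (real (p n)))" using lnp[of n] by (simp add: abs_mult)
      then show ?case unfolding H h_def using b(1) k0[of n] by (simp add: field_simps)
    qed
    ultimately show "s\<^sub>0 \<in> \<Theta>(\<lambda>n. real (p n) ^ 2 * exp (- 2 * \<zeta> n))"
      using b(1) c(1)
      by (intro large_deficit_order[OF assms(2) s_pos \<zeta>eq, where c = "1 / c" and b = "1 / b"]) auto
  next
    assume *: "(\<lambda>n. real (k n)) \<in> o(\<lambda>n. real (d n) * ln (real (p n))) \<and> (\<lambda>n. 1) \<in> o(\<zeta>)"
    have "(\<lambda>n. real (k n) / real (k n)) \<in> o(\<lambda>n. real (d n) * ln (real (p n)) / real (k n))"
      using * k0 by (intro landau_o.small.divide_right) auto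
    moreover have "k n \<noteq> 0" for n using k0[of n] by simp
    ultimately have "(\<lambda>n. 1) \<in> o(h)" by (simp add: h_def)
    then have "filterlim (\<lambda>n. cyclic_entropy w (p n) (s\<^sub>0 n)) at_top sequentially"
      unfolding H using h0 by (rule smallo_1_imp_filterlim_at_top)
    moreover have "filterlim \<zeta> at_top sequentially"
      using * \<zeta>0 by (intro smallo_1_imp_filterlim_at_top) auto
    ultimately show "s\<^sub>0 \<sim>[sequentially] (\<lambda>n. real (p n) ^ 2 * exp (- 2 * \<zeta> n) / (2 * pi * exp 1))"
      by (intro diverging_deficit_asymp[OF assms(2) s_pos \<zeta>eq])
  next
    fix n
    have "real (p n) ^ 2 * exp (- 2 * \<zeta> n) = exp (2 * h n)"
      by (rule exp_twice_entropy[OF p0 \<zeta>h])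
    also have "\<dots> = (real (p n) ^ d n) powr (2 / real (k n))"
      using p0[of n] by (simp add: powr_def ln_realpow h_def)
    finally show "real (p n) ^ 2 * exp (- 2 * \<zeta> n) = (real (p n) ^ d n) powr (2 / real (k n))" .
  next
    assume lim: "filterlim p at_top sequentially"
    have "filterlim (\<lambda>x::real. 2 * pi / x) (at_right 0) at_top" by real_asymp
    from filterlim_compose[OF this filterlim_compose[OF filterlim_real_sequentially lim]]
    have angle_lim: "filterlim (\<lambda>n. 2 * pi / real (p n)) (at_right 0) sequentially" .
    have "(\<lambda>y::real. 1 - cos y) \<sim>[at_right 0] (\<lambda>y. y ^ 2 / 2)" by real_asymp
    from asymp_equiv_compose'[OF this angle_lim]
    show "(\<lambda>n. 1 - cos (2 * pi / real (p n))) \<sim>[sequentially] (\<lambda>n. 2 * pi ^ 2 / real (p n) ^ 2)"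
      by (simp add: power_divide power_mult_distrib)
  next
    fix n
    have "real (p n) powr (- 2 * real (d n) / real (k n)) * exp (- 2 * \<zeta> n)
        = exp (- 2 * h n + - 2 * \<zeta> n)"
      using p0[of n] by (simp only: exp_add) (simp add: powr_def h_def mult.assoc)
    also have "- 2 * h n + - 2 * \<zeta> n = - (2 * ln (real (p n)))" by (simp add: \<zeta>h)
    also have "exp \<dots> = 1 / real (p n) ^ 2" by (simp only: exp_minus p2 inverse_eq_divide)
    finally have "real (p n) powr (- 2 * real (d n) / real (k n)) * exp (- 2 * \<zeta> n) = 1 / real (p n) ^ 2" .
    then show "2 * pi ^ 2 / real (p n) ^ 2 =
       2 * pi ^ 2 * real (p n) powr (- 2 * real (d n) / real (k n)) * exp (- 2 * \<zeta> n)"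
      by (simp only: mult.assoc) simp
  qed
qed

end
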